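(* Let $m\ge 0$ be an integer and $p>1$. Let $\Omega\subset\mathbb{R}^d$ be a bounded domain. Suppose the activation function $\sigma\in W^{m,\infty}(\mathbb{R})$ is non-zero and satisfies, for some constant $C_p$, the polynomial decay condition $$|\sigma^{(k)}(t)|\le C_p(1+|t|)^{-p}\qquad\text{for } 0\le k\le m .$$ Then there is a constant $C=C(p,m,\mathrm{diam}(\Omega),\sigma)$, depending only on $p$, $m$, $\mathrm{diam}(\Omega)$ and $\sigma$, such that for every $f\in\mathcal{B}^{m+1}$ and every integer $n\ge 1$, $$\inf_{f_n\in\Sigma_d^n(\sigma)}\|f-f_n\|_{H^m(\Omega)}\le |\Omega|^{1/2}\,C(p,m,\mathrm{diam}(\Omega),\sigma)\,n^{-1/2}\,\|f\|_{\mathcal{B}^{m+1}} .$$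
   Context: For $\sigma:\mathbb{R}\to\mathbb{R}$, $\Sigma_d^n(\sigma)=\{x\mapsto\sum_{i=1}^n\beta_i\sigma(\omega_i\cdot x+b_i):\omega_i\in\mathbb{R}^d,\ b_i,\beta_i\in\mathbb{R}\}$. Fourier convention: $\hat f(\omega)=(2\pi)^{-d}\int_{\mathbb{R}^d} f(x)e^{-i\omega\cdot x}dx$, so that $f(x)=\int_{\mathbb{R}^d}e^{i\omega\cdot x}\hat f(\omega)d\omega$. The Barron norm of $f:\mathbb{R}^d\to\mathbb{R}$ is $\|f\|_{\mathcal{B}^s}=\int_{\mathbb{R}^d}(1+|\omega|)^s|\hat f(\omega)|\,d\omega$, and $\mathcal{B}^s=\{f:\|f\|_{\mathcal{B}^s}<\infty\}$ (real-valued functions whose Fourier transform is a function with this integral finite). $|\Omega|$ is the Lebesgue measure of $\Omega$, and $\|g\|_{H^m(\Omega)}=\big(\sum_{|\alpha|\le m}\|D^\alpha g\|_{L^2(\Omega)}^2\big)^{1/2}$. Derivatives $\sigma^{(k)}$ are weak derivatives, pointwise bounds hold almost everywhere, and "non-zero" means not almost everywhere zero. *)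

theory Defs
  imports "HOL-Analysis.Analysis"
begin

text \<open>
  Points of \<open>\<real>\<^sup>d\<close> are extensional functions \<open>{..<d} \<rightarrow>\<^sub>E UNIV\<close> rather than elements of a type
  indexed by its dimension, so that a constant can be chosen before \<open>d\<close> is quantified.
  The topology on them is \<open>powertop_real {..<d}\<close>.
\<close>

type_synonym vec = "nat \<Rightarrow> real"

definition space_R :: "nat \<Rightarrow> vec set" where
  "space_R d = ({..<d} \<rightarrow>\<^sub>E UNIV)"

definition leb :: "nat \<Rightarrow> vec measure" where
  "leb d = completion (\<Pi>\<^sub>M i\<in>{..<d}. (lborel :: real measure))"

definition dotp :: "nat \<Rightarrow> vec \<Rightarrow> vec \<Rightarrow> real" where
  "dotp d x y = (\<Sum>i<d. x i * y i)"

definition enorm :: "nat \<Rightarrow> vec \<Rightarrow> real" where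
  "enorm d x = L2_set x {..<d}"

definition diam :: "nat \<Rightarrow> vec set \<Rightarrow> real" where
  "diam d S = (SUP (x, y) \<in> S \<times> S. L2_set (\<lambda>i. x i - y i) {..<d})"

definition bounded_domain :: "nat \<Rightarrow> vec set \<Rightarrow> bool" where
  "bounded_domain d \<Omega> \<longleftrightarrow>
     \<Omega> \<noteq> {} \<and> openin (powertop_real {..<d}) \<Omega> \<and> connectedin (powertop_real {..<d}) \<Omega> \<and>
     (\<exists>R. \<forall>x\<in>\<Omega>. enorm d x \<le> R)"


subsection \<open>Classical partial derivatives and test functions\<close>

definition pderiv_at :: "nat \<Rightarrow> (vec \<Rightarrow> 'a::real_normed_vector) \<Rightarrow> vec \<Rightarrow> 'a" where
  "pderiv_at i \<phi> x = vector_derivative (\<lambda>t. \<phi> (x(i := t))) (at (x i))"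

definition multi_indices :: "nat \<Rightarrow> (nat \<Rightarrow> nat) set" where
  "multi_indices d = ({..<d} \<rightarrow>\<^sub>E UNIV)"

definition mi_order :: "nat \<Rightarrow> (nat \<Rightarrow> nat) \<Rightarrow> nat" where
  "mi_order d \<alpha> = (\<Sum>i<d. \<alpha> i)"

definition mderiv :: "nat \<Rightarrow> (nat \<Rightarrow> nat) \<Rightarrow> (vec \<Rightarrow> 'a::real_normed_vector) \<Rightarrow> vec \<Rightarrow> 'a" where
  "mderiv d \<alpha> \<phi> = fold (\<lambda>i. pderiv_at i ^^ \<alpha> i) [0..<d] \<phi>"

definition smooth :: "nat \<Rightarrow> (vec \<Rightarrow> 'a::real_normed_vector) \<Rightarrow> bool" where
  "smooth d \<phi> \<longleftrightarrow>
     (\<forall>js. set js \<subseteq> {..<d} \<longrightarrow>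
        continuous_map (powertop_real {..<d}) euclidean (fold pderiv_at js \<phi>) \<and>
        (\<forall>x\<in>space_R d. \<forall>i<d. (\<lambda>t. fold pderiv_at js \<phi> (x(i := t))) differentiable at (x i)))"

definition test_fun :: "nat \<Rightarrow> vec set \<Rightarrow> (vec \<Rightarrow> real) \<Rightarrow> bool" where
  "test_fun d \<Omega> \<phi> \<longleftrightarrow> smooth d \<phi> \<and>
     (\<exists>K. compactin (powertop_real {..<d}) K \<and> K \<subseteq> \<Omega> \<and> (\<forall>x\<in>space_R d - K. \<phi> x = 0))"

definition schwartz :: "nat \<Rightarrow> (vec \<Rightarrow> complex) \<Rightarrow> bool" where
  "schwartz d \<phi> \<longleftrightarrow> smooth d \<phi> \<and>
     (\<forall>\<alpha>\<in>multi_indices d. \<forall>k::nat. \<exists>B. \<forall>x\<in>space_R d. (1 + enorm d x) ^ k * norm (mderiv d \<alpha> \<phi> x) \<le> B)"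


subsection \<open>Weak derivatives and the Sobolev norm of \<open>H\<^sup>m(\<Omega>)\<close>\<close>

definition locally_integrable :: "nat \<Rightarrow> vec set \<Rightarrow> (vec \<Rightarrow> real) \<Rightarrow> bool" where
  "locally_integrable d \<Omega> g \<longleftrightarrow>
     (\<forall>K. compactin (powertop_real {..<d}) K \<and> K \<subseteq> \<Omega> \<longrightarrow> set_integrable (leb d) K g)"

definition is_weak_deriv ::
    "nat \<Rightarrow> vec set \<Rightarrow> (nat \<Rightarrow> nat) \<Rightarrow> (vec \<Rightarrow> real) \<Rightarrow> (vec \<Rightarrow> real) \<Rightarrow> bool" where
  "is_weak_deriv d \<Omega> \<alpha> g v \<longleftrightarrow>
     locally_integrable d \<Omega> g \<and> locally_integrable d \<Omega> v \<and>
     (\<forall>\<phi>. test_fun d \<Omega> \<phi> \<longrightarrow>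
        (LINT x:\<Omega>|leb d. g x * mderiv d \<alpha> \<phi> x) =
        (- 1) ^ mi_order d \<alpha> * (LINT x:\<Omega>|leb d. v x * \<phi> x))"

text \<open>Weak derivatives are unique up to null sets, so the choice below is immaterial.\<close>

definition weak_deriv :: "nat \<Rightarrow> vec set \<Rightarrow> (nat \<Rightarrow> nat) \<Rightarrow> (vec \<Rightarrow> real) \<Rightarrow> vec \<Rightarrow> real" where
  "weak_deriv d \<Omega> \<alpha> g = (SOME v. is_weak_deriv d \<Omega> \<alpha> g v)"

definition in_H :: "nat \<Rightarrow> nat \<Rightarrow> vec set \<Rightarrow> (vec \<Rightarrow> real) \<Rightarrow> bool" where
  "in_H d m \<Omega> g \<longleftrightarrow>
     (\<forall>\<alpha>\<in>multi_indices d. mi_order d \<alpha> \<le> m \<longrightarrow>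
        (\<exists>v. is_weak_deriv d \<Omega> \<alpha> g v) \<and>
        set_integrable (leb d) \<Omega> (\<lambda>x. (weak_deriv d \<Omega> \<alpha> g x)\<^sup>2))"

definition H_norm :: "nat \<Rightarrow> nat \<Rightarrow> vec set \<Rightarrow> (vec \<Rightarrow> real) \<Rightarrow> ennreal" where
  "H_norm d m \<Omega> g =
     (if in_H d m \<Omega> g
      then ennreal (sqrt (\<Sum>\<alpha> | \<alpha> \<in> multi_indices d \<and> mi_order d \<alpha> \<le> m.
                            LINT x:\<Omega>|leb d. (weak_deriv d \<Omega> \<alpha> g x)\<^sup>2))
      else \<infinity>)"


subsection \<open>Weak derivatives on the real line and \<open>W\<^bsup>m,\<infinity>\<^esup>(\<real>)\<close>\<close>

definition test_fun1 :: "(real \<Rightarrow> real) \<Rightarrow> bool" where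
  "test_fun1 \<phi> \<longleftrightarrow>
     (\<forall>k t. (deriv ^^ k) \<phi> field_differentiable at t) \<and> (\<exists>R. \<forall>t. \<bar>t\<bar> > R \<longrightarrow> \<phi> t = 0)"

definition locally_integrable1 :: "(real \<Rightarrow> real) \<Rightarrow> bool" where
  "locally_integrable1 g \<longleftrightarrow> (\<forall>K. compact K \<longrightarrow> set_integrable lebesgue K g)"

definition is_weak_deriv1 :: "nat \<Rightarrow> (real \<Rightarrow> real) \<Rightarrow> (real \<Rightarrow> real) \<Rightarrow> bool" where
  "is_weak_deriv1 k g v \<longleftrightarrow>
     locally_integrable1 g \<and> locally_integrable1 v \<and>
     (\<forall>\<phi>. test_fun1 \<phi> \<longrightarrow>
        (LINT t|lebesgue. g t * (deriv ^^ k) \<phi> t) = (- 1) ^ k * (LINT t|lebesgue. v t * \<phi> t))"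

definition weak_deriv1 :: "nat \<Rightarrow> (real \<Rightarrow> real) \<Rightarrow> real \<Rightarrow> real" where
  "weak_deriv1 k g = (SOME v. is_weak_deriv1 k g v)"

definition W_inf :: "nat \<Rightarrow> (real \<Rightarrow> real) set" where
  "W_inf m = {g. \<forall>k\<le>m. (\<exists>v. is_weak_deriv1 k g v) \<and>
                 (\<exists>B. AE t in lebesgue. \<bar>weak_deriv1 k g t\<bar> \<le> B)}"


subsection \<open>Fourier transform and Barron spaces\<close>

definition fourier :: "nat \<Rightarrow> (vec \<Rightarrow> complex) \<Rightarrow> vec \<Rightarrow> complex" where
  "fourier d \<phi> \<omega> =
     complex_of_real (1 / (2 * pi) ^ d) *
       (LINT x|leb d. \<phi> x * exp (- (\<i> * complex_of_real (dotp d \<omega> x))))"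

text \<open>
  Elements of a Barron space need not be integrable, so their Fourier transform is taken in the
  sense of tempered distributions, \<open>\<langle>f, \<phi>^\<rangle> = \<langle>f^, \<phi>\<rangle>\<close> for all Schwartz functions \<open>\<phi>\<close>, with the
  same normalisation as \<^const>\<open>fourier\<close>; it is required to be a function \<open>g\<close>.
  As \<open>\<phi>^\<close> ranges over all Schwartz functions, the first integrability condition says that \<open>f\<close>
  acts by integration on the Schwartz space. It excludes no relevant function:
  an integrable \<open>f^\<close> makes \<open>f\<close> almost everywhere bounded.
\<close>

definition is_fourier_transform :: "nat \<Rightarrow> (vec \<Rightarrow> real) \<Rightarrow> (vec \<Rightarrow> complex) \<Rightarrow> bool" where
  "is_fourier_transform d f g \<longleftrightarrow>
     f \<in> borel_measurable (leb d) \<and> g \<in> borel_measurable (leb d) \<and>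
     (\<forall>\<phi>. schwartz d \<phi> \<longrightarrow>
        integrable (leb d) (\<lambda>x. complex_of_real (f x) * fourier d \<phi> x) \<and>
        integrable (leb d) (\<lambda>\<omega>. g \<omega> * \<phi> \<omega>) \<and>
        (LINT x|leb d. complex_of_real (f x) * fourier d \<phi> x) = (LINT \<omega>|leb d. g \<omega> * \<phi> \<omega>))"

definition fourier_transform :: "nat \<Rightarrow> (vec \<Rightarrow> real) \<Rightarrow> vec \<Rightarrow> complex" where
  "fourier_transform d f = (SOME g. is_fourier_transform d f g)"

definition barron_norm :: "nat \<Rightarrow> real \<Rightarrow> (vec \<Rightarrow> real) \<Rightarrow> ennreal" where
  "barron_norm d s f =
     (if \<exists>g. is_fourier_transform d f g
      then \<integral>\<^sup>+ \<omega>. ennreal ((1 + enorm d \<omega>) powr s * norm (fourier_transform d f \<omega>)) \<partial>leb d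
      else \<infinity>)"

definition barron_space :: "nat \<Rightarrow> real \<Rightarrow> (vec \<Rightarrow> real) set" where
  "barron_space d s = {f. barron_norm d s f < \<infinity>}"


subsection \<open>Shallow networks\<close>

definition shallow_nets :: "nat \<Rightarrow> nat \<Rightarrow> (real \<Rightarrow> real) \<Rightarrow> (vec \<Rightarrow> real) set" where
  "shallow_nets d n \<sigma> =
     {(\<lambda>x. \<Sum>i<n. \<beta> i * \<sigma> (dotp d (\<omega> i) x + b i)) | \<beta> \<omega> b. \<forall>i<n. \<omega> i \<in> space_R d}"

end

theory Submission
  imports Defs "HOL-Probability.Levy"
begin

text \<open>
  Since \<open>\<sigma>\<close> is integrable and non-zero, its Fourier transform does not vanish at some frequency
  \<open>a \<noteq> 0\<close>, so every plane wave is a superposition of translates of a ridge function,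
  \<open>\<kappa> exp (i \<omega>\<cdot>x) = \<integral> \<sigma> (\<tau> \<omega>\<cdot>x + b) exp (i a b) db\<close> with \<open>\<tau> = - 1 / a\<close>. Fourier inversion then writes
  \<open>f\<close> on \<open>\<Omega>\<close> as an integral of ridge functions over \<open>(\<omega>, b)\<close>. The decay of \<open>\<sigma>\<close> and its derivatives
  bounds the integrand and its derivatives up to order \<open>m\<close>, uniformly on \<open>\<Omega>\<close>, by a multiple of the
  density \<open>(1 + \<bar>\<tau> \<omega>\<bar>)\<^sup>m \<bar>f^ \<omega>\<bar> h (\<omega>, b)\<close>, where \<open>\<integral> h db\<close> grows linearly in \<open>\<bar>\<omega>\<bar>\<close>; the total mass is
  therefore controlled by the Barron norm of order \<open>m + 1\<close>. Sampling \<open>n\<close> ridge functions from the normalised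
  density gives the rate \<open>n\<^sup>-\<^sup>1\<^sup>/\<^sup>2\<close>. The samples are chosen greedily, one after the other, and the weak
  derivatives of \<open>f\<close> are obtained as means of those of the ridge functions.
\<close>

subsection \<open>Uniqueness of Fourier transforms\<close>

text \<open>Three obstacles shape the proof. The constant must be independent of \<open>d\<close>:
  the squares of all derivatives are therefore bounded jointly at each point, and the sum of the
  squared monomials of degree at most \<open>m\<close> costs only a factor \<open>m + 1\<close>,
  whatever the number of multi-indices. The activation is determined only up to null sets, while a
  ridge function evaluates it on hyperplanes: the analysis uses Borel representatives bounded at
  every point, and the samples are taken outside a null set of parameters, so that
  \<open>\<sigma>\<close> can be put back at the end. Finally, \<open>weak_deriv\<close> is a choice
  and the Fourier transform of \<open>f\<close> is distributional, so uniqueness of weak derivatives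
  and an inversion formula valid almost everywhere are required. Both rest on the injectivity of the
  Fourier transform of integrable functions: bumps times characters are the test functions for the
  first, shifted Gaussians for the second.\<close>

lemmas lint_cong = Bochner_Integration.integral_cong[OF refl]
lemmas integrable_dominated = Bochner_Integration.integrable_bound

text \<open>Normalised by their common mass \<open>c\<close>, the positive and the negative part of
  \<open>w\<close> push forward along \<open>X\<close> to two probability measures with the same
  characteristic function, so Levy's uniqueness theorem applies; the frequency \<open>y = 0\<close>
  shows that the masses agree. With a general \<open>M\<close> and \<open>X\<close>, one coordinate
  of a product can be treated while the factors of the others are absorbed in the weight.\<close>

lemma real_fourier_zero:
  fixes w X :: "'a \<Rightarrow> real"
  assumes w: "integrable M w" and X: "X \<in> borel_measurable M"
    and zero: "\<And>y. (LINT x|M. w x *\<^sub>R iexp (y * X x)) = 0" and A: "A \<in> sets borel"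
  shows "(LINT x|M. w x * indicator A (X x)) = 0"
proof -
  have wm[measurable]: "w \<in> borel_measurable M" using w by auto
  note X[measurable] A[measurable]
  define c where "c = (LINT x|M. max 0 (w x))"
  have ip: "integrable M (\<lambda>x. max 0 (w x))" "integrable M (\<lambda>x. max 0 (- w x))"
    using w by (auto intro!: integrable_max)
  have w_eq: "w x = max 0 (w x) - max 0 (- w x)" for x by auto
  have iw: "integrable M (\<lambda>x. v x *\<^sub>R iexp (y * X x))" if "integrable M v" for v :: "'a \<Rightarrow> real" and y
    using that by (rule integrable_dominated) (use that in auto)
  have iA: "integrable M (\<lambda>x. v x * indicator A (X x))" if "integrable M v" for v :: "'a \<Rightarrow> real"
    using that by (rule integrable_dominated) (use that in \<open>auto simp: indicator_def\<close>)
  have eq: "(LINT x|M. max 0 (w x) *\<^sub>R iexp (y * X x)) = (LINT x|M. max 0 (- w x) *\<^sub>R iexp (y * X x))" for y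
  proof -
    have "(LINT x|M. w x *\<^sub>R iexp (y * X x))
        = (LINT x|M. max 0 (w x) *\<^sub>R iexp (y * X x) - max 0 (- w x) *\<^sub>R iexp (y * X x))"
      by (subst w_eq) (simp add: scaleR_diff_left)
    also have "\<dots> = (LINT x|M. max 0 (w x) *\<^sub>R iexp (y * X x)) - (LINT x|M. max 0 (- w x) *\<^sub>R iexp (y * X x))"
      by (intro Bochner_Integration.integral_diff iw ip)
    finally show ?thesis using zero[of y] by simp
  qed
  have c2: "c = (LINT x|M. max 0 (- w x))"
  proof -
    have "complex_of_real c = complex_of_real (LINT x|M. max 0 (- w x))"
      unfolding c_def integral_complex_of_real[symmetric] using eq[of 0] by (simp add: scaleR_conv_of_real)
    thus ?thesis by simp
  qed
  have c0: "c \<ge> 0" unfolding c_def by simp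
  show ?thesis
  proof (cases "c = 0")
    case True
    have "AE x in M. max 0 (w x) = 0" using True ip unfolding c_def by (subst (asm) integral_nonneg_eq_0_iff_AE) auto
    moreover have "AE x in M. max 0 (- w x) = 0"
      using True c2 by (subst integral_nonneg_eq_0_iff_AE[symmetric]) (auto simp: ip)
    ultimately have "AE x in M. w x * indicator A (X x) = 0" by eventually_elim auto
    thus ?thesis by (rule integral_eq_zero_AE)
  next
    case False
    hence cp: "c > 0" using c0 by simp
    define D where "D v = distr (density M (\<lambda>x. ennreal (max 0 (v x) / c))) borel X" for v :: "'a \<Rightarrow> real"
    have D: "real_distribution (D v)" "char (D v) y = (LINT x|M. max 0 (v x) *\<^sub>R iexp (y * X x)) / c"
         "measure (D v) A = (LINT x|M. max 0 (v x) * indicator A (X x)) / c"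
      if v[measurable]: "v \<in> borel_measurable M" and iv: "integrable M (\<lambda>x. max 0 (v x))" and cv: "c = (LINT x|M. max 0 (v x))"
      for v y
    proof -
      have "(\<integral>\<^sup>+ x. ennreal (max 0 (v x) / c) \<partial>M) = ennreal (LINT x|M. max 0 (v x) / c)"
        using iv cp by (intro nn_integral_eq_integral) auto
      also have "(LINT x|M. max 0 (v x) / c) = 1" using cv cp by simp
      finally have "prob_space (density M (\<lambda>x. ennreal (max 0 (v x) / c)))"
        by (intro prob_spaceI) (simp add: emeasure_density cong: nn_integral_cong)
      then interpret prob_space "density M (\<lambda>x. ennreal (max 0 (v x) / c))" .
      show r: "real_distribution (D v)" unfolding D_def by (rule real_distribution_distr) simp
      show "char (D v) y = (LINT x|M. max 0 (v x) *\<^sub>R iexp (y * X x)) / c"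
        unfolding D_def char_def using cp
        by (subst integral_distr; simp?) (subst integral_density; simp add: scaleR_conv_of_real)
      interpret D: real_distribution "D v" by fact
      have "measure (D v) A = (LINT t|D v. indicator A t)" by (simp add: D_def)
      also have "\<dots> = (LINT x|M. max 0 (v x) * indicator A (X x)) / c"
        unfolding D_def using cp
        by (subst integral_distr; simp?) (subst integral_density; simp)
      finally show "measure (D v) A = (LINT x|M. max 0 (v x) * indicator A (X x)) / c" .
    qed
    have mw: "(\<lambda>x. - w x) \<in> borel_measurable M" by simp
    have "char (D w) = char (D (\<lambda>x. - w x))"
      by (rule ext) (simp add: D(2)[OF wm ip(1) c_def] D(2)[OF mw ip(2) c2] eq del: of_real_mult)
    hence "D w = D (\<lambda>x. - w x)"
      by (intro Levy_uniqueness D(1)[OF wm ip(1) c_def] D(1)[OF mw ip(2) c2])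
    hence e: "(LINT x|M. max 0 (w x) * indicator A (X x)) = (LINT x|M. max 0 (- w x) * indicator A (X x))"
      using D(3)[OF wm ip(1) c_def] D(3)[OF mw ip(2) c2] cp by simp
    have "(LINT x|M. w x * indicator A (X x))
        = (LINT x|M. max 0 (w x) * indicator A (X x) - max 0 (- w x) * indicator A (X x))"
      by (subst w_eq) (simp add: left_diff_distrib)
    also have "\<dots> = (LINT x|M. max 0 (w x) * indicator A (X x)) - (LINT x|M. max 0 (- w x) * indicator A (X x))"
      by (intro Bochner_Integration.integral_diff iA ip)
    finally show ?thesis using e by simp
  qed
qed

text \<open>Conjugation turns the frequency \<open>y\<close> into \<open>-y\<close>, so
  \<open>cnj w\<close> satisfies the hypothesis as well, and the real and imaginary parts are
  combinations of \<open>w\<close> and \<open>cnj w\<close>.\<close>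

lemma complex_fourier_zero:
  fixes w :: "'a \<Rightarrow> complex" and X :: "'a \<Rightarrow> real"
  assumes w: "integrable M w" and X: "X \<in> borel_measurable M"
    and zero: "\<And>y. (LINT x|M. w x * iexp (y * X x)) = 0" and A: "A \<in> sets borel"
  shows "(LINT x|M. w x * indicator A (X x)) = 0"
proof -
  have [measurable]: "w \<in> borel_measurable M" using w by auto
  note X[measurable] A[measurable]
  have iw: "integrable M (\<lambda>x. v x * iexp (y * X x))" if "integrable M v" for v :: "'a \<Rightarrow> complex" and y
    using that by (rule integrable_dominated) (use that in \<open>auto simp: norm_mult\<close>)
  have icw: "integrable M (\<lambda>x. cnj (w x))" using w by simp
  have zero': "(LINT x|M. cnj (w x) * iexp (y * X x)) = 0" for y
  proof -
    have "(LINT x|M. cnj (w x) * iexp (y * X x)) = (LINT x|M. cnj (w x * iexp (- y * X x)))"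
      by (simp add: exp_cnj)
    also have "\<dots> = cnj (LINT x|M. w x * iexp (- y * X x))" by (rule Bochner_Integration.integral_cnj)
    finally show ?thesis using zero[of "-y"] by simp
  qed
  have re: "(LINT x|M. Re (w x) *\<^sub>R iexp (y * X x)) = 0" for y
  proof -
    have "(LINT x|M. Re (w x) *\<^sub>R iexp (y * X x))
       = (LINT x|M. (w x * iexp (y * X x) + cnj (w x) * iexp (y * X x)) / 2)"
      by (intro lint_cong)
         (simp add: scaleR_conv_of_real complex_add_cnj flip: distrib_right)
    also have "\<dots> = 0" using iw[OF w] iw[OF icw] by (simp add: zero zero' del: of_real_mult)
    finally show ?thesis .
  qed
  have im: "(LINT x|M. Im (w x) *\<^sub>R iexp (y * X x)) = 0" for y
  proof -
    have "(LINT x|M. Im (w x) *\<^sub>R iexp (y * X x))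
       = (LINT x|M. (w x * iexp (y * X x) - cnj (w x) * iexp (y * X x)) / (2 * \<i>))"
      by (intro lint_cong)
         (simp add: scaleR_conv_of_real complex_diff_cnj field_simps flip: left_diff_distrib)
    also have "\<dots> = 0" using iw[OF w] iw[OF icw] by (simp add: zero zero' del: of_real_mult)
    finally show ?thesis .
  qed
  have "(LINT x|M. Re (w x) * indicator A (X x)) = 0" "(LINT x|M. Im (w x) * indicator A (X x)) = 0"
    using w by (auto intro!: real_fourier_zero re im X A)
  moreover have iA: "integrable M (\<lambda>x. w x * indicator A (X x))"
    using w by (rule integrable_dominated) (auto simp: indicator_def)
  moreover have "Re (indicator A t) = indicator A t" "Im (indicator A t) = 0" for t
    by (simp_all add: indicator_def)
  ultimately show ?thesis
    by (intro complex_eqI) (simp_all flip: integral_Re integral_Im)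
qed

section \<open>Passing between a measure and its completion\<close>

lemma borel_measurable_completion_AE:
  fixes v v0 :: "'a \<Rightarrow> 'b::topological_space"
  assumes v0: "v0 \<in> borel_measurable M" and ae: "AE x in M. v x = v0 x"
  shows "v \<in> borel_measurable (completion M)"
proof (rule measurableI)
  fix A :: "'b set" assume A: "A \<in> sets borel"
  have 1: "v0 -` A \<inter> space M \<in> sets (completion M)"
    using measurable_sets[OF v0 A] by auto
  have 2: "AE x in completion M. x \<in> v0 -` A \<inter> space M \<longleftrightarrow> x \<in> v -` A \<inter> space M"
    using AE_completion[OF ae] AE_space by eventually_elim auto
  show "v -` A \<inter> space (completion M) \<in> sets (completion M)"
    using completion.in_sets_AE[OF 2 1] by simp
qed simp

lemma integral_completion_AE:
  fixes v v0 :: "'a \<Rightarrow> 'b::{banach, second_countable_topology}"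
  assumes v0: "v0 \<in> borel_measurable M" and ae: "AE x in M. v x = v0 x"
  shows "integral\<^sup>L (completion M) v = integral\<^sup>L M v0" "integrable (completion M) v \<longleftrightarrow> integrable M v0"
  using integral_cong_AE[OF borel_measurable_completion_AE[OF v0 ae] measurable_completion[OF v0] AE_completion[OF ae]]
    integrable_cong_AE[OF borel_measurable_completion_AE[OF v0 ae] measurable_completion[OF v0] AE_completion[OF ae]]
  by (simp_all add: integral_completion[OF v0] integrable_completion[OF v0])

text \<open>Fubini's theorem is applied to this product before completion; functions on
  \<open>leb d\<close> are first exchanged for Borel representatives.\<close>

abbreviation lebp :: "nat \<Rightarrow> vec measure" where
  "lebp d \<equiv> PiM {..<d} (\<lambda>_. lborel)"

interpretation lborel_family: product_sigma_finite "\<lambda>_::nat. (lborel :: real measure)"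
  by standard

interpretation lebp: sigma_finite_measure "lebp d" for d
  by (rule lborel_family.sigma_finite) simp

lemma space_lebp: "space (lebp d) = space_R d"
  by (auto simp: space_PiM space_R_def)

lemma lebp_component: "i < d \<Longrightarrow> (\<lambda>x. x i) \<in> borel_measurable (lebp d)"
  using measurable_component_singleton[of i "{..<d}" "\<lambda>_. lborel :: real measure"] by simp

text \<open>
  The characters in the hypothesis are replaced by indicator functions one coordinate at a time, which
  reduces the claim to the uniqueness of characteristic functions on the real line.
\<close>

lemma fourier_injective:
  fixes H :: "vec \<Rightarrow> complex"
  assumes H: "integrable (lebp d) H"
    and zero: "\<And>y. (LINT x|lebp d. H x * (\<Prod>i<d. iexp (y i * x i))) = 0"
  shows "AE x in lebp d. H x = 0"
proof -
  have Hm[measurable]: "H \<in> borel_measurable (lebp d)" using H by auto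
  \<comment> \<open>For \<open>k = 0\<close> this is the hypothesis, for \<open>k = d\<close> it
    concerns integrals over boxes. The frequencies \<open>y\<close> stay arbitrary in the induction
    because the one of coordinate \<open>k\<close> is varied in the step.\<close>
  have box: "(LINT x|lebp d. H x * (\<Prod>i<d. if i < k then indicator (A i) (x i) else iexp (y i * x i))) = 0"
    if "k \<le> d" "\<And>i. A i \<in> sets borel" for k A y
    using that(1)
  proof (induction k arbitrary: y)
    case 0
    then show ?case using zero by simp
  next
    case (Suc k)
    note that(2)[measurable]
    let ?h = "\<lambda>i x. if i < k then indicator (A i) (x i) else iexp (y i * x i)"
    let ?w = "\<lambda>x. H x * (\<Prod>i\<in>{..<d} - {k}. ?h i x)"
    have k: "k < d" using Suc by simp
    note lebp_component[measurable]
    have hm: "(\<lambda>x. ?h i x) \<in> borel_measurable (lebp d)" if "i < d" for i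
      using that by (cases "i < k") auto
    have wm[measurable]: "?w \<in> borel_measurable (lebp d)"
      using hm by (intro borel_measurable_times borel_measurable_prod Hm) auto
    have iw: "integrable (lebp d) ?w"
      using H
    proof (rule integrable_dominated)
      have "(\<Prod>i\<in>{..<d} - {k}. norm (?h i x)) \<le> 1" for x
        by (intro prod_le_1) (auto simp: indicator_def)
      thus "AE x in lebp d. norm (?w x) \<le> norm (H x)"
        by (auto simp: norm_mult prod_norm[symmetric] mult_left_le)
    qed measurable
    have split: "(\<Prod>i<d. f i) = f k * (\<Prod>i\<in>{..<d}-{k}. f i)" for f :: "nat \<Rightarrow> complex"
      using k by (intro prod.remove) auto
    have "(LINT x|lebp d. ?w x * indicator (A k) (x k)) = 0"
    proof (rule complex_fourier_zero[OF iw])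
      fix z
      have "(LINT x|lebp d. ?w x * iexp (z * x k)) = (LINT x|lebp d. H x *
          (\<Prod>i<d. if i < k then indicator (A i) (x i) else iexp ((y(k:=z)) i * x i)))"
        by (intro lint_cong, subst split) (auto intro!: prod.cong split: if_splits)
      also have "\<dots> = 0" using Suc by simp
      finally show "(LINT x|lebp d. ?w x * iexp (z * x k)) = 0" .
    qed (use k in auto)
    also have "(LINT x|lebp d. ?w x * indicator (A k) (x k)) =
       (LINT x|lebp d. H x * (\<Prod>i<d. if i < Suc k then indicator (A i) (x i) else iexp (y i * x i)))"
      by (intro lint_cong, subst split) (auto intro!: prod.cong split: if_splits)
    finally show ?case .
  qed
  \<comment> \<open>Boxes generate the sigma-algebra and are stable under intersection, so the
    finite measures with densities \<open>max 0 v\<close> and \<open>max 0 (- v)\<close> coincide.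
    Equal densities must both vanish, as at each point one of them is zero.\<close>
  have real0: "AE x in lebp d. v x = 0"
    if v: "integrable (lebp d) v"
      and vA: "\<And>A. (\<And>i. A i \<in> sets borel) \<Longrightarrow> (LINT x|lebp d. v x * (\<Prod>i<d. indicator (A i) (x i))) = 0"
    for v :: "vec \<Rightarrow> real"
  proof -
    have [measurable]: "v \<in> borel_measurable (lebp d)" using v by auto
    define D where "D u = density (lebp d) (\<lambda>x. ennreal (u x))" for u
    have ip: "integrable (lebp d) (\<lambda>x. max 0 (v x))" "integrable (lebp d) (\<lambda>x. max 0 (- v x))"
      using v by (auto intro!: integrable_max)
    have DE: "emeasure (D u) (Pi\<^sub>E {..<d} A) = ennreal (LINT x|lebp d. u x * (\<Prod>i<d. indicator (A i) (x i)))"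
        "emeasure (D u) (Pi\<^sub>E {..<d} A) < \<infinity>" "integrable (lebp d) (\<lambda>x. u x * (\<Prod>i<d. indicator (A i) (x i)))"
      if iu: "integrable (lebp d) u" and u0: "\<And>x. u x \<ge> 0" and A: "\<And>i. A i \<in> sets borel" for u A
    proof -
      note A[measurable]
      have [measurable]: "u \<in> borel_measurable (lebp d)" using iu by auto
      have [measurable]: "Pi\<^sub>E {..<d} A \<in> sets (lebp d)" by (intro sets_PiM_I_finite) auto
      have ind: "indicator (Pi\<^sub>E {..<d} A) x = ennreal (\<Prod>i<d. indicator (A i) (x i))" if xs: "x \<in> space (lebp d)" for x
      proof (cases "x \<in> Pi\<^sub>E {..<d} A")
        case False
        then obtain i where "i < d" "x i \<notin> A i" using xs
          by (auto simp: space_PiM PiE_iff extensional_def)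
        hence "(\<Prod>i<d. indicator (A i) (x i)) = (0::real)" by (intro prod_zero) (auto intro!: bexI[of _ i])
        thus ?thesis using False by (simp del: prod_zero_iff)
      qed (auto simp: PiE_iff)
      show iui: "integrable (lebp d) (\<lambda>x. u x * (\<Prod>i<d. indicator (A i) (x i)))"
        using iu
      proof (rule integrable_dominated)
        show "(\<lambda>x. u x * (\<Prod>i<d. indicator (A i) (x i))) \<in> borel_measurable (lebp d)"
          by (intro borel_measurable_times borel_measurable_prod) auto
        have "(\<Prod>i<d. indicator (A i) (x i)) \<le> (1::real)" "0 \<le> (\<Prod>i<d. indicator (A i) (x i) :: real)" for x
          by (intro prod_le_1 prod_nonneg; auto simp: indicator_def)+
        thus "AE x in lebp d. norm (u x * (\<Prod>i<d. indicator (A i) (x i))) \<le> norm (u x)"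
          using u0 by (auto simp: mult_left_le)
      qed
      have "emeasure (D u) (Pi\<^sub>E {..<d} A) = (\<integral>\<^sup>+ x. ennreal (u x) * indicator (Pi\<^sub>E {..<d} A) x \<partial>lebp d)"
        unfolding D_def by (intro emeasure_density) auto
      also have "\<dots> = (\<integral>\<^sup>+ x. ennreal (u x * (\<Prod>i<d. indicator (A i) (x i))) \<partial>lebp d)"
        using u0 by (intro nn_integral_cong) (simp add: ind ennreal_mult prod_nonneg)
      also have "\<dots> = ennreal (LINT x|lebp d. u x * (\<Prod>i<d. indicator (A i) (x i)))"
        using u0 iui by (intro nn_integral_eq_integral) (auto simp: prod_nonneg)
      finally show "emeasure (D u) (Pi\<^sub>E {..<d} A) = ennreal (LINT x|lebp d. u x * (\<Prod>i<d. indicator (A i) (x i)))" .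
      thus "emeasure (D u) (Pi\<^sub>E {..<d} A) < \<infinity>" by simp
    qed
    have "D (\<lambda>x. max 0 (v x)) = D (\<lambda>x. max 0 (- v x))"
    proof (rule measure_eqI_PiM_finite[where I="{..<d}" and M="\<lambda>_. lborel" and A="\<lambda>_. Pi\<^sub>E {..<d} (\<lambda>_. UNIV)"])
      fix A :: "nat \<Rightarrow> real set" assume "\<And>i. i \<in> {..<d} \<Longrightarrow> A i \<in> sets lborel"
      \<comment> \<open>Only the sides with index below \<open>d\<close> are known to be Borel;
        replacing the others by the empty set leaves the box unchanged.\<close>
      define B where "B i = (if i < d then A i else {})" for i
      have B: "B i \<in> sets borel" for i using \<open>\<And>i. i \<in> {..<d} \<Longrightarrow> A i \<in> sets lborel\<close> by (auto simp: B_def)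
      have AB: "Pi\<^sub>E {..<d} A = Pi\<^sub>E {..<d} B" by (auto simp: B_def PiE_def Pi_def)
      have "0 = (LINT x|lebp d. max 0 (v x) * (\<Prod>i<d. indicator (B i) (x i)) - max 0 (- v x) * (\<Prod>i<d. indicator (B i) (x i)))"
        by (subst vA[OF B, symmetric], intro lint_cong) (auto simp: max_def)
      also have "\<dots> = (LINT x|lebp d. max 0 (v x) * (\<Prod>i<d. indicator (B i) (x i))) - (LINT x|lebp d. max 0 (- v x) * (\<Prod>i<d. indicator (B i) (x i)))"
        by (intro Bochner_Integration.integral_diff DE(3) ip B) auto
      finally show "emeasure (D (\<lambda>x. max 0 (v x))) (Pi\<^sub>E {..<d} A) = emeasure (D (\<lambda>x. max 0 (- v x))) (Pi\<^sub>E {..<d} A)"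
        unfolding AB by (subst (1 2) DE(1)) (auto simp: ip B)
    next
      fix i :: nat
      show "emeasure (D (\<lambda>x. max 0 (v x))) (Pi\<^sub>E {..<d} (\<lambda>_. UNIV)) \<noteq> \<infinity>"
        using DE(2)[OF ip(1), of "\<lambda>_. UNIV"] by auto
      show "range (\<lambda>_::nat. Pi\<^sub>E {..<d} (\<lambda>_. UNIV)) \<subseteq> prod_algebra {..<d} (\<lambda>_. lborel)"
        by (auto intro!: prod_algebraI_finite)
    qed (auto simp: D_def space_PiM)
    hence "AE x in lebp d. ennreal (max 0 (v x)) = ennreal (max 0 (- v x))"
      unfolding D_def by (intro lebp.density_unique) auto
    thus ?thesis by eventually_elim (auto simp: max_def ennreal_eq_0_iff split: if_splits)
  qed
  have cb: "integrable (lebp d) (\<lambda>x. H x * (\<Prod>i<d. indicator (A i) (x i)))" if A: "\<And>i. A i \<in> sets borel" for A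
    using H
  proof (rule integrable_dominated)
    note A[measurable]
    show "(\<lambda>x. H x * (\<Prod>i<d. indicator (A i) (x i))) \<in> borel_measurable (lebp d)"
      by (intro borel_measurable_times borel_measurable_prod Hm) auto
    have "(\<Prod>i<d. norm (indicator (A i) (x i) :: complex)) \<le> 1" for x
      by (intro prod_le_1) (auto simp: indicator_def)
    thus "AE x in lebp d. norm (H x * (\<Prod>i<d. indicator (A i) (x i))) \<le> norm (H x)"
      by (auto simp: norm_mult prod_norm[symmetric] mult_left_le)
  qed
  have re_prod: "(\<Prod>i<d. indicator (A i) (x i)) = complex_of_real (\<Prod>i<d. indicator (A i) (x i))" for A :: "nat \<Rightarrow> real set" and x
    by (auto simp: indicator_def intro!: prod.cong)
  have b: "(LINT x|lebp d. H x * (\<Prod>i<d. indicator (A i) (x i))) = 0" if "\<And>i. A i \<in> sets borel" for A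
    using box[of d A] that by simp
  have "AE x in lebp d. Re (H x) = 0"
  proof (rule real0)
    fix A :: "nat \<Rightarrow> real set" assume A: "\<And>i. A i \<in> sets borel"
    have "(LINT x|lebp d. Re (H x) * (\<Prod>i<d. indicator (A i) (x i))) = (LINT x|lebp d. Re (H x * (\<Prod>i<d. indicator (A i) (x i))))"
      unfolding re_prod by (simp del: of_real_prod)
    also have "\<dots> = 0" by (subst integral_Re[OF cb[OF A]]) (simp add: b[OF A])
    finally show "(LINT x|lebp d. Re (H x) * (\<Prod>i<d. indicator (A i) (x i))) = 0" .
  qed (use H in auto)
  moreover have "AE x in lebp d. Im (H x) = 0"
  proof (rule real0)
    fix A :: "nat \<Rightarrow> real set" assume A: "\<And>i. A i \<in> sets borel"
    have "(LINT x|lebp d. Im (H x) * (\<Prod>i<d. indicator (A i) (x i))) = (LINT x|lebp d. Im (H x * (\<Prod>i<d. indicator (A i) (x i))))"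
      unfolding re_prod by (simp del: of_real_prod)
    also have "\<dots> = 0" by (subst integral_Im[OF cb[OF A]]) (simp add: b[OF A])
    finally show "(LINT x|lebp d. Im (H x) * (\<Prod>i<d. indicator (A i) (x i))) = 0" .
  qed (use H in auto)
  ultimately show ?thesis by eventually_elim (simp add: complex_eq_iff)
qed

subsection \<open>Smooth functions of one variable\<close>

text \<open>The derivative is quantified existentially, so closure under products, affine
  substitutions and linear maps is an induction on the order, without formulas for higher
  derivatives.\<close>

fun diffn :: "nat \<Rightarrow> (real \<Rightarrow> 'a::real_normed_vector) \<Rightarrow> bool" where
  "diffn 0 f = True"
| "diffn (Suc n) f = (\<exists>f'. (\<forall>t. (f has_vector_derivative f' t) (at t)) \<and> diffn n f')"

definition smooth1 :: "(real \<Rightarrow> 'a::real_normed_vector) \<Rightarrow> bool" where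
  "smooth1 f \<longleftrightarrow> (\<forall>n. diffn n f)"

definition vderiv :: "(real \<Rightarrow> 'a::real_normed_vector) \<Rightarrow> real \<Rightarrow> 'a" where
  "vderiv f t = vector_derivative f (at t)"

lemma diffn_SucD: "diffn (Suc n) f \<Longrightarrow> diffn n f"
proof (induction n arbitrary: f)
  case (Suc n)
  then obtain f' where "\<forall>t. (f has_vector_derivative f' t) (at t)" "diffn (Suc n) f'"
    by (auto simp del: diffn.simps(2) simp: diffn.simps(2)[of "Suc n"])
  thus ?case using Suc.IH[of f'] by auto
qed simp

lemma diffn_const: "diffn n (\<lambda>t. c)"
  by (induction n arbitrary: c) (auto intro!: exI[of _ "\<lambda>t. 0"])

lemma diffn_add: "diffn n f \<Longrightarrow> diffn n g \<Longrightarrow> diffn n (\<lambda>t. f t + g t)"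
proof (induction n arbitrary: f g)
  case (Suc n)
  from Suc.prems obtain f' g' where
    "\<forall>t. (f has_vector_derivative f' t) (at t)" "diffn n f'"
    "\<forall>t. (g has_vector_derivative g' t) (at t)" "diffn n g'" by auto
  thus ?case
    by (auto intro!: exI[of _ "\<lambda>t. f' t + g' t"] Suc.IH has_vector_derivative_add)
qed simp

lemma diffn_mult:
  fixes f g :: "real \<Rightarrow> 'a::real_normed_algebra"
  shows "diffn n f \<Longrightarrow> diffn n g \<Longrightarrow> diffn n (\<lambda>t. f t * g t)"
proof (induction n arbitrary: f g)
  case (Suc n)
  note fg = diffn_SucD[OF Suc.prems(1)] diffn_SucD[OF Suc.prems(2)]
  from Suc.prems obtain f' g' where
    "\<forall>t. (f has_vector_derivative f' t) (at t)" "diffn n f'"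
    "\<forall>t. (g has_vector_derivative g' t) (at t)" "diffn n g'" by auto
  thus ?case
    using fg by (auto intro!: exI[of _ "\<lambda>t. f t * g' t + f' t * g t"] diffn_add Suc.IH has_vector_derivative_mult)
qed simp

lemma diffn_bounded_linear:
  assumes L: "bounded_linear L"
  shows "diffn n f \<Longrightarrow> diffn n (\<lambda>t. L (f t))"
proof (induction n arbitrary: f)
  case (Suc n)
  then obtain f' where "\<forall>t. (f has_vector_derivative f' t) (at t)" "diffn n f'" by auto
  thus ?case
    by (auto intro!: exI[of _ "\<lambda>t. L (f' t)"] Suc.IH bounded_linear.has_vector_derivative[OF L])
qed simp

lemma diffn_affine:
  fixes f :: "real \<Rightarrow> 'a::real_normed_algebra_1"
  shows "diffn n f \<Longrightarrow> diffn n (\<lambda>t. f (a * t + b))"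
proof (induction n arbitrary: f)
  case (Suc n)
  then obtain f' where f': "\<forall>t. (f has_vector_derivative f' t) (at t)" "diffn n f'" by auto
  have "((\<lambda>t. f (a * t + b)) has_vector_derivative of_real a * f' (a * t + b)) (at t)" for t
  proof -
    have "((\<lambda>t. a * t + b) has_vector_derivative a) (at t)"
      by (auto intro!: derivative_eq_intros)
    from vector_diff_chain_at[OF this f'(1)[rule_format]] show ?thesis
      by (simp add: o_def scaleR_conv_of_real)
  qed
  thus ?case
    using f'(2) by (auto intro!: exI[of _ "\<lambda>t. of_real a * f' (a * t + b)"] Suc.IH diffn_mult diffn_const)
qed simp

text \<open>The equation itself raises the regularity of \<open>f\<close>: if \<open>f\<close> has
  \<open>n\<close> derivatives, so has \<open>u t * f t\<close>, which is the derivative of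
  \<open>f\<close>.\<close>

lemma diffn_ode:
  fixes f u :: "real \<Rightarrow> 'a::real_normed_algebra"
  assumes "\<And>t. (f has_vector_derivative u t * f t) (at t)" "\<And>n. diffn n u"
  shows "diffn n f"
proof (induction n)
  case (Suc n)
  thus ?case using assms by (auto intro!: exI[of _ "\<lambda>t. u t * f t"] diffn_mult)
qed simp

lemma smooth1_mult:
  fixes f g :: "real \<Rightarrow> 'a::real_normed_algebra"
  shows "smooth1 f \<Longrightarrow> smooth1 g \<Longrightarrow> smooth1 (\<lambda>t. f t * g t)"
  by (simp add: smooth1_def diffn_mult)

lemma smooth1_of_real: "smooth1 f \<Longrightarrow> smooth1 (\<lambda>t. of_real (f t) :: 'a::real_normed_algebra_1)"
  by (simp add: smooth1_def diffn_bounded_linear[OF bounded_linear_of_real])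

lemma smooth1_iexp: "smooth1 (\<lambda>t. iexp (y * t))"
  unfolding smooth1_def
proof
  fix n
  have "((\<lambda>t. iexp (y * t)) has_vector_derivative (\<i> * of_real y) * iexp (y * t)) (at t)" for t
  proof -
    have "((\<lambda>z. exp (\<i> * of_real y * z)) has_field_derivative (\<i> * of_real y) * iexp (y * t)) (at (of_real t))"
      by (auto intro!: derivative_eq_intros simp: mult.assoc)
    from has_vector_derivative_real_field[OF this] show ?thesis by (simp add: mult.assoc)
  qed
  thus "diffn n (\<lambda>t. iexp (y * t))" by (rule diffn_ode) (rule diffn_const)
qed

lemma smooth1_vderiv:
  assumes "smooth1 f"
  shows "(f has_vector_derivative vderiv f t) (at t)" "smooth1 (vderiv f)"
proof -
  have *: "(\<forall>t. (f has_vector_derivative vderiv f t) (at t)) \<and> diffn n (vderiv f)" for n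
  proof -
    obtain f' where f': "\<forall>t. (f has_vector_derivative f' t) (at t)" "diffn n f'"
      using assms[unfolded smooth1_def, rule_format, of "Suc n"] by auto
    hence "vderiv f = f'" by (auto simp: vderiv_def vector_derivative_at)
    thus ?thesis using f' by simp
  qed
  show "(f has_vector_derivative vderiv f t) (at t)" "smooth1 (vderiv f)"
    using * by (auto simp: smooth1_def)
qed

lemma smooth1_vderiv_pow: "smooth1 f \<Longrightarrow> smooth1 ((vderiv ^^ k) f)"
  by (induction k) (auto intro: smooth1_vderiv)

lemma smooth1_isCont: "smooth1 f \<Longrightarrow> isCont f t"
  using smooth1_vderiv(1) has_vector_derivative_continuous by blast

section \<open>Smooth functions that vanish on a half-line\<close>

lemma poly_abs_bound: "\<exists>C N. C \<ge> 0 \<and> (\<forall>t::real. \<bar>poly p t\<bar> \<le> C * (1 + \<bar>t\<bar>) ^ N)"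
proof (induction p)
  case 0 show ?case by (auto intro!: exI[of _ 0])
next
  case (pCons a p)
  then obtain C N where C: "C \<ge> 0" "\<And>t. \<bar>poly p t\<bar> \<le> C * (1 + \<bar>t\<bar>) ^ N" by auto
  have "\<bar>poly (pCons a p) t\<bar> \<le> (\<bar>a\<bar> + C) * (1 + \<bar>t\<bar>) ^ Suc N" for t
  proof -
    have "\<bar>poly (pCons a p) t\<bar> \<le> \<bar>a\<bar> + \<bar>t\<bar> * \<bar>poly p t\<bar>"
      by (simp add: abs_triangle_ineq[THEN order_trans] abs_mult)
    also have "\<bar>t\<bar> * \<bar>poly p t\<bar> \<le> (1 + \<bar>t\<bar>) * (C * (1 + \<bar>t\<bar>) ^ N)"
      using C by (intro mult_mono) auto
    also have "\<bar>a\<bar> \<le> \<bar>a\<bar> * (1 + \<bar>t\<bar>) ^ Suc N"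
      using one_le_power[of "1 + \<bar>t\<bar>" "Suc N"] by (simp add: mult_le_cancel_left1)
    finally show ?thesis by (simp add: algebra_simps)
  qed
  thus ?case using C(1) by (intro exI[of _ "\<bar>a\<bar> + C"] exI[of _ "Suc N"]) auto
qed

lemma power_le_fact_exp: "x \<ge> 0 \<Longrightarrow> x ^ n \<le> fact n * exp (x::real)"
proof -
  assume x: "x \<ge> 0"
  have "(\<Sum>k\<in>{n}. inverse (fact k) * x ^ k) \<le> (\<Sum>k. inverse (fact k) * x ^ k)"
    using x by (intro sum_le_suminf summable_exp) auto
  also have "\<dots> = exp x" by (simp add: exp_def)
  finally show ?thesis by (simp add: field_simps)
qed

text \<open>The classical function \<open>exp (- 1 / t)\<close>, with a polynomial factor in
  \<open>u = 1 / t\<close> that makes the family closed under differentiation: the derivative in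
  \<open>t\<close> of \<open>p(u) exp (- u)\<close> is
  \<open>(p(u) - p'(u)) u^2 exp (- u)\<close>.\<close>

definition flat :: "real poly \<Rightarrow> real \<Rightarrow> real" where
  "flat p t = (if t > 0 then poly p (1 / t) * exp (- (1 / t)) else 0)"

text \<open>In the variable \<open>s = 1 / t\<close> the exponential beats every power. Order two is
  what the derivative at \<open>0\<close> asks for: the difference quotient is then bounded by a
  multiple of \<open>\<bar>h\<bar>\<close>.\<close>

lemma flat_quadratic: "\<exists>B. \<forall>t. \<bar>flat p t\<bar> \<le> B * t\<^sup>2"
proof -
  obtain C N where C: "C \<ge> 0" "\<And>t. \<bar>poly p t\<bar> \<le> C * (1 + \<bar>t\<bar>) ^ N" using poly_abs_bound by blast
  \<comment> \<open>The power \<open>(1 + s) ^ (N + 2)\<close> is at most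
    \<open>fact (N + 2) * exp (1 + s)\<close>, and the shift by one leaves the factor
    \<open>exp 1\<close>.\<close>
  let ?B = "C * fact (N + 2) * exp 1"
  have "\<bar>flat p t\<bar> \<le> ?B * t\<^sup>2" for t
  proof (cases "t > 0")
    case True
    define s where "s = 1 / t"
    have s: "s > 0" using True by (simp add: s_def)
    have "\<bar>poly p s\<bar> * s\<^sup>2 \<le> C * (1 + s) ^ N * (1 + s)\<^sup>2"
      using C(2)[of s] C(1) s by (intro mult_mono) (auto intro!: power_mono)
    also have "\<dots> = C * (1 + s) ^ (N + 2)" by (simp add: power_add power2_eq_square)
    also have "\<dots> \<le> C * (fact (N + 2) * exp (1 + s))"
      using C(1) s by (intro mult_left_mono power_le_fact_exp) auto
    finally have "\<bar>poly p s\<bar> * exp (- s) * s\<^sup>2 \<le> ?B"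
      by (simp add: exp_add exp_minus field_simps)
    thus ?thesis using True by (simp add: flat_def s_def abs_mult power2_eq_square field_simps)
  qed (auto simp: flat_def C)
  thus ?thesis by blast
qed

lemma flat_deriv: "(flat p has_vector_derivative flat ((p - pderiv p) * [:0, 0, 1:]) t) (at t)"
proof -
  consider "t > 0" | "t < 0" | "t = 0" by linarith
  hence "(flat p has_real_derivative flat ((p - pderiv p) * [:0, 0, 1:]) t) (at t)"
  proof cases
    case 1
    have "((\<lambda>t. poly p (1 / t) * exp (- (1 / t))) has_real_derivative
        flat ((p - pderiv p) * [:0, 0, 1:]) t) (at t)"
      using 1 by (auto intro!: derivative_eq_intros poly_DERIV[THEN DERIV_chain2]
           simp: flat_def field_simps power2_eq_square)
    thus ?thesis
      by (rule DERIV_cong_ev[THEN iffD1, rotated -1, OF _ refl _ refl])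
         (use 1 in \<open>auto simp: flat_def intro!: eventually_mono[OF eventually_gt_at_top] eventually_nhds_in_open[of "{0<..}", THEN eventually_mono]\<close>)
  next
    case 2
    have "((\<lambda>t. 0) has_real_derivative 0) (at t)" by simp
    thus ?thesis using 2
      by (intro DERIV_cong_ev[THEN iffD1, OF refl _ _ \<open>((\<lambda>t. 0) has_real_derivative 0) (at t)\<close>])
         (auto simp: flat_def intro!: eventually_nhds_in_open[of "{..<0}", THEN eventually_mono])
  next
    case 3
    obtain B where B: "\<And>t. \<bar>flat p t\<bar> \<le> B * t\<^sup>2" using flat_quadratic by blast
    have "((\<lambda>h. flat p h / h) \<longlongrightarrow> 0) (at 0)"
    proof (rule Lim_null_comparison)
      show "\<forall>\<^sub>F h in at 0. norm (flat p h / h) \<le> B * \<bar>h\<bar>"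
        unfolding eventually_at
      proof (intro exI[of _ 1] conjI ballI impI)
        fix h :: real assume "h \<noteq> 0 \<and> dist h 0 < 1"
        thus "norm (flat p h / h) \<le> B * \<bar>h\<bar>"
          using B[of h] by (simp add: field_simps power2_eq_square abs_mult_self_eq flip: abs_mult)
      qed simp
      show "((\<lambda>h. B * \<bar>h\<bar>) \<longlongrightarrow> 0) (at 0)" by (auto intro!: tendsto_eq_intros)
    qed
    thus ?thesis using 3 by (simp add: DERIV_def flat_def[of _ 0])
  qed
  thus ?thesis by (simp add: has_real_derivative_iff_has_vector_derivative)
qed

lemma smooth1_flat: "smooth1 (flat p)"
proof -
  have "diffn n (flat p)" for n
    by (induction n arbitrary: p) (use flat_deriv in auto)
  thus ?thesis by (simp add: smooth1_def)
qed

subsection \<open>Products of functions of one variable\<close>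

abbreviation Rtop :: "nat \<Rightarrow> vec topology" where
  "Rtop d \<equiv> powertop_real {..<d}"

lemma topspace_Rtop: "topspace (Rtop d) = space_R d"
  by (simp add: space_R_def)

text \<open>In the space of all real sequences, open sets belong to the product sigma-algebra.
  Restriction to \<open>{..<d}\<close> is continuous and pulls \<open>S\<close> back to such an open
  set; extension by zero is a measurable right inverse of the restriction and brings it
  back.\<close>

lemma openin_sets_lebp:
  assumes "openin (Rtop d) S"
  shows "S \<in> sets (lebp d)"
proof -
  let ?r = "\<lambda>x::vec. restrict x {..<d}" and ?e = "\<lambda>x::vec. \<lambda>i. if i < d then x i else 0"
  have "continuous_map (product_topology (\<lambda>_. euclideanreal) UNIV) (Rtop d) ?r"
    by (subst continuous_map_componentwise) (auto intro: continuous_map_product_projection)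
  hence "continuous_map euclidean (Rtop d) ?r" by (simp add: euclidean_product_topology)
  from openin_continuous_map_preimage[OF this assms] have "open {x. ?r x \<in> S}"
    by simp
  hence b: "{x. ?r x \<in> S} \<in> sets (PiM UNIV (\<lambda>_. borel))"
    by (simp add: sets_PiM_equal_borel)
  have "?e \<in> measurable (lebp d) (PiM UNIV (\<lambda>_. borel))"
  proof (rule measurable_PiM_single')
    show "(\<lambda>x. if i < d then x i else 0) \<in> borel_measurable (lebp d)" for i
      by (cases "i < d") (simp_all add: lebp_component)
  qed auto
  from measurable_sets[OF this b] have "?e -` {x. ?r x \<in> S} \<inter> space (lebp d) \<in> sets (lebp d)" .
  also have "?e -` {x. ?r x \<in> S} \<inter> space (lebp d) = S"
  proof -
    have "?r (?e x) = x" if "x \<in> space_R d" for x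
      using that by (auto simp: space_R_def PiE_def extensional_def fun_eq_iff)
    thus ?thesis using openin_subset[OF assms] by (auto simp: space_lebp space_R_def)
  qed
  finally show ?thesis .
qed

lemma continuous_map_borel_lebp:
  fixes \<phi> :: "vec \<Rightarrow> 'a::topological_space"
  assumes "continuous_map (Rtop d) euclidean \<phi>"
  shows "\<phi> \<in> borel_measurable (lebp d)"
proof (rule borel_measurableI)
  fix U :: "'a set" assume "open U"
  hence "openin (Rtop d) {x \<in> topspace (Rtop d). \<phi> x \<in> U}"
    by (intro openin_continuous_map_preimage[OF assms]) simp
  from openin_sets_lebp[OF this] show "\<phi> -` U \<inter> space (lebp d) \<in> sets (lebp d)"
    by (simp add: space_lebp space_R_def vimage_def Int_def conj_commute)
qed

lemma compactin_sets_lebp: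
  assumes "compactin (Rtop d) K" shows "K \<in> sets (lebp d)"
proof -
  have "closedin (Rtop d) K"
    using assms by (intro compactin_imp_closedin) (auto simp: Hausdorff_space_product_topology)
  hence "openin (Rtop d) (space_R d - K)" by (simp add: closedin_def space_R_def)
  moreover have "K \<subseteq> space_R d" using compactin_subset_topspace[OF assms] by (simp add: space_R_def)
  ultimately have "space (lebp d) - (space_R d - K) \<in> sets (lebp d)"
    using openin_sets_lebp by blast
  moreover have "space (lebp d) - (space_R d - K) = K" using \<open>K \<subseteq> space_R d\<close> by (auto simp: space_lebp)
  ultimately show ?thesis by simp
qed

text \<open>A multi-index as a sorted list of coordinates: \<open>mderiv\<close> becomes a
  \<open>fold\<close> of first-order derivatives, the form that occurs in \<open>smooth\<close> and
  that permits induction on lists.\<close>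

definition word :: "nat \<Rightarrow> (nat \<Rightarrow> nat) \<Rightarrow> nat list" where
  "word d \<alpha> = concat (map (\<lambda>i. replicate (\<alpha> i) i) [0..<d])"

lemma fold_pderiv_mderiv:
  "mderiv d \<alpha> \<phi> = fold pderiv_at (word d \<alpha>) \<phi>"
proof -
  have r: "fold f (replicate n x) = f x ^^ n" for f :: "'b \<Rightarrow> 'c \<Rightarrow> 'c" and n x
    by (induction n) (auto simp: funpow_Suc_right simp del: funpow.simps(2))
  have "fold (\<lambda>i. pderiv_at i ^^ \<alpha> i) is \<phi> = fold pderiv_at (concat (map (\<lambda>i. replicate (\<alpha> i) i) is)) \<phi>" for "is"
    by (induction "is" arbitrary: \<phi>) (auto simp: r)
  thus ?thesis by (simp add: mderiv_def word_def)
qed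

lemma count_multi_index: "i < d \<Longrightarrow> count_list (word d \<alpha>) i = \<alpha> i"
proof -
  have r: "count_list (replicate n x) y = (if x = y then n else 0)" for n and x y :: nat
    by (induction n) auto
  have "count_list (concat (map (\<lambda>i. replicate (\<alpha> i) i) [0..<d])) i = (if i < d then \<alpha> i else 0)"
    by (induction d) (auto simp: r)
  thus "i < d \<Longrightarrow> ?thesis" by (simp add: word_def)
qed

text \<open>All test functions constructed below are of this form, up to real and imaginary parts: a
  partial derivative acts on a single factor, and integrals factorise.\<close>

definition tensor :: "nat \<Rightarrow> (nat \<Rightarrow> real \<Rightarrow> 'a::real_normed_field) \<Rightarrow> vec \<Rightarrow> 'a" where
  "tensor d \<psi> x = (\<Prod>i<d. \<psi> i (x i))"

lemma tensor_line:
  assumes "j < d"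
  shows "tensor d \<psi> (x(j := t)) = \<psi> j t * (\<Prod>i\<in>{..<d} - {j}. \<psi> i (x i))"
proof -
  have "tensor d \<psi> (x(j := t)) = \<psi> j ((x(j := t)) j) * (\<Prod>i\<in>{..<d} - {j}. \<psi> i ((x(j := t)) i))"
    unfolding tensor_def using assms by (intro prod.remove) auto
  also have "(\<Prod>i\<in>{..<d} - {j}. \<psi> i ((x(j := t)) i)) = (\<Prod>i\<in>{..<d} - {j}. \<psi> i (x i))"
    by (intro prod.cong) auto
  finally show ?thesis by (simp only: fun_upd_same)
qed

text \<open>The linear map \<open>L\<close> is carried along because test functions are real,
  whereas tensors containing characters are complex, and the real part of a product is not a product
  of real parts.\<close>

lemma tensor_line_deriv:
  assumes L: "bounded_linear L" and j: "j < d" and \<psi>: "smooth1 (\<psi> j)"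
  shows "((\<lambda>t. L (tensor d \<psi> (x(j := t)))) has_vector_derivative L (tensor d (\<psi>(j := vderiv (\<psi> j))) x)) (at (x j))"
proof -
  have "((\<lambda>t. \<psi> j t * (\<Prod>i\<in>{..<d} - {j}. \<psi> i (x i))) has_vector_derivative
      vderiv (\<psi> j) (x j) * (\<Prod>i\<in>{..<d} - {j}. \<psi> i (x i))) (at (x j))"
    by (intro has_vector_derivative_mult_left smooth1_vderiv \<psi>)
  moreover have "tensor d (\<psi>(j := vderiv (\<psi> j))) x = vderiv (\<psi> j) (x j) * (\<Prod>i\<in>{..<d} - {j}. \<psi> i (x i))"
    using tensor_line[OF j, of "\<psi>(j := vderiv (\<psi> j))" x "x j"]
    by (simp cong: prod.cong_simp)
  ultimately show ?thesis
    by (simp add: tensor_line[OF j] bounded_linear.has_vector_derivative[OF L])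
qed

text \<open>Derivatives in different coordinates act on different factors, so only the number of
  occurrences of each coordinate counts, not their order.\<close>

lemma fold_pderiv_tensor:
  assumes L: "bounded_linear L"
  shows "set js \<subseteq> {..<d} \<Longrightarrow> (\<And>i. i < d \<Longrightarrow> smooth1 (\<psi> i)) \<Longrightarrow>
    fold pderiv_at js (\<lambda>x. L (tensor d \<psi> x)) = (\<lambda>x. L (tensor d (\<lambda>i. (vderiv ^^ count_list js i) (\<psi> i)) x))"
proof (induction js arbitrary: \<psi>)
  case (Cons j js)
  let ?\<psi> = "\<psi>(j := vderiv (\<psi> j))"
  have j: "j < d" using Cons.prems by simp
  have pd: "pderiv_at j (\<lambda>x. L (tensor d \<psi> x)) = (\<lambda>x. L (tensor d ?\<psi> x))"
    using tensor_line_deriv[OF L j, of \<psi>] Cons.prems(2)[OF j]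
    by (auto simp: pderiv_at_def fun_eq_iff intro!: vector_derivative_at)
  have e: "(\<lambda>i. (vderiv ^^ count_list js i) (?\<psi> i)) = (\<lambda>i. (vderiv ^^ count_list (j # js) i) (\<psi> i))"
    by (auto simp: fun_eq_iff funpow_swap1)
  have "fold pderiv_at (j # js) (\<lambda>x. L (tensor d \<psi> x)) = fold pderiv_at js (\<lambda>x. L (tensor d ?\<psi> x))"
    by (simp only: fold_simps pd)
  also have "\<dots> = (\<lambda>x. L (tensor d (\<lambda>i. (vderiv ^^ count_list js i) (?\<psi> i)) x))"
    using Cons.prems j by (intro Cons.IH) (auto intro: smooth1_vderiv(2))
  finally show ?case by (simp only: e)
qed simp

lemma continuous_map_tensor:
  assumes "\<And>i. i < d \<Longrightarrow> smooth1 (\<psi> i)"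
  shows "continuous_map (Rtop d) euclidean (tensor d \<psi>)"
proof -
  have 1: "continuous_map (Rtop d) euclidean (\<lambda>x. \<psi> i (x i))" if "i < d" for i
  proof -
    have "continuous_map euclidean euclidean (\<psi> i)"
      using smooth1_isCont[OF assms[OF that]] by (simp add: continuous_at_imp_continuous_on)
    moreover have "continuous_map (Rtop d) euclideanreal (\<lambda>x. x i)"
      using that continuous_map_product_projection[of i "{..<d}" "\<lambda>_. euclideanreal"] by simp
    ultimately have "continuous_map (Rtop d) euclidean (\<psi> i \<circ> (\<lambda>x. x i))"
      by (intro continuous_map_compose[where X'=euclidean])
    thus ?thesis by (simp add: o_def)
  qed
  have "continuous_map (Rtop d) euclidean (\<lambda>x. \<Prod>i<k. \<psi> i (x i))" if "k \<le> d" for k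
    using that
  proof (induction k)
    case (Suc k)
    thus ?case using 1[of k] by (simp add: continuous_map_atin tendsto_mult)
  qed simp
  thus ?thesis by (simp add: tensor_def[abs_def])
qed

lemma smooth_tensor:
  assumes L: "bounded_linear L" and \<psi>: "\<And>i. i < d \<Longrightarrow> smooth1 (\<psi> i)"
  shows "smooth d (\<lambda>x. L (tensor d \<psi> x))"
  unfolding smooth_def
proof (intro allI impI conjI ballI)
  fix js assume js: "set js \<subseteq> {..<d}"
  let ?\<psi> = "\<lambda>i. (vderiv ^^ count_list js i) (\<psi> i)"
  have s: "smooth1 (?\<psi> i)" if "i < d" for i using that \<psi> by (simp add: smooth1_vderiv_pow)
  have "continuous_map euclidean euclidean L"
    using L by (simp add: linear_continuous_on)
  from continuous_map_compose[OF continuous_map_tensor this, of d ?\<psi>] s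
  show "continuous_map (Rtop d) euclidean (fold pderiv_at js (\<lambda>x. L (tensor d \<psi> x)))"
    by (simp add: fold_pderiv_tensor[OF L js \<psi>] o_def)
  fix x i assume "i < d"
  from tensor_line_deriv[OF L this, of ?\<psi> x] s[OF this]
  show "(\<lambda>t. fold pderiv_at js (\<lambda>x. L (tensor d \<psi> x)) (x(i := t))) differentiable at (x i)"
    by (simp add: fold_pderiv_tensor[OF L js \<psi>] differentiableI_vector)
qed

lemma test_fun_tensor:
  assumes L: "bounded_linear L" and \<psi>: "\<And>i. i < d \<Longrightarrow> smooth1 (\<psi> i)"
    and supp: "\<And>i t. i < d \<Longrightarrow> t \<notin> {a i..b i} \<Longrightarrow> \<psi> i t = 0" and box: "Pi\<^sub>E {..<d} (\<lambda>i. {a i..b i}) \<subseteq> \<Omega>"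
  shows "test_fun d \<Omega> (\<lambda>x. L (tensor d \<psi> x))"
  unfolding test_fun_def
proof (intro conjI exI[of _ "Pi\<^sub>E {..<d} (\<lambda>i. {a i..b i})"] ballI smooth_tensor L \<psi> box)
  show "compactin (Rtop d) (Pi\<^sub>E {..<d} (\<lambda>i. {a i..b i}))"
    by (simp add: compactin_PiE)
  fix x assume x: "x \<in> space_R d - Pi\<^sub>E {..<d} (\<lambda>i. {a i..b i})"
  then obtain i where "i < d" "x i \<notin> {a i..b i}" by (auto simp: space_R_def PiE_iff)
  hence "tensor d \<psi> x = 0" unfolding tensor_def using supp by (intro prod_zero) auto
  thus "L (tensor d \<psi> x) = 0" using L by (simp add: linear_simps)
qed

text \<open>A multiplicative bound lets the decay of a tensor be checked factor by factor.\<close>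

lemma one_plus_enorm_le: "1 + enorm d x \<le> (\<Prod>i<d. 1 + \<bar>x i\<bar>)"
proof -
  have "1 + (\<Sum>i<d. \<bar>x i\<bar>) \<le> (\<Prod>i<d. 1 + \<bar>x i\<bar>)"
  proof (induction d)
    case (Suc d)
    have "1 \<le> (\<Prod>i<d. 1 + \<bar>x i\<bar>)" by (intro prod_ge_1) auto
    hence "\<bar>x d\<bar> \<le> \<bar>x d\<bar> * (\<Prod>i<d. 1 + \<bar>x i\<bar>)" by (simp add: mult_le_cancel_left1)
    with Suc show ?case by (simp add: algebra_simps)
  qed simp
  thus ?thesis unfolding enorm_def using L2_set_le_sum_abs[of x "{..<d}"] by simp
qed

lemma enorm_nonneg: "0 \<le> enorm d x"
  by (simp add: enorm_def L2_set_nonneg)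

lemma schwartz_tensor:
  fixes \<psi> :: "nat \<Rightarrow> real \<Rightarrow> complex"
  assumes \<psi>: "\<And>i. i < d \<Longrightarrow> smooth1 (\<psi> i)"
    and dec: "\<And>i n k. i < d \<Longrightarrow> \<exists>B. \<forall>t. (1 + \<bar>t\<bar>) ^ k * norm ((vderiv ^^ n) (\<psi> i) t) \<le> B"
  shows "schwartz d (tensor d \<psi>)"
  unfolding schwartz_def
proof (intro conjI ballI allI)
  show "smooth d (tensor d \<psi>)" using smooth_tensor[OF bounded_linear_ident \<psi>] by simp
  fix \<alpha> and k :: nat
  let ?\<psi> = "\<lambda>i. (vderiv ^^ \<alpha> i) (\<psi> i)"
  have "mderiv d \<alpha> (tensor d \<psi>) = (\<lambda>x. tensor d (\<lambda>i. (vderiv ^^ count_list (word d \<alpha>) i) (\<psi> i)) x)"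
    unfolding fold_pderiv_mderiv by (rule fold_pderiv_tensor[OF bounded_linear_ident]) (auto simp: \<psi> word_def)
  also have "\<dots> = tensor d ?\<psi>"
    by (auto simp: fun_eq_iff tensor_def count_multi_index intro!: prod.cong)
  finally have *: "mderiv d \<alpha> (tensor d \<psi>) = tensor d ?\<psi>" .
  have "\<forall>i. \<exists>B. i < d \<longrightarrow> (\<forall>t. (1 + \<bar>t\<bar>) ^ k * norm (?\<psi> i t) \<le> B)"
    using dec by blast
  then obtain B where B: "\<And>i t. i < d \<Longrightarrow> (1 + \<bar>t\<bar>) ^ k * norm (?\<psi> i t) \<le> B i"
    by metis
  have "(1 + enorm d x) ^ k * norm (mderiv d \<alpha> (tensor d \<psi>) x) \<le> (\<Prod>i<d. B i)" for x
  proof -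
    have "(1 + enorm d x) ^ k * norm (mderiv d \<alpha> (tensor d \<psi>) x)
       \<le> (\<Prod>i<d. 1 + \<bar>x i\<bar>) ^ k * (\<Prod>i<d. norm (?\<psi> i (x i)))"
      unfolding * tensor_def prod_norm
      by (intro mult_right_mono power_mono one_plus_enorm_le) (auto simp: enorm_nonneg add_nonneg_nonneg)
    also have "\<dots> = (\<Prod>i<d. (1 + \<bar>x i\<bar>) ^ k * norm (?\<psi> i (x i)))"
      by (simp add: prod.distrib prod_power_distrib)
    also have "\<dots> \<le> (\<Prod>i<d. B i)" by (intro prod_mono) (auto intro: B)
    finally show ?thesis .
  qed
  thus "\<exists>B. \<forall>x\<in>space_R d. (1 + enorm d x) ^ k * norm (mderiv d \<alpha> (tensor d \<psi>) x) \<le> B" by blast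
qed

section \<open>Gaussians as Schwartz functions\<close>

definition gaussp :: "real \<Rightarrow> real poly \<Rightarrow> real \<Rightarrow> complex" where
  "gaussp y p t = of_real (poly p t * exp (- ((t - y)\<^sup>2 / 2)))"

text \<open>The polynomial factor makes the family stable under differentiation, so one decay
  estimate serves all derivatives.\<close>

lemma gaussp_deriv: "(gaussp y p has_vector_derivative gaussp y (pderiv p - [:- y, 1:] * p) t) (at t)"
proof -
  have "((\<lambda>t. poly p t * exp (- ((t - y)\<^sup>2 / 2))) has_real_derivative
      poly (pderiv p - [:- y, 1:] * p) t * exp (- ((t - y)\<^sup>2 / 2))) (at t)"
    by (auto intro!: derivative_eq_intros poly_DERIV simp: field_simps)
  hence "((\<lambda>t. poly p t * exp (- ((t - y)\<^sup>2 / 2))) has_vector_derivative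
      poly (pderiv p - [:- y, 1:] * p) t * exp (- ((t - y)\<^sup>2 / 2))) (at t)"
    by (simp add: has_real_derivative_iff_has_vector_derivative)
  from bounded_linear.has_vector_derivative[OF bounded_linear_of_real this]
  show ?thesis unfolding gaussp_def[abs_def] .
qed

lemma smooth1_gaussp: "smooth1 (gaussp y p)"
proof -
  have "diffn n (gaussp y p)" for n
    by (induction n arbitrary: p) (auto intro: gaussp_deriv simp del: mult_pCons_left)
  thus ?thesis by (simp add: smooth1_def)
qed

lemma gaussp_vderiv: "\<exists>q. (vderiv ^^ n) (gaussp y p) = gaussp y q"
proof (induction n)
  case (Suc n)
  then obtain q where "(vderiv ^^ n) (gaussp y p) = gaussp y q" by blast
  moreover have "vderiv (gaussp y q) = gaussp y (pderiv q - [:- y, 1:] * q)"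
    using gaussp_deriv by (auto simp: fun_eq_iff vderiv_def intro: vector_derivative_at)
  ultimately show ?case by auto
qed auto

text \<open>The weight is moved to the centre by \<open>1 + \<bar>t\<bar> \<le> (1 + \<bar>y\<bar>)
  * (1 + \<bar>t - y\<bar>)\<close>. For \<open>u = \<bar>t - y\<bar>\<close> and
  \<open>M = k + N\<close>, the bounds \<open>(1 + u) ^ M \<le> exp (M * u)\<close> and
  \<open>M * u \<le> M^2 / 2 + u^2 / 2\<close> follow, and the Gaussian cancels the last
  term.\<close>

lemma gaussp_decay: "\<exists>B. \<forall>t. (1 + \<bar>t\<bar>) ^ k * norm (gaussp y p t) \<le> B"
proof -
  obtain C N where C: "C \<ge> 0" "\<And>t. \<bar>poly p t\<bar> \<le> C * (1 + \<bar>t\<bar>) ^ N" using poly_abs_bound by blast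
  let ?M = "real (k + N)"
  have "(1 + \<bar>t\<bar>) ^ k * norm (gaussp y p t) \<le> C * (1 + \<bar>y\<bar>) ^ (k + N) * exp (?M\<^sup>2 / 2)" for t
  proof -
    have "(1 + \<bar>t\<bar>) ^ (k + N) \<le> ((1 + \<bar>y\<bar>) * (1 + \<bar>t - y\<bar>)) ^ (k + N)"
    proof (intro power_mono)
      have "\<bar>t\<bar> \<le> \<bar>y\<bar> + \<bar>t - y\<bar>" by simp
      moreover have "0 \<le> \<bar>y\<bar> * \<bar>t - y\<bar>" by simp
      ultimately show "1 + \<bar>t\<bar> \<le> (1 + \<bar>y\<bar>) * (1 + \<bar>t - y\<bar>)" unfolding distrib_left distrib_right by linarith
    qed simp
    also have "\<dots> = (1 + \<bar>y\<bar>) ^ (k + N) * (1 + \<bar>t - y\<bar>) ^ (k + N)" by (rule power_mult_distrib)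
    also have "(1 + \<bar>t - y\<bar>) ^ (k + N) \<le> exp \<bar>t - y\<bar> ^ (k + N)"
      by (intro power_mono exp_ge_add_one_self) simp
    also have "exp \<bar>t - y\<bar> ^ (k + N) = exp (?M * \<bar>t - y\<bar>)" by (simp only: exp_of_nat_mult)
    also have "\<dots> \<le> exp (?M\<^sup>2 / 2 + (t - y)\<^sup>2 / 2)"
    proof -
      have "?M * \<bar>t - y\<bar> \<le> ?M\<^sup>2 / 2 + (t - y)\<^sup>2 / 2"
        using sum_squares_bound[of ?M "\<bar>t - y\<bar>"] unfolding power2_abs by linarith
      thus ?thesis by (simp only: exp_le_cancel_iff)
    qed
    finally have b: "(1 + \<bar>t\<bar>) ^ (k + N) \<le> (1 + \<bar>y\<bar>) ^ (k + N) * exp (?M\<^sup>2 / 2 + (t - y)\<^sup>2 / 2)"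
      by (simp add: mult_left_mono)
    have "(1 + \<bar>t\<bar>) ^ k * norm (gaussp y p t) = (1 + \<bar>t\<bar>) ^ k * \<bar>poly p t\<bar> * exp (- ((t - y)\<^sup>2 / 2))"
      by (simp add: gaussp_def norm_mult)
    also have "\<dots> \<le> (1 + \<bar>t\<bar>) ^ k * (C * (1 + \<bar>t\<bar>) ^ N) * exp (- ((t - y)\<^sup>2 / 2))"
      by (intro mult_right_mono mult_left_mono C) auto
    also have "\<dots> = C * (1 + \<bar>t\<bar>) ^ (k + N) * exp (- ((t - y)\<^sup>2 / 2))" by (simp add: power_add mult_ac)
    also have "\<dots> \<le> C * ((1 + \<bar>y\<bar>) ^ (k + N) * exp (?M\<^sup>2 / 2 + (t - y)\<^sup>2 / 2)) * exp (- ((t - y)\<^sup>2 / 2))"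
      by (intro mult_right_mono mult_left_mono b C) auto
    also have "\<dots> = C * (1 + \<bar>y\<bar>) ^ (k + N) * exp (?M\<^sup>2 / 2)"
      by (simp add: exp_add exp_minus)
    finally show ?thesis .
  qed
  thus ?thesis by blast
qed

lemma schwartz_gauss: "schwartz d (tensor d (\<lambda>i. gaussp (y i) 1))"
proof (rule schwartz_tensor)
  fix i n k
  obtain q where "(vderiv ^^ n) (gaussp (y i) 1) = gaussp (y i) q" using gaussp_vderiv by blast
  thus "\<exists>B. \<forall>t. (1 + \<bar>t\<bar>) ^ k * norm ((vderiv ^^ n) (gaussp (y i) 1) t) \<le> B"
    using gaussp_decay by simp
qed (rule smooth1_gaussp)

subsection \<open>Fourier inversion\<close>

text \<open>Read off from the characteristic function of the standard normal distribution by a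
  translation by \<open>y\<close>.\<close>

lemma gauss_integral:
  "integrable lborel (\<lambda>t. gaussp y 1 t * iexp (x * t))" (is ?I)
  "(LINT t|lborel. gaussp y 1 t * iexp (x * t)) = of_real (sqrt (2 * pi) * exp (- (x\<^sup>2 / 2))) * iexp (x * y)" (is ?E)
proof -
  have g0: "gaussp 0 1 t = of_real (sqrt (2 * pi)) * of_real (std_normal_density t)" for t
  proof -
    have "exp (- (t\<^sup>2 / 2)) = sqrt (2 * pi) * std_normal_density t" by (simp add: std_normal_density_def)
    thus ?thesis by (simp only: gaussp_def of_real_mult[symmetric]) simp
  qed
  have mg: "gaussp y 1 \<in> borel_measurable borel" for y
    using smooth1_isCont[OF smooth1_gaussp] by (intro borel_measurable_continuous_onI) (simp add: continuous_at_imp_continuous_on)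
  note [measurable] = mg
  have i0: "integrable lborel (\<lambda>t. gaussp 0 1 t * iexp (x * t))"
  proof (rule integrable_dominated[where f="\<lambda>t. sqrt (2 * pi) * std_normal_density t"])
    show "integrable lborel (\<lambda>t. sqrt (2 * pi) * std_normal_density t)"
      using integrable_std_normal_moment[of 0] by simp
  qed (auto simp: g0 norm_mult)
  have "char std_normal_distribution x = of_real (exp (- (x\<^sup>2 / 2)))"
    by (simp add: char_std_normal_distribution)
  hence "(LINT t|lborel. std_normal_density t *\<^sub>R iexp (x * t)) = of_real (exp (- (x\<^sup>2 / 2)))"
    unfolding char_def by (subst (asm) integral_density) (auto simp: normal_density_nonneg)
  hence e0: "(LINT t|lborel. gaussp 0 1 t * iexp (x * t)) = of_real (sqrt (2 * pi) * exp (- (x\<^sup>2 / 2)))"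
    unfolding g0 mult.assoc by (simp add: scaleR_conv_of_real)
  have sh: "gaussp y 1 (y + 1 * t) * iexp (x * (y + 1 * t)) = iexp (x * y) * (gaussp 0 1 t * iexp (x * t))" for t
    by (simp add: gaussp_def algebra_simps exp_add)
  have "integrable lborel (\<lambda>t. gaussp y 1 (y + 1 * t) * iexp (x * (y + 1 * t)))"
    unfolding sh using i0 by (intro integrable_mult_right)
  thus ?I by (subst (asm) lborel_integrable_real_affine_iff) auto
  have "(LINT t|lborel. gaussp y 1 t * iexp (x * t)) = (LINT t|lborel. gaussp y 1 (y + 1 * t) * iexp (x * (y + 1 * t)))"
    by (subst lborel_integral_real_affine[of 1 _ y]) auto
  also have "\<dots> = iexp (x * y) * (LINT t|lborel. gaussp 0 1 t * iexp (x * t))"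
    unfolding sh by (rule integral_mult_right_zero)
  finally show ?E unfolding e0 by (simp only: mult.commute)
qed

lemma iexp_sum: "iexp (\<Sum>i\<in>I. f i) = (\<Prod>i\<in>I. iexp (f i))" if "finite I"
  using that by (simp add: exp_sum sum_distrib_left)

lemma iexp_dotp: "iexp (dotp d x y) = (\<Prod>i<d. iexp (x i * y i))"
  unfolding dotp_def by (rule iexp_sum) simp

lemma dotp_measurable[measurable]:
  assumes f: "f \<in> measurable M (lebp d)" and g: "g \<in> measurable M (lebp d)"
  shows "(\<lambda>x. dotp d (f x) (g x)) \<in> borel_measurable M"
  unfolding dotp_def
  using measurable_compose[OF f lebp_component] measurable_compose[OF g lebp_component]
  by (intro borel_measurable_sum borel_measurable_times) auto

lemma dotp_measurable_right: "dotp d w \<in> borel_measurable (lebp d)"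
  unfolding dotp_def using lebp_component by (intro borel_measurable_sum borel_measurable_times) auto

lemma dotp_measurable_left: "(\<lambda>w. dotp d w x) \<in> borel_measurable (lebp d)"
  unfolding dotp_def using lebp_component by (intro borel_measurable_sum borel_measurable_times) auto

lemma integral_tensor:
  fixes \<psi> :: "nat \<Rightarrow> real \<Rightarrow> complex"
  assumes "\<And>i. i < d \<Longrightarrow> integrable lborel (\<psi> i)"
  shows "integrable (lebp d) (tensor d \<psi>)" "(LINT x|lebp d. tensor d \<psi> x) = (\<Prod>i<d. LINT t|lborel. \<psi> i t)"
  unfolding tensor_def[abs_def]
  using assms by (auto intro!: lborel_family.product_integrable_prod lborel_family.product_integral_prod)

lemma gauss_integral_tensor:
  "integrable (lebp d) (\<lambda>w. tensor d (\<lambda>i. gaussp (y i) 1) w * iexp (dotp d x w))"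
  "(LINT w|lebp d. tensor d (\<lambda>i. gaussp (y i) 1) w * iexp (dotp d x w)) =
     of_real (sqrt (2 * pi) ^ d) * (tensor d (\<lambda>i. gaussp 0 1) x * iexp (dotp d x y))"
proof -
  have e: "(\<lambda>w. tensor d (\<lambda>i. gaussp (y i) 1) w * iexp (dotp d x w)) = tensor d (\<lambda>i t. gaussp (y i) 1 t * iexp (x i * t))"
    by (simp only: fun_eq_iff tensor_def iexp_dotp prod.distrib) simp
  show "integrable (lebp d) (\<lambda>w. tensor d (\<lambda>i. gaussp (y i) 1) w * iexp (dotp d x w))"
    unfolding e by (intro integral_tensor gauss_integral)
  have "(LINT w|lebp d. tensor d (\<lambda>i. gaussp (y i) 1) w * iexp (dotp d x w)) =
    (\<Prod>i<d. of_real (sqrt (2 * pi) * exp (- ((x i)\<^sup>2 / 2))) * iexp (x i * y i))"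
    unfolding e gauss_integral(2)[symmetric] by (intro integral_tensor gauss_integral)
  also have "\<dots> = of_real (sqrt (2 * pi) ^ d) * (tensor d (\<lambda>i. gaussp 0 1) x * iexp (dotp d x y))"
    unfolding iexp_dotp by (simp add: tensor_def gaussp_def prod.distrib)
  finally show "(LINT w|lebp d. tensor d (\<lambda>i. gaussp (y i) 1) w * iexp (dotp d x w)) =
     of_real (sqrt (2 * pi) ^ d) * (tensor d (\<lambda>i. gaussp 0 1) x * iexp (dotp d x y))" .
qed

lemma tensor_measurable:
  assumes "\<And>i. i < d \<Longrightarrow> smooth1 (\<psi> i)"
  shows "tensor d \<psi> \<in> borel_measurable (lebp d)"
  by (intro continuous_map_borel_lebp continuous_map_tensor assms)

lemma fourier_gauss:
  "fourier d (tensor d (\<lambda>i. gaussp (y i) 1)) x =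
     of_real (1 / sqrt (2 * pi) ^ d) * (tensor d (\<lambda>i. gaussp 0 1) x * iexp (- dotp d x y))"
proof -
  let ?\<phi> = "tensor d (\<lambda>i. gaussp (y i) 1)"
  have [measurable]: "?\<phi> \<in> borel_measurable (lebp d)" by (intro tensor_measurable smooth1_gaussp)
  have neg: "- dotp d x w = dotp d (\<lambda>i. - x i) w" for w by (simp add: dotp_def sum_negf)
  have m: "(\<lambda>w. ?\<phi> w * iexp (- dotp d x w)) \<in> borel_measurable (lebp d)"
    using dotp_measurable_right[of d x] by measurable
  have g: "tensor d (\<lambda>i. gaussp 0 1) (\<lambda>i. - x i) = tensor d (\<lambda>i. gaussp 0 1) x"
    by (simp add: tensor_def gaussp_def)
  have "fourier d ?\<phi> x = of_real (1 / (2 * pi) ^ d) * (LINT w|lebp d. ?\<phi> w * iexp (- dotp d x w))"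
    unfolding fourier_def leb_def by (subst integral_completion[symmetric, OF m]) simp
  also have "\<dots> = of_real (1 / (2 * pi) ^ d * sqrt (2 * pi) ^ d) * (tensor d (\<lambda>i. gaussp 0 1) x * iexp (- dotp d x y))"
    unfolding neg gauss_integral_tensor(2) g by (simp add: mult_ac)
  also have "1 / (2 * pi) ^ d * sqrt (2 * pi) ^ d = 1 / sqrt (2 * pi) ^ d"
  proof -
    have "(2 * pi) ^ d = sqrt (2 * pi) ^ d * sqrt (2 * pi) ^ d"
      by (subst power_mult_distrib[symmetric]) simp
    thus ?thesis by (simp add: field_simps)
  qed
  finally show ?thesis .
qed

lemma integrable_pair_kernel:
  fixes u :: "'a \<Rightarrow> complex" and v :: "'b \<Rightarrow> complex" and k :: "'a \<times> 'b \<Rightarrow> complex"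
  assumes M: "sigma_finite_measure M" "sigma_finite_measure N"
    and u: "integrable M u" and v: "integrable N v" and k: "k \<in> borel_measurable (M \<Otimes>\<^sub>M N)"
    and k1: "\<And>z. norm (k z) \<le> 1"
  shows "integrable (M \<Otimes>\<^sub>M N) (\<lambda>(x, y). u x * v y * k (x, y))"
proof -
  interpret M: sigma_finite_measure M by fact
  interpret N: sigma_finite_measure N by fact
  interpret pair_sigma_finite M N ..
  have [measurable]: "u \<in> borel_measurable M" "v \<in> borel_measurable N" using u v by auto
  note k[measurable]
  have "integrable (M \<Otimes>\<^sub>M N) (\<lambda>(x, y). u x * v y)"
  proof (rule Fubini_integrable)
    show "integrable M (\<lambda>x. LINT y|N. norm (case (x, y) of (x, y) \<Rightarrow> u x * v y))"
      using u by (simp add: norm_mult)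
  qed (use v in auto)
  thus ?thesis
  proof (rule integrable_dominated)
    show "AE z in M \<Otimes>\<^sub>M N. norm (case z of (x, y) \<Rightarrow> u x * v y * k (x, y)) \<le> norm (case z of (x, y) \<Rightarrow> u x * v y)"
      using k1 by (intro AE_I2) (auto simp: norm_mult intro!: mult_left_le)
  qed measurable
qed

text \<open>
  Tested against shifted Gaussians: their Fourier transforms are a fixed Gaussian times the characters,
  so that injectivity of the Fourier transform of integrable functions applies to the difference of both sides.
\<close>

lemma fourier_inversion:
  assumes ft: "is_fourier_transform d f g"
    and g0: "AE w in lebp d. g w = g0 w" "integrable (lebp d) g0"
  shows "AE x in lebp d. of_real (f x) = (LINT w|lebp d. g0 w * iexp (dotp d w x))"
proof -
  have g0m[measurable]: "g0 \<in> borel_measurable (lebp d)" using g0 by auto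
  have fm: "f \<in> borel_measurable (completion (lebp d))" using ft by (simp add: is_fourier_transform_def leb_def)
  obtain f0 where f0[measurable]: "f0 \<in> borel_measurable (lebp d)" and f0_eq: "AE x in lebp d. f x = f0 x"
    using completion_ex_borel_measurable_real[OF fm] by blast
  define F where "F x = (LINT w|lebp d. g0 w * iexp (dotp d w x))" for x
  have kerm: "(\<lambda>(w, x). iexp (dotp d w x)) \<in> borel_measurable (lebp d \<Otimes>\<^sub>M lebp d)" by measurable
  have Fm[measurable]: "F \<in> borel_measurable (lebp d)"
    unfolding F_def by measurable
  have Fb: "norm (F x) \<le> (LINT w|lebp d. norm (g0 w))" for x
    unfolding F_def by (rule integral_norm_bound[THEN order_trans]) (simp add: norm_mult)
  let ?G = "tensor d (\<lambda>i. gaussp 0 1)"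
  define c :: complex where "c = of_real (1 / sqrt (2 * pi) ^ d)"
  have Gi: "integrable (lebp d) ?G"
    using gauss_integral[of 0 0] by (intro integral_tensor) simp
  have [measurable]: "?G \<in> borel_measurable (lebp d)" using Gi by auto
  have c0: "c \<noteq> 0" by (simp add: c_def)
  have sf: "sigma_finite_measure (lebp d)" by unfold_locales
  interpret pair_sigma_finite "lebp d" "lebp d" ..
  have FT: "integrable (lebp d) (\<lambda>x. of_real (f0 x) * (?G x * iexp (- dotp d x y)))"
       "c * (LINT x|lebp d. of_real (f0 x) * (?G x * iexp (- dotp d x y))) = (LINT w|lebp d. g0 w * tensor d (\<lambda>i. gaussp (y i) 1) w)" for y
  proof -
    let ?\<phi> = "tensor d (\<lambda>i. gaussp (y i) 1)"
    have [measurable]: "?\<phi> \<in> borel_measurable (lebp d)" by (intro tensor_measurable smooth1_gaussp)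
    have [measurable]: "(\<lambda>x. dotp d x y) \<in> borel_measurable (lebp d)" by (rule dotp_measurable_left)
    have s: "integrable (leb d) (\<lambda>x. of_real (f x) * fourier d ?\<phi> x)"
      "(LINT x|leb d. of_real (f x) * fourier d ?\<phi> x) = (LINT w|leb d. g w * ?\<phi> w)"
      "integrable (leb d) (\<lambda>w. g w * ?\<phi> w)" "g \<in> borel_measurable (leb d)"
      using ft schwartz_gauss[of d y] by (auto simp: is_fourier_transform_def)
    have ae: "AE x in lebp d. of_real (f x) * fourier d ?\<phi> x = c * (of_real (f0 x) * (?G x * iexp (- dotp d x y)))"
      using f0_eq by eventually_elim (simp add: fourier_gauss c_def)
    have m: "(\<lambda>x. c * (of_real (f0 x) * (?G x * iexp (- dotp d x y)))) \<in> borel_measurable (lebp d)" by measurable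
    note FC = integral_completion_AE[OF m ae]
    have i: "integrable (lebp d) (\<lambda>x. c * (of_real (f0 x) * (?G x * iexp (- dotp d x y))))"
      using s(1) by (simp only: leb_def FC)
    thus "integrable (lebp d) (\<lambda>x. of_real (f0 x) * (?G x * iexp (- dotp d x y)))"
      using integrable_mult_right[OF i, of "inverse c"] c0 by (simp add: mult.assoc[symmetric])
    have m2: "(\<lambda>w. g0 w * ?\<phi> w) \<in> borel_measurable (lebp d)" by measurable
    have "c * (LINT x|lebp d. of_real (f0 x) * (?G x * iexp (- dotp d x y)))
      = (LINT x|lebp d. c * (of_real (f0 x) * (?G x * iexp (- dotp d x y))))"
      by (rule integral_mult_right_zero[symmetric])
    also have "\<dots> = (LINT w|leb d. g w * ?\<phi> w)"
      using FC(1) s(2) by (simp only: leb_def)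
    also have "\<dots> = (LINT w|lebp d. g0 w * ?\<phi> w)"
    proof -
      have "AE w in lebp d. g w * ?\<phi> w = g0 w * ?\<phi> w" using g0(1) by eventually_elim simp
      from integral_completion_AE(1)[OF m2 this] show ?thesis by (simp only: leb_def)
    qed
    finally show "c * (LINT x|lebp d. of_real (f0 x) * (?G x * iexp (- dotp d x y))) = (LINT w|lebp d. g0 w * ?\<phi> w)" .
  qed
  \<comment> \<open>The same identity with \<open>F\<close> for \<open>f0\<close>. Fubini moves the
    integral over \<open>x\<close> inside, where it transforms \<open>?G\<close> at the frequency
    \<open>w - y\<close>; up to a constant the result is the Gaussian in \<open>w\<close> centred at
    \<open>y\<close>.\<close>
  have FF: "integrable (lebp d) (\<lambda>x. F x * (?G x * iexp (- dotp d x y)))"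
       "c * (LINT x|lebp d. F x * (?G x * iexp (- dotp d x y))) = (LINT w|lebp d. g0 w * tensor d (\<lambda>i. gaussp (y i) 1) w)" for y
  proof -
    have [measurable]: "(\<lambda>x. dotp d x y) \<in> borel_measurable (lebp d)" by (rule dotp_measurable_left)
    let ?k = "\<lambda>(w, x). iexp (dotp d w x) * iexp (- dotp d x y)"
    have km: "?k \<in> borel_measurable (lebp d \<Otimes>\<^sub>M lebp d)" by measurable
    have ik: "integrable (lebp d \<Otimes>\<^sub>M lebp d) (\<lambda>(w, x). g0 w * ?G x * ?k (w, x))"
      by (rule integrable_pair_kernel[OF sf sf g0(2) Gi km]) (auto simp: norm_mult)
    have "(LINT x|lebp d. F x * (?G x * iexp (- dotp d x y))) = (LINT x|lebp d. LINT w|lebp d. g0 w * ?G x * ?k (w, x))"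
    proof (intro lint_cong)
      fix x
      have "F x * (?G x * iexp (- dotp d x y)) = (LINT w|lebp d. (g0 w * iexp (dotp d w x)) * (?G x * iexp (- dotp d x y)))"
        unfolding F_def by (rule integral_mult_left_zero[symmetric])
      also have "\<dots> = (LINT w|lebp d. g0 w * ?G x * ?k (w, x))"
        by (intro lint_cong) (simp add: mult_ac)
      finally show "F x * (?G x * iexp (- dotp d x y)) = (LINT w|lebp d. g0 w * ?G x * ?k (w, x))" .
    qed
    also have "\<dots> = (LINT w|lebp d. LINT x|lebp d. g0 w * ?G x * ?k (w, x))"
      by (rule Fubini_integral) (use ik in simp)
    also have "\<dots> = (LINT w|lebp d. of_real (sqrt (2 * pi) ^ d) * (g0 w * tensor d (\<lambda>i. gaussp (y i) 1) w))"
    proof (intro lint_cong)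
      fix w
      have "(LINT x|lebp d. g0 w * ?G x * ?k (w, x)) = g0 w * (LINT x|lebp d. ?G x * iexp (dotp d (\<lambda>i. w i - y i) x))"
      proof (subst integral_mult_right_zero[symmetric], intro lint_cong)
        fix x
        have "dotp d (\<lambda>i. w i - y i) x = dotp d w x + - dotp d x y"
          by (simp add: dotp_def algebra_simps sum_subtractf)
        hence "iexp (dotp d (\<lambda>i. w i - y i) x) = iexp (dotp d w x) * iexp (- dotp d x y)"
          by (simp only: of_real_add distrib_left exp_add)
        thus "g0 w * ?G x * ?k (w, x) = g0 w * (?G x * iexp (dotp d (\<lambda>i. w i - y i) x))"
          by (simp only: prod.case mult_ac)
      qed
      also have "\<dots> = g0 w * (of_real (sqrt (2 * pi) ^ d) * (?G (\<lambda>i. w i - y i)))"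
        using gauss_integral_tensor(2)[of d "\<lambda>_. 0" "\<lambda>i. w i - y i"] by (simp add: dotp_def)
      also have "?G (\<lambda>i. w i - y i) = tensor d (\<lambda>i. gaussp (y i) 1) w"
        by (simp add: tensor_def gaussp_def)
      finally show "(LINT x|lebp d. g0 w * ?G x * ?k (w, x)) = of_real (sqrt (2 * pi) ^ d) * (g0 w * tensor d (\<lambda>i. gaussp (y i) 1) w)"
        by simp
    qed
    finally show "c * (LINT x|lebp d. F x * (?G x * iexp (- dotp d x y))) = (LINT w|lebp d. g0 w * tensor d (\<lambda>i. gaussp (y i) 1) w)"
      by (simp add: c_def)
    have "integrable (lebp d) (\<lambda>x. of_real (LINT w|lebp d. norm (g0 w)) * ?G x)"
      using Gi by simp
    thus "integrable (lebp d) (\<lambda>x. F x * (?G x * iexp (- dotp d x y)))"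
    proof (rule integrable_dominated)
      show "AE x in lebp d. norm (F x * (?G x * iexp (- dotp d x y))) \<le> norm (of_real (LINT w|lebp d. norm (g0 w)) * ?G x)"
        using Fb by (auto simp: norm_mult intro!: mult_right_mono AE_I2 order_trans[OF Fb])
    qed measurable
  qed
  \<comment> \<open>\<open>f0\<close> itself is not known to be integrable, but its product with
    \<open>?G\<close> is; since \<open>?G\<close> has no zeros, it can be divided out at the
    end.\<close>
  define H where "H x = (of_real (f0 x) - F x) * ?G x" for x
  have HH: "integrable (lebp d) (\<lambda>x. H x * iexp (- dotp d x y))" "(LINT x|lebp d. H x * iexp (- dotp d x y)) = 0" for y
  proof -
    have e: "H x * iexp (- dotp d x y) = of_real (f0 x) * (?G x * iexp (- dotp d x y)) - F x * (?G x * iexp (- dotp d x y))" for x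
      by (simp add: H_def algebra_simps)
    show "integrable (lebp d) (\<lambda>x. H x * iexp (- dotp d x y))"
      unfolding e by (intro Bochner_Integration.integrable_diff FT FF)
    have "c * (LINT x|lebp d. H x * iexp (- dotp d x y)) = 0"
      unfolding e by (subst Bochner_Integration.integral_diff[OF FT(1) FF(1)], subst right_diff_distrib, subst FT, subst FF) simp
    thus "(LINT x|lebp d. H x * iexp (- dotp d x y)) = 0" using c0 by simp
  qed
  have H0: "AE x in lebp d. H x = 0"
  proof (rule fourier_injective)
    show "integrable (lebp d) H" using HH(1)[of "\<lambda>_. 0"] by (simp add: dotp_def)
    fix y
    have "(\<Prod>i<d. iexp (y i * x i)) = iexp (- dotp d x (\<lambda>i. - y i))" for x
    proof -
      have "- dotp d x (\<lambda>i. - y i) = dotp d y x" by (simp add: dotp_def sum_negf mult.commute)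
      thus ?thesis by (simp only: iexp_dotp)
    qed
    thus "(LINT x|lebp d. H x * (\<Prod>i<d. iexp (y i * x i))) = 0" using HH(2)[of "\<lambda>i. - y i"] by simp
  qed
  have G0: "?G x \<noteq> 0" for x by (simp add: tensor_def gaussp_def)
  from H0 f0_eq show ?thesis
  proof eventually_elim
    case (elim x)
    thus ?case using G0[of x] by (auto simp: H_def F_def)
  qed
qed

subsection \<open>Weak derivatives on the real line\<close>

lemma vderiv_eq_deriv: "vderiv f = deriv f"
  by (simp add: vderiv_def field_derivative_eq_vector_derivative fun_eq_iff)

lemma test_fun1_iff_smooth1: "test_fun1 \<phi> \<longleftrightarrow> smooth1 \<phi> \<and> (\<exists>R. \<forall>t. \<bar>t\<bar> > R \<longrightarrow> \<phi> t = 0)"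
proof -
  have "smooth1 \<phi>" if *: "\<forall>k t. (deriv ^^ k) \<phi> field_differentiable at t"
  proof -
    have "diffn n ((deriv ^^ k) \<phi>)" for n k
    proof (induction n arbitrary: k)
      case (Suc n)
      have "((deriv ^^ k) \<phi> has_vector_derivative (deriv ^^ Suc k) \<phi> t) (at t)" for t
        using field_differentiable_derivI[OF *[rule_format, of k t]]
        by (simp add: has_real_derivative_iff_has_vector_derivative)
      thus ?case using Suc[of "Suc k"] unfolding diffn.simps by blast
    qed simp
    from this[of _ 0] show ?thesis by (simp add: smooth1_def)
  qed
  moreover have "(deriv ^^ k) \<phi> field_differentiable at t" if "smooth1 \<phi>" for k t
    using smooth1_vderiv(1)[OF smooth1_vderiv_pow[OF that, of k], of t]
    unfolding vderiv_eq_deriv field_differentiable_def has_real_derivative_iff_has_vector_derivative by blast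
  ultimately show ?thesis unfolding test_fun1_def by blast
qed

lemma test_fun1_affine:
  assumes "test_fun1 \<phi>" and a: "a \<noteq> 0"
  shows "test_fun1 (\<lambda>t. \<phi> (a * t + b))"
proof -
  obtain R where R: "\<And>t. \<bar>t\<bar> > R \<Longrightarrow> \<phi> t = 0" using assms(1) by (auto simp: test_fun1_def)
  have "\<phi> (a * t + b) = 0" if "\<bar>t\<bar> > (R + \<bar>b\<bar>) / \<bar>a\<bar>" for t
  proof (rule R)
    have "R + \<bar>b\<bar> < \<bar>a * t\<bar>" using that a by (simp add: field_simps abs_mult)
    thus "R < \<bar>a * t + b\<bar>" by linarith
  qed
  thus ?thesis using assms(1) by (auto simp: test_fun1_iff_smooth1 smooth1_def intro: diffn_affine)
qed

lemma test_fun1_deriv: "test_fun1 \<phi> \<Longrightarrow> test_fun1 (deriv \<phi>)"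
proof -
  assume t: "test_fun1 \<phi>"
  then obtain R where R: "\<And>t. \<bar>t\<bar> > R \<Longrightarrow> \<phi> t = 0" by (auto simp: test_fun1_def)
  have "deriv \<phi> t = 0" if "\<bar>t\<bar> > R" for t
  proof -
    have "open {t. \<bar>t\<bar> > R}" by (intro open_Collect_less continuous_intros)
    hence "eventually (\<lambda>t. \<phi> t = 0) (nhds t)"
      using that R by (intro eventually_nhds_in_open[THEN eventually_mono]) auto
    hence "deriv \<phi> t = deriv (\<lambda>_. 0) t" by (intro deriv_cong_ev) auto
    thus ?thesis by simp
  qed
  thus ?thesis using t smooth1_vderiv(2)[of \<phi>] by (auto simp: test_fun1_iff_smooth1 vderiv_eq_deriv)
qed

lemma test_fun1_DERIV: "test_fun1 \<phi> \<Longrightarrow> (\<phi> has_real_derivative deriv \<phi> t) (at t)"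
  using smooth1_vderiv(1)[of \<phi> t]
  by (simp add: test_fun1_iff_smooth1 vderiv_eq_deriv has_real_derivative_iff_has_vector_derivative)

lemma test_fun1_isCont: "test_fun1 \<phi> \<Longrightarrow> isCont \<phi> t"
  by (rule DERIV_isCont[OF test_fun1_DERIV])

lemma test_fun1_bounded:
  assumes "test_fun1 \<phi>"
  obtains R B where "R \<ge> 0" "\<And>t. \<bar>\<phi> t\<bar> \<le> B * indicator {-R..R} t"
proof -
  obtain R where R: "\<And>t. \<bar>t\<bar> > R \<Longrightarrow> \<phi> t = 0" using assms by (auto simp: test_fun1_def)
  let ?R = "max 0 R"
  have "compact (\<phi> ` {-?R..?R})"
    using test_fun1_isCont[OF assms] by (intro compact_continuous_image continuous_at_imp_continuous_on) auto
  from compact_imp_bounded[OF this] obtain B where B: "\<forall>t\<in>{-?R..?R}. \<bar>\<phi> t\<bar> \<le> B"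
    unfolding bounded_iff by auto
  have "\<bar>\<phi> t\<bar> \<le> B * indicator {-?R..?R} t" for t
    using B[rule_format, of t] R[of t] by (cases "t \<in> {-?R..?R}") auto
  thus ?thesis by (intro that[of ?R]) auto
qed

lemma test_fun1_borel: "test_fun1 \<phi> \<Longrightarrow> \<phi> \<in> borel_measurable borel"
  using test_fun1_isCont by (intro borel_measurable_continuous_onI continuous_at_imp_continuous_on) auto

lemma test_fun1_integral_deriv:
  assumes "test_fun1 \<phi>" shows "(LINT t|lborel. deriv \<phi> t) = 0"
proof -
  obtain R B where R: "R \<ge> 0" "\<And>t. \<bar>\<phi> t\<bar> \<le> B * indicator {-R..R} t" using test_fun1_bounded[OF assms] by blast
  obtain R' B' where R': "R' \<ge> 0" "\<And>t. \<bar>deriv \<phi> t\<bar> \<le> B' * indicator {-R'..R'} t"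
    using test_fun1_bounded[OF test_fun1_deriv[OF assms]] by blast
  let ?M = "max R R' + 1"
  have "(LINT t|lborel. deriv \<phi> t) = (LINT t|lborel. deriv \<phi> t * indicator {-?M..?M} t)"
  proof (intro lint_cong)
    fix t show "deriv \<phi> t = deriv \<phi> t * indicator {-?M..?M} t"
      using R'(2)[of t] by (cases "t \<in> {-R'..R'}") (auto simp: indicator_def)
  qed
  also have "\<dots> = \<phi> ?M - \<phi> (- ?M)"
    using R(1) test_fun1_DERIV[OF assms] test_fun1_isCont[OF test_fun1_deriv[OF assms]]
    by (intro integral_FTC_Icc_real) auto
  also have "\<dots> = 0"
  proof -
    have "?M \<notin> {-R..R}" "- ?M \<notin> {-R..R}" using R(1) by auto
    moreover have "\<phi> t = 0" if "t \<notin> {-R..R}" for t using R(2)[of t] that by (simp del: atLeastAtMost_iff)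
    ultimately have "\<phi> ?M = 0" "\<phi> (- ?M) = 0" by blast+
    thus ?thesis by simp
  qed
  finally show ?thesis .
qed

text \<open>The substitution \<open>u = c + a * t\<close> produces the factor
  \<open>\<bar>a\<bar>\<close> on both sides. For \<open>a = 0\<close> both sides vanish, because
  the derivative of a test function has integral zero.\<close>

lemma affine_weak_deriv:
  assumes s: "s \<in> borel_measurable borel" "s' \<in> borel_measurable borel"
    and weak: "\<And>\<psi>. test_fun1 \<psi> \<Longrightarrow> (LINT t|lborel. s t * deriv \<psi> t) = - (LINT t|lborel. s' t * \<psi> t)"
    and \<zeta>: "test_fun1 \<zeta>"
  shows "(LINT t|lborel. s (c + a * t) * deriv \<zeta> t) = - a * (LINT t|lborel. s' (c + a * t) * \<zeta> t)"
proof (cases "a = 0")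
  case True
  thus ?thesis using test_fun1_integral_deriv[OF \<zeta>] by simp
next
  case False
  define \<psi> where "\<psi> u = \<zeta> ((1/a) * u + (- c / a))" for u
  have \<psi>: "test_fun1 \<psi>" unfolding \<psi>_def using False by (intro test_fun1_affine \<zeta>) auto
  have \<psi>c: "\<psi> (c + a * t) = \<zeta> t" for t using False by (simp add: \<psi>_def field_simps)
  have d: "a * deriv \<psi> (c + a * t) = deriv \<zeta> t" for t
  proof -
    have "((\<lambda>t. \<psi> (c + a * t)) has_real_derivative deriv \<psi> (c + a * t) * a) (at t)"
      by (rule DERIV_chain2[OF test_fun1_DERIV[OF \<psi>]]) (auto intro!: derivative_eq_intros)
    thus ?thesis unfolding \<psi>c by (simp add: DERIV_imp_deriv mult.commute)
  qed
  have "\<bar>a\<bar> * (LINT t|lborel. s (c + a * t) * deriv \<zeta> t) = (LINT u|lborel. s u * (a * deriv \<psi> u))"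
    by (subst lborel_integral_real_affine[OF False, of _ c]) (simp add: d)
  also have "\<dots> = a * (LINT u|lborel. s u * deriv \<psi> u)"
    by (subst integral_mult_right_zero[symmetric]) (simp add: mult_ac)
  also have "\<dots> = - a * (LINT u|lborel. s' u * \<psi> u)" using weak[OF \<psi>] by simp
  also have "\<dots> = \<bar>a\<bar> * (- a * (LINT t|lborel. s' (c + a * t) * \<zeta> t))"
    by (subst lborel_integral_real_affine[OF False, of _ c]) (simp add: \<psi>c)
  finally show ?thesis using False mult_left_cancel[of "\<bar>a\<bar>"] by (metis abs_eq_0)
qed

text \<open>Testing with the sets where \<open>w\<close> is positive and where it is negative
  annihilates its two parts.\<close>

lemma real_fourier_injective:
  fixes w :: "real \<Rightarrow> real"
  assumes w: "integrable lborel w" and zero: "\<And>y. (LINT t|lborel. w t *\<^sub>R iexp (y * t)) = 0"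
  shows "AE t in lborel. w t = 0"
proof -
  have [measurable]: "w \<in> borel_measurable borel" using w by auto
  have A: "(LINT t|lborel. w t * indicator A t) = 0" if "A \<in> sets borel" for A
    by (rule real_fourier_zero[OF w _ _ that]) (use zero in auto)
  have i: "integrable lborel (\<lambda>t. max 0 (w t))" "integrable lborel (\<lambda>t. max 0 (- w t))" using w by auto
  have "(LINT t|lborel. max 0 (w t)) = (LINT t|lborel. w t * indicator {t. w t > 0} t)"
    by (intro Bochner_Integration.integral_cong) (auto simp: indicator_def max_def)
  also have "\<dots> = 0" by (rule A) measurable
  finally have "AE t in lborel. max 0 (w t) = 0"
    using i by (subst integral_nonneg_eq_0_iff_AE[symmetric]) auto
  moreover have "(LINT t|lborel. max 0 (- w t)) = - (LINT t|lborel. w t * indicator {t. w t < 0} t)"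
    unfolding integral_minus[symmetric]
    by (intro Bochner_Integration.integral_cong) (auto simp: indicator_def max_def)
  hence "(LINT t|lborel. max 0 (- w t)) = 0" by (subst (asm) A) auto
  hence "AE t in lborel. max 0 (- w t) = 0"
    using i by (subst integral_nonneg_eq_0_iff_AE[symmetric]) auto
  ultimately show ?thesis by eventually_elim (auto simp: max_def split: if_splits)
qed

text \<open>Being non-zero throughout the open interval is what allows the bump to be divided out of
  an identity there.\<close>

definition bump :: "real \<Rightarrow> real \<Rightarrow> (real \<Rightarrow> real) \<Rightarrow> bool" where
  "bump a b \<psi> \<longleftrightarrow> smooth1 \<psi> \<and> (\<forall>t. 0 \<le> \<psi> t \<and> \<psi> t \<le> 1) \<and> (\<forall>t. \<psi> t \<noteq> 0 \<longleftrightarrow> t \<in> {a<..<b})"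

lemma bumpD:
  assumes "bump a b \<psi>"
  shows "smooth1 \<psi>" "a < t \<Longrightarrow> t < b \<Longrightarrow> \<psi> t \<noteq> 0" "t \<notin> {a..b} \<Longrightarrow> \<psi> t = 0" "0 \<le> \<psi> t" "\<psi> t \<le> 1"
proof -
  have z: "\<psi> t \<noteq> 0 \<longleftrightarrow> a < t \<and> t < b" using assms by (simp add: bump_def)
  thus "t \<notin> {a..b} \<Longrightarrow> \<psi> t = 0" by (meson atLeastAtMost_iff less_imp_le)
  show "a < t \<Longrightarrow> t < b \<Longrightarrow> \<psi> t \<noteq> 0" using z by simp
qed (use assms in \<open>auto simp: bump_def\<close>)

text \<open>Two flat functions are multiplied, one vanishing left of \<open>a\<close>, the other
  right of \<open>b\<close>. For \<open>b \<le> a\<close> the product is zero everywhere, in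
  accordance with the empty interval.\<close>

lemma bump_exists: "\<exists>\<psi>. bump a b \<psi>"
proof
  define \<psi> where "\<psi> t = flat 1 (1 * t + (- a)) * flat 1 ((-1) * t + b)" for t
  have "smooth1 \<psi>" using smooth1_flat[of 1] unfolding \<psi>_def smooth1_def
    by (intro allI diffn_mult diffn_affine) auto
  thus "bump a b \<psi>" by (auto simp: bump_def \<psi>_def flat_def intro!: mult_le_one)
qed

lemma smooth1_cos_sin: "smooth1 (\<lambda>t. cos (y * t) :: real)" "smooth1 (\<lambda>t. sin (y * t) :: real)"
proof -
  have "smooth1 (\<lambda>t. Re (iexp (y * t)))" "smooth1 (\<lambda>t. Im (iexp (y * t)))"
    using smooth1_iexp[of y] unfolding smooth1_def
    by (auto intro: diffn_bounded_linear[OF bounded_linear_Re] diffn_bounded_linear[OF bounded_linear_Im] simp del: of_real_mult)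
  thus "smooth1 (\<lambda>t. cos (y * t) :: real)" "smooth1 (\<lambda>t. sin (y * t) :: real)"
    by (simp_all add: Re_exp Im_exp)
qed

section \<open>Almost everywhere uniqueness on the line\<close>

lemma locally_integrable1_borel:
  assumes "locally_integrable1 g"
  obtains g0 where "g0 \<in> borel_measurable borel" "AE t in lborel. g t = g0 t"
proof -
  have "g \<in> borel_measurable lebesgue"
  proof (rule borel_measurable_LIMSEQ_metric)
    fix n :: nat
    have "set_integrable lebesgue {- real n..real n} g" using assms by (auto simp: locally_integrable1_def)
    thus "(\<lambda>t. indicator {- real n..real n} t *\<^sub>R g t) \<in> borel_measurable lebesgue"
      by (auto simp: set_integrable_def)
  next
    fix t :: real
    obtain N :: nat where "\<bar>t\<bar> \<le> real N" using real_arch_simple by blast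
    hence "eventually (\<lambda>n. indicator {- real n..real n} t *\<^sub>R g t = g t) sequentially"
      by (intro eventually_sequentiallyI[of N]) (auto simp: indicator_def)
    thus "(\<lambda>n. indicator {- real n..real n} t *\<^sub>R g t) \<longlonglongrightarrow> g t" by (rule tendsto_eventually)
  qed
  from completion_ex_borel_measurable_real[OF this] that show ?thesis by auto
qed

lemma lebesgue_integral_AE_borel:
  fixes g g0 :: "real \<Rightarrow> real"
  assumes "g0 \<in> borel_measurable borel" "AE t in lborel. g t = g0 t"
  shows "integral\<^sup>L lebesgue g = integral\<^sup>L lborel g0" "integrable lebesgue g \<longleftrightarrow> integrable lborel g0"
  using assms integral_completion_AE[of g0 lborel g] by simp_all

text \<open>Multiplied by a bump the difference becomes integrable, and bump times cosine or sine is
  a test function, so the Fourier transform of the product vanishes. This identifies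
  \<open>weak_deriv1 0 \<sigma>\<close>, which is a choice, with \<open>\<sigma>\<close>.\<close>

lemma weak_deriv1_zero_unique:
  assumes li: "locally_integrable1 g" "locally_integrable1 v"
    and eq: "\<And>\<phi>. test_fun1 \<phi> \<Longrightarrow> (LINT t|lebesgue. g t * \<phi> t) = (LINT t|lebesgue. v t * \<phi> t)"
  shows "AE t in lborel. g t = v t"
proof -
  obtain g0 where g0[measurable]: "g0 \<in> borel_measurable borel" and g0e: "AE t in lborel. g t = g0 t"
    using locally_integrable1_borel[OF li(1)] by blast
  obtain v0 where v0[measurable]: "v0 \<in> borel_measurable borel" and v0e: "AE t in lborel. v t = v0 t"
    using locally_integrable1_borel[OF li(2)] by blast
  have "AE t in lborel. - real N < t \<and> t < real N \<longrightarrow> g0 t = v0 t" for N :: nat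
  proof -
    obtain \<psi> where "bump (- real N) (real N) \<psi>" using bump_exists by blast
    note \<psi> = bumpD[OF this]
    have test: "test_fun1 (\<lambda>t. \<psi> t * f t)" if "smooth1 f" for f
    proof -
      have "\<psi> t * f t = 0" if "\<bar>t\<bar> > real N" for t using that \<psi>(3)[of t] by (auto simp: abs_if split: if_splits)
      thus ?thesis using \<psi>(1) \<open>smooth1 f\<close> by (auto simp: test_fun1_iff_smooth1 simp del: mult_eq_0_iff intro!: smooth1_mult)
    qed
    have int: "integrable lborel (\<lambda>t. h0 t * (\<psi> t * f t))" "(LINT t|lebesgue. h t * (\<psi> t * f t)) = (LINT t|lborel. h0 t * (\<psi> t * f t))"
      if h: "locally_integrable1 h" "AE t in lborel. h t = h0 t" "h0 \<in> borel_measurable borel" and f: "smooth1 f" "\<And>t. \<bar>f t\<bar> \<le> 1"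
      for h h0 f :: "real \<Rightarrow> real"
    proof -
      note h(3)[measurable]
      have [measurable]: "(\<lambda>t. \<psi> t * f t) \<in> borel_measurable borel" using test_fun1_borel[OF test[OF f(1)]] .
      have ae: "AE t in lborel. h t * (\<psi> t * f t) = h0 t * (\<psi> t * f t)" using h(2) by eventually_elim simp
      show "(LINT t|lebesgue. h t * (\<psi> t * f t)) = (LINT t|lborel. h0 t * (\<psi> t * f t))"
        by (rule lebesgue_integral_AE_borel[OF _ ae]) measurable
      have "integrable lebesgue (\<lambda>t. indicator {- real N..real N} t *\<^sub>R h t)"
        using h(1) by (auto simp: locally_integrable1_def set_integrable_def)
      moreover have "AE t in lborel. indicator {- real N..real N} t *\<^sub>R h t = indicator {- real N..real N} t * h0 t"
        using h(2) by eventually_elim simp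
      ultimately have "integrable lborel (\<lambda>t. indicator {- real N..real N} t * h0 t)"
        by (subst (asm) lebesgue_integral_AE_borel(2)) auto
      thus "integrable lborel (\<lambda>t. h0 t * (\<psi> t * f t))"
      proof (rule integrable_dominated)
        have "\<bar>h0 t * (\<psi> t * f t)\<bar> \<le> \<bar>indicator {- real N..real N} t * h0 t\<bar>" for t
        proof (cases "t \<in> {- real N..real N}")
          case True
          have "\<bar>\<psi> t * f t\<bar> \<le> 1" using \<psi>(4,5)[of t] f(2)[of t] by (simp add: abs_mult mult_le_one)
          thus ?thesis using True by (simp add: abs_mult mult_left_le)
        qed (use \<psi>(3) in auto)
        thus "AE t in lborel. norm (h0 t * (\<psi> t * f t)) \<le> norm (indicator {- real N..real N} t * h0 t)" by simp
      qed measurable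
    qed
    have z: "(LINT t|lborel. (g0 t - v0 t) * (\<psi> t * f t)) = 0" "integrable lborel (\<lambda>t. (g0 t - v0 t) * (\<psi> t * f t))"
      if f: "smooth1 f" "\<And>t. \<bar>f t\<bar> \<le> 1" for f
      using eq[OF test[OF f(1)]] int[OF li(1) g0e g0 f] int[OF li(2) v0e v0 f]
      by (simp_all add: left_diff_distrib)
    have "AE t in lborel. (g0 t - v0 t) * \<psi> t = 0"
    proof (rule real_fourier_injective)
      have c1: "smooth1 (\<lambda>t::real. 1::real)" by (simp add: smooth1_def diffn_const)
      show "integrable lborel (\<lambda>t. (g0 t - v0 t) * \<psi> t)" using z(2)[OF c1] by simp
      fix y
      have e: "((g0 t - v0 t) * \<psi> t) *\<^sub>R iexp (y * t) =
          of_real ((g0 t - v0 t) * (\<psi> t * cos (y * t))) + \<i> * of_real ((g0 t - v0 t) * (\<psi> t * sin (y * t)))" for t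
        by (simp add: complex_eq_iff Re_exp Im_exp)
      have cs: "integrable lborel (\<lambda>t. (g0 t - v0 t) * (\<psi> t * cos (y * t)))" "integrable lborel (\<lambda>t. (g0 t - v0 t) * (\<psi> t * sin (y * t)))"
         "(LINT t|lborel. (g0 t - v0 t) * (\<psi> t * cos (y * t))) = 0" "(LINT t|lborel. (g0 t - v0 t) * (\<psi> t * sin (y * t))) = 0"
        by (intro z smooth1_cos_sin; simp)+
      show "(LINT t|lborel. ((g0 t - v0 t) * \<psi> t) *\<^sub>R iexp (y * t)) = 0"
        unfolding e using cs
        by (subst Bochner_Integration.integral_add) (auto simp del: of_real_mult simp: integral_complex_of_real)
    qed
    thus ?thesis
    proof eventually_elim
      case (elim t)
      thus ?case using \<psi>(2)[of t] by auto
    qed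
  qed
  hence "AE t in lborel. \<forall>N. - real N < t \<and> t < real N \<longrightarrow> g0 t = v0 t"
    by (simp only: AE_all_countable) blast
  thus ?thesis using g0e v0e
  proof eventually_elim
    case (elim t)
    obtain N :: nat where "\<bar>t\<bar> < real N" using reals_Archimedean2 by blast
    thus ?case using elim by (auto simp: abs_less_iff)
  qed
qed

subsection \<open>Weak derivatives of ridge functions\<close>

lemma fun_upd_space_R: "x \<in> space_R d \<Longrightarrow> i < d \<Longrightarrow> x(i := t) \<in> space_R d"
  by (auto simp: space_R_def PiE_iff extensional_def)

lemma emeasure_box_finite: "emeasure (lebp d) (Pi\<^sub>E {..<d} (\<lambda>i. {a i..b i})) < \<infinity>"
proof -
  have "emeasure (lebp d) (Pi\<^sub>E {..<d} (\<lambda>i. {a i..b i})) = (\<Prod>i<d. emeasure lborel {a i..b i})"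
    by (intro lborel_family.emeasure_PiM) auto
  also have "\<dots> < \<infinity>"
    by (auto simp: less_top[symmetric] ennreal_prod_eq_top emeasure_lborel_Icc_eq simp del: prod_constant)
  finally show ?thesis .
qed

lemma compactin_bounded_measure:
  assumes "compactin (Rtop d) K"
  shows "emeasure (lebp d) K < \<infinity>" "i < d \<Longrightarrow> \<exists>R. \<forall>x\<in>K. \<bar>x i\<bar> \<le> R"
proof -
  have ex: "\<exists>R. \<forall>x\<in>K. \<bar>x i\<bar> \<le> R" if "i < d" for i
  proof -
    have "continuous_map (Rtop d) euclideanreal (\<lambda>x. x i)"
      using that continuous_map_product_projection[of i "{..<d}" "\<lambda>_. euclideanreal"] by simp
    from image_compactin[OF assms this] have "compact ((\<lambda>x. x i) ` K)" by simp
    from compact_imp_bounded[OF this] show ?thesis unfolding bounded_iff by auto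
  qed
  thus "i < d \<Longrightarrow> \<exists>R. \<forall>x\<in>K. \<bar>x i\<bar> \<le> R" .
  from ex obtain R where R: "\<And>i x. i < d \<Longrightarrow> x \<in> K \<Longrightarrow> \<bar>x i\<bar> \<le> R i" by metis
  have sub: "K \<subseteq> Pi\<^sub>E {..<d} (\<lambda>i. {- R i..R i})"
  proof
    fix x assume x: "x \<in> K"
    hence "x \<in> extensional {..<d}" using compactin_subset_topspace[OF assms] by (auto simp: PiE_def)
    moreover have "x i \<in> {- R i..R i}" if "i < d" for i using R[OF that x] by auto
    ultimately show "x \<in> Pi\<^sub>E {..<d} (\<lambda>i. {- R i..R i})" by (simp add: PiE_iff)
  qed
  have "emeasure (lebp d) K \<le> emeasure (lebp d) (Pi\<^sub>E {..<d} (\<lambda>i. {- R i..R i}))"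
    by (intro emeasure_mono sub sets_PiM_I_finite) auto
  also have "\<dots> < \<infinity>" by (rule emeasure_box_finite)
  finally show "emeasure (lebp d) K < \<infinity>" .
qed

lemma test_fun_continuous: "test_fun d \<Omega> \<phi> \<Longrightarrow> continuous_map (Rtop d) euclideanreal \<phi>"
  by (auto simp: test_fun_def smooth_def dest: spec[of _ "[]"])

lemma test_fun_borel: "test_fun d \<Omega> \<phi> \<Longrightarrow> \<phi> \<in> borel_measurable (lebp d)"
  by (intro continuous_map_borel_lebp test_fun_continuous)

lemma test_fun_support:
  assumes "test_fun d \<Omega> \<phi>"
  obtains K B where "compactin (Rtop d) K" "K \<subseteq> \<Omega>" "\<And>x. x \<in> space_R d \<Longrightarrow> \<bar>\<phi> x\<bar> \<le> B * indicator K x"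
proof -
  obtain K where K: "compactin (Rtop d) K" "K \<subseteq> \<Omega>" "\<And>x. x \<in> space_R d - K \<Longrightarrow> \<phi> x = 0"
    using assms by (auto simp: test_fun_def)
  have "compact (\<phi> ` K)" using image_compactin[OF K(1) test_fun_continuous[OF assms]] by simp
  from compact_imp_bounded[OF this] obtain B where B: "\<And>x. x \<in> K \<Longrightarrow> \<bar>\<phi> x\<bar> \<le> B"
    unfolding bounded_iff by auto
  show ?thesis using K B by (intro that[of K B]) (auto simp: indicator_def)
qed

lemma test_fun_zero: "test_fun d \<Omega> \<phi> \<Longrightarrow> x \<in> space_R d \<Longrightarrow> x \<notin> \<Omega> \<Longrightarrow> \<phi> x = 0"
  by (auto simp: test_fun_def)

lemma test_fun_integrable_mult:
  assumes \<phi>: "test_fun d \<Omega> \<phi>" and s[measurable]: "s \<in> borel_measurable (lebp d)" and b: "\<And>x. x \<in> \<Omega> \<Longrightarrow> \<bar>s x\<bar> \<le> C"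
  shows "integrable (lebp d) (\<lambda>x. s x * \<phi> x)"
proof -
  obtain K B where K: "compactin (Rtop d) K" "K \<subseteq> \<Omega>" "\<And>x. x \<in> space_R d \<Longrightarrow> \<bar>\<phi> x\<bar> \<le> B * indicator K x"
    using test_fun_support[OF \<phi>] by blast
  note test_fun_borel[OF \<phi>, measurable] compactin_sets_lebp[OF K(1), measurable]
  have "integrable (lebp d) (\<lambda>x. (C * B) * indicator K x)"
    using compactin_bounded_measure(1)[OF K(1)] by auto
  thus ?thesis
  proof (rule integrable_dominated)
    show "AE x in lebp d. norm (s x * \<phi> x) \<le> norm (C * B * indicator K x)"
    proof (rule AE_I2)
      fix x assume "x \<in> space (lebp d)"
      hence x: "\<bar>\<phi> x\<bar> \<le> B * indicator K x" using K(3) by (simp add: space_lebp)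
      show "norm (s x * \<phi> x) \<le> norm (C * B * indicator K x)"
      proof (cases "x \<in> K")
        case True
        hence "\<bar>s x\<bar> * \<bar>\<phi> x\<bar> \<le> C * B" using x b[of x] K(2) by (intro mult_mono) auto
        also have "\<dots> \<le> \<bar>C\<bar> * \<bar>B\<bar>" unfolding abs_mult[symmetric] by (rule abs_ge_self)
        finally show ?thesis using True by (simp add: abs_mult)
      qed (use x in auto)
    qed
  qed measurable
qed

lemma pderiv_at_line: "pderiv_at i \<phi> (x(i := t)) = deriv (\<lambda>t. \<phi> (x(i := t))) t"
  by (simp add: pderiv_at_def field_derivative_eq_vector_derivative)

text \<open>The support stays in the same compact \<open>K\<close>: its complement is open, so near
  a point outside \<open>K\<close> the function vanishes along the coordinate line.\<close>

lemma test_fun_pderiv: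
  assumes \<phi>: "test_fun d \<Omega> \<phi>" and i: "i < d"
  shows "test_fun d \<Omega> (pderiv_at i \<phi>)"
proof -
  obtain K where K: "compactin (Rtop d) K" "K \<subseteq> \<Omega>" "\<And>x. x \<in> space_R d - K \<Longrightarrow> \<phi> x = 0"
    using \<phi> by (auto simp: test_fun_def)
  have "closedin (Rtop d) K"
    using K(1) by (intro compactin_imp_closedin) (auto simp: Hausdorff_space_product_topology)
  hence op: "openin (Rtop d) (topspace (Rtop d) - K)" by (simp add: closedin_def)
  have "pderiv_at i \<phi> x = 0" if x: "x \<in> space_R d - K" for x
  proof -
    have "continuous_map euclideanreal (Rtop d) (\<lambda>t. x(i := t))"
      using x by (subst continuous_map_componentwise) (auto simp: space_R_def PiE_iff extensional_def i)
    from openin_continuous_map_preimage[OF this op] have "open {t. x(i := t) \<in> topspace (Rtop d) - K}" by simp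
    moreover have "x(i := x i) \<in> topspace (Rtop d) - K" using x by (simp add: topspace_Rtop[symmetric] del: topspace_product_topology)
    moreover have "\<phi> (x(i := t)) = 0" if "x(i := t) \<in> topspace (Rtop d) - K" for t
      using that K(3) by (simp add: topspace_Rtop[symmetric] del: topspace_product_topology)
    ultimately have "eventually (\<lambda>t. \<phi> (x(i := t)) = 0) (nhds (x i))"
      by (intro eventually_nhds_in_open[THEN eventually_mono]) auto
    hence "deriv (\<lambda>t. \<phi> (x(i := t))) (x i) = deriv (\<lambda>_. 0) (x i)" by (intro deriv_cong_ev) auto
    thus ?thesis using pderiv_at_line[of i \<phi> x "x i"] by simp
  qed
  moreover have "smooth d (pderiv_at i \<phi>)"
    unfolding smooth_def
  proof (intro allI impI)
    fix js assume "set js \<subseteq> {..<d}"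
    hence "set (i # js) \<subseteq> {..<d}" using i by simp
    with \<phi> have "continuous_map (Rtop d) euclideanreal (fold pderiv_at (i # js) \<phi>) \<and>
      (\<forall>x\<in>space_R d. \<forall>k<d. (\<lambda>t. fold pderiv_at (i # js) \<phi> (x(k := t))) differentiable at (x k))"
      unfolding test_fun_def smooth_def by blast
    thus "continuous_map (Rtop d) euclideanreal (fold pderiv_at js (pderiv_at i \<phi>)) \<and>
      (\<forall>x\<in>space_R d. \<forall>k<d. (\<lambda>t. fold pderiv_at js (pderiv_at i \<phi>) (x(k := t))) differentiable at (x k))" by simp
  qed
  ultimately show ?thesis using K by (auto simp: test_fun_def)
qed

lemma test_fun_fold: "test_fun d \<Omega> \<phi> \<Longrightarrow> set js \<subseteq> {..<d} \<Longrightarrow> test_fun d \<Omega> (fold pderiv_at js \<phi>)"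
  by (induction js arbitrary: \<phi>) (auto intro: test_fun_pderiv)

lemma test_fun_mderiv: "test_fun d \<Omega> \<phi> \<Longrightarrow> test_fun d \<Omega> (mderiv d \<alpha> \<phi>)"
  unfolding fold_pderiv_mderiv by (rule test_fun_fold) (auto simp: word_def)

text \<open>Once the product measure is split, \<open>x\<close> carries only the other coordinates
  and its entry at \<open>i\<close> is undefined; hence the hypothesis on
  \<open>x(i := 0)\<close>.\<close>

lemma test_fun_line:
  assumes \<phi>: "test_fun d \<Omega> \<phi>" and x: "x(i := 0) \<in> space_R d" and i: "i < d"
  shows "test_fun1 (\<lambda>t. \<phi> (x(i := t)))"
proof -
  have x': "x(i := t) \<in> space_R d" for t using fun_upd_space_R[OF x i, of t] by simp
  have d: "(deriv ^^ k) (\<lambda>t. \<phi> (x(i := t))) = (\<lambda>t. fold pderiv_at (replicate k i) \<phi> (x(i := t)))" for k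
  proof (induction k)
    case (Suc k)
    have r: "fold pderiv_at (replicate (Suc k) i) \<phi> = pderiv_at i (fold pderiv_at (replicate k i) \<phi>)"
      by (simp add: replicate_append_same[symmetric] del: replicate.simps(2))
    have "(deriv ^^ Suc k) (\<lambda>t. \<phi> (x(i := t))) = deriv (\<lambda>t. fold pderiv_at (replicate k i) \<phi> (x(i := t)))"
      by (simp only: funpow.simps o_def Suc)
    also have "\<dots> = (\<lambda>t. pderiv_at i (fold pderiv_at (replicate k i) \<phi>) (x(i := t)))"
      by (simp only: pderiv_at_line)
    finally show ?case by (simp only: r)
  qed simp
  obtain K where K: "compactin (Rtop d) K" "\<And>x. x \<in> space_R d - K \<Longrightarrow> \<phi> x = 0"
    using \<phi> by (auto simp: test_fun_def)
  obtain R where R: "\<And>x. x \<in> K \<Longrightarrow> \<bar>x i\<bar> \<le> R" using compactin_bounded_measure(2)[OF K(1) i] by blast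
  have "(\<lambda>t. fold pderiv_at (replicate k i) \<phi> (x(i := t))) field_differentiable at t" for k t
  proof -
    have "set (replicate k i) \<subseteq> {..<d}" using i by auto
    hence "(\<lambda>s. fold pderiv_at (replicate k i) \<phi> ((x(i := t))(i := s))) differentiable at ((x(i := t)) i)"
      using \<phi> i x'[of t] unfolding test_fun_def smooth_def by blast
    thus ?thesis by (simp add: field_differentiable_def real_differentiable_def)
  qed
  moreover have "\<phi> (x(i := t)) = 0" if "\<bar>t\<bar> > R" for t
    using R[of "x(i := t)"] that x'[of t] by (intro K(2)) auto
  ultimately show ?thesis unfolding test_fun1_def d by blast
qed

definition ridge :: "nat \<Rightarrow> (real \<Rightarrow> real) \<Rightarrow> vec \<Rightarrow> real \<Rightarrow> vec \<Rightarrow> real" where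
  "ridge d s w b x = s (dotp d w x + b)"

lemma ridge_measurable:
  assumes s: "s \<in> borel_measurable borel"
  shows "ridge d s w b \<in> borel_measurable (lebp d)"
proof -
  have "(\<lambda>x. dotp d w x + b) \<in> borel_measurable (lebp d)"
    by (intro borel_measurable_add dotp_measurable_right borel_measurable_const)
  from measurable_compose[OF this s] show ?thesis by (simp add: ridge_def[abs_def])
qed

text \<open>
  On a line parallel to a coordinate axis a test function is a one-dimensional test function, so the
  one-dimensional weak derivative can be used line by line; no smoothing of the profile is needed.
\<close>

lemma ridge_partial:
  assumes s: "s \<in> borel_measurable borel" "s' \<in> borel_measurable borel"
    and bnd: "\<And>t. \<bar>s t\<bar> \<le> C" "\<And>t. \<bar>s' t\<bar> \<le> C"
    and weak: "\<And>\<psi>. test_fun1 \<psi> \<Longrightarrow> (LINT t|lborel. s t * deriv \<psi> t) = - (LINT t|lborel. s' t * \<psi> t)"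
    and \<phi>: "test_fun d \<Omega> \<phi>" and i: "i < d"
  shows "(LINT x|lebp d. ridge d s w b x * pderiv_at i \<phi> x) = - w i * (LINT x|lebp d. ridge d s' w b x * \<phi> x)"
proof -
  let ?J = "{..<d} - {i}"
  have ins: "insert i ?J = {..<d}" using i by auto
  have split: "(LINT x|lebp d. f x) = (LINT x|PiM ?J (\<lambda>_. lborel). LINT t|lborel. f (x(i := t)))"
    if "integrable (lebp d) f" for f :: "vec \<Rightarrow> real"
    using lborel_family.product_integral_insert[of ?J i f, unfolded ins] that by simp
  have int1: "integrable (lebp d) (\<lambda>x. ridge d s w b x * pderiv_at i \<phi> x)"
    using bnd by (intro test_fun_integrable_mult[where \<Omega>=\<Omega> and C=C] test_fun_pderiv \<phi> i ridge_measurable s) (simp add: ridge_def)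
  have int2: "integrable (lebp d) (\<lambda>x. ridge d s' w b x * \<phi> x)"
    using bnd by (intro test_fun_integrable_mult[where \<Omega>=\<Omega> and C=C] \<phi> ridge_measurable s) (simp add: ridge_def)
  have "(LINT x|lebp d. ridge d s w b x * pderiv_at i \<phi> x) =
    (LINT x|PiM ?J (\<lambda>_. lborel). LINT t|lborel. ridge d s w b (x(i := t)) * pderiv_at i \<phi> (x(i := t)))"
    by (rule split[OF int1])
  also have "\<dots> = (LINT x|PiM ?J (\<lambda>_. lborel). - w i * (LINT t|lborel. ridge d s' w b (x(i := t)) * \<phi> (x(i := t))))"
  proof (intro lint_cong)
    fix x :: vec assume "x \<in> space (PiM ?J (\<lambda>_. lborel))"
    hence x: "x(i := 0) \<in> space_R d" using i by (auto simp: space_PiM space_R_def PiE_iff extensional_def)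
    \<comment> \<open>Along the line the argument of the ridge function is affine in
      \<open>t\<close>, with slope \<open>w i\<close>, which may be zero.\<close>
    define c where "c = (\<Sum>j\<in>?J. w j * x j) + b"
    have dp: "dotp d w (x(i := t)) + b = c + w i * t" for t
    proof -
      have "dotp d w (x(i := t)) = w i * t + (\<Sum>j\<in>?J. w j * (x(i := t)) j)"
        unfolding dotp_def using i by (subst sum.remove[of _ i]) auto
      also have "(\<Sum>j\<in>?J. w j * (x(i := t)) j) = (\<Sum>j\<in>?J. w j * x j)" by (intro sum.cong) auto
      finally show ?thesis unfolding c_def by linarith
    qed
    show "(LINT t|lborel. ridge d s w b (x(i := t)) * pderiv_at i \<phi> (x(i := t))) =
      - w i * (LINT t|lborel. ridge d s' w b (x(i := t)) * \<phi> (x(i := t)))"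
      unfolding ridge_def dp pderiv_at_line
      by (rule affine_weak_deriv[OF s weak test_fun_line[OF \<phi> x i]])
  qed
  also have "\<dots> = - w i * (LINT x|PiM ?J (\<lambda>_. lborel). LINT t|lborel. ridge d s' w b (x(i := t)) * \<phi> (x(i := t)))"
    by (rule integral_mult_right_zero)
  also have "(LINT x|PiM ?J (\<lambda>_. lborel). LINT t|lborel. ridge d s' w b (x(i := t)) * \<phi> (x(i := t))) =
     (LINT x|lebp d. ridge d s' w b x * \<phi> x)" by (rule split[OF int2, symmetric])
  finally show ?thesis .
qed

text \<open>Neighbours are linked by a single integration by parts, which suits an induction along a
  list of coordinates. The bounds hold at every point, so a ridge function is bounded for every
  \<open>w\<close>, even for \<open>w = 0\<close>, where it sees a single value of the
  profile.\<close>

definition weak_chain :: "nat \<Rightarrow> real \<Rightarrow> (nat \<Rightarrow> real \<Rightarrow> real) \<Rightarrow> bool" where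
  "weak_chain m C s \<longleftrightarrow> (\<forall>k\<le>m. s k \<in> borel_measurable borel \<and> (\<forall>t. \<bar>s k t\<bar> \<le> C)) \<and>
     (\<forall>k<m. \<forall>\<psi>. test_fun1 \<psi> \<longrightarrow> (LINT t|lborel. s k t * deriv \<psi> t) = - (LINT t|lborel. s (Suc k) t * \<psi> t))"

text \<open>As \<open>fold\<close> treats the head of the list first, the induction hypothesis is
  used for \<open>pderiv_at i \<phi>\<close>; one further integration by parts removes the remaining
  derivative.\<close>

lemma ridge_fold:
  assumes s: "weak_chain m C s"
  shows "test_fun d \<Omega> \<phi> \<Longrightarrow> set js \<subseteq> {..<d} \<Longrightarrow> length js \<le> m \<Longrightarrow>
    (LINT x|lebp d. ridge d (s 0) w b x * fold pderiv_at js \<phi> x) =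
    (-1) ^ length js * (\<Prod>j\<leftarrow>js. w j) * (LINT x|lebp d. ridge d (s (length js)) w b x * \<phi> x)"
proof (induction js arbitrary: \<phi>)
  case (Cons i js)
  let ?k = "length js"
  have i: "i < d" and k: "?k < m" using Cons.prems by auto
  have "(LINT x|lebp d. ridge d (s 0) w b x * fold pderiv_at (i # js) \<phi> x) =
      (-1) ^ ?k * (\<Prod>j\<leftarrow>js. w j) * (LINT x|lebp d. ridge d (s ?k) w b x * pderiv_at i \<phi> x)"
    using Cons.IH[OF test_fun_pderiv[OF Cons.prems(1) i]] Cons.prems by simp
  also have "(LINT x|lebp d. ridge d (s ?k) w b x * pderiv_at i \<phi> x) = - w i * (LINT x|lebp d. ridge d (s (Suc ?k)) w b x * \<phi> x)"
    using s k by (intro ridge_partial[where C=C and \<Omega>=\<Omega>] Cons.prems(1) i) (auto simp: weak_chain_def)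
  finally show ?case by simp
qed simp

lemma prod_list_word: "(\<Prod>j\<leftarrow>word d \<alpha>. w j) = (\<Prod>i<d. w i ^ \<alpha> i :: real)"
  unfolding word_def by (induction d) (auto simp: prod_list_replicate map_replicate lessThan_Suc mult.commute)

lemma length_word: "length (word d \<alpha>) = mi_order d \<alpha>"
  unfolding word_def by (induction d) (auto simp: mi_order_def)

lemma ridge_mderiv:
  assumes "weak_chain m C s" "test_fun d \<Omega> \<phi>" "mi_order d \<alpha> \<le> m"
  shows "(LINT x|lebp d. ridge d (s 0) w b x * mderiv d \<alpha> \<phi> x) =
    (-1) ^ mi_order d \<alpha> * (LINT x|lebp d. (\<Prod>i<d. w i ^ \<alpha> i) * ridge d (s (mi_order d \<alpha>)) w b x * \<phi> x)"
proof -
  have "(LINT x|lebp d. ridge d (s 0) w b x * mderiv d \<alpha> \<phi> x) =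
    (-1) ^ mi_order d \<alpha> * (\<Prod>i<d. w i ^ \<alpha> i) * (LINT x|lebp d. ridge d (s (mi_order d \<alpha>)) w b x * \<phi> x)"
    unfolding fold_pderiv_mderiv prod_list_word[symmetric] length_word[symmetric]
    using assms by (intro ridge_fold[where m=m and C=C and \<Omega>=\<Omega>]) (auto simp: length_word, auto simp: word_def)
  thus ?thesis by (simp add: mult.assoc)
qed

text \<open>Products of bumps and characters yield test functions, so the difference of
  \<open>v\<close> and \<open>v'\<close> times the bumps has vanishing Fourier transform; inside the
  open box the bumps are divided out.\<close>

lemma AE_zero_on_box:
  assumes v: "locally_integrable d \<Omega> v" "locally_integrable d \<Omega> v'"
    and eq: "\<And>\<phi>. test_fun d \<Omega> \<phi> \<Longrightarrow> (LINT x:\<Omega>|leb d. v x * \<phi> x) = (LINT x:\<Omega>|leb d. v' x * \<phi> x)"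
    and box: "Pi\<^sub>E {..<d} (\<lambda>i. {a i..b i}) \<subseteq> \<Omega>"
  shows "AE x in lebp d. (\<forall>i<d. a i < x i \<and> x i < b i) \<longrightarrow> v x = v' x"
proof -
  define K where "K = Pi\<^sub>E {..<d} (\<lambda>i. {a i..b i})"
  have K: "compactin (Rtop d) K" "K \<subseteq> \<Omega>" using box by (auto simp: K_def compactin_PiE)
  note Km[measurable] = compactin_sets_lebp[OF K(1)]
  have rep: "\<exists>u0. integrable (lebp d) u0 \<and> (AE x in lebp d. indicator K x * u x = u0 x)" if "locally_integrable d \<Omega> u" for u
  proof -
    have i: "integrable (completion (lebp d)) (\<lambda>x. indicator K x * u x)"
      using that K by (auto simp: locally_integrable_def set_integrable_def leb_def)
    then obtain u0 where "u0 \<in> borel_measurable (lebp d)" "AE x in lebp d. indicator K x * u x = u0 x"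
      using completion_ex_borel_measurable_real[of "\<lambda>x. indicator K x * u x"] by blast
    thus ?thesis using i by (auto simp: integral_completion_AE(2))
  qed
  obtain v0 where v0: "integrable (lebp d) v0" "AE x in lebp d. indicator K x * v x = v0 x" using rep[OF v(1)] by blast
  obtain v0' where v0': "integrable (lebp d) v0'" "AE x in lebp d. indicator K x * v' x = v0' x" using rep[OF v(2)] by blast
  have "\<forall>i. \<exists>\<psi>. bump (a i) (b i) \<psi>" by (simp add: bump_exists)
  from choice[OF this] obtain \<psi> where b: "\<And>i. bump (a i) (b i) (\<psi> i)" by blast
  note \<psi> = bumpD[OF b]
  define T where "T y = tensor d (\<lambda>i t. of_real (\<psi> i t) * iexp (y i * t))" for y
  have sm: "smooth1 (\<lambda>t. of_real (\<psi> i t) * iexp (y * t))" for i y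
    by (intro smooth1_mult smooth1_of_real \<psi> smooth1_iexp)
  have Tm[measurable]: "T y \<in> borel_measurable (lebp d)" for y
    unfolding T_def by (intro tensor_measurable sm)
  have T1: "norm (T y x) \<le> 1" for y x
  proof -
    have "norm (T y x) = (\<Prod>i<d. norm (of_real (\<psi> i (x i)) * iexp (y i * x i)))" by (simp add: T_def tensor_def prod_norm)
    also have "\<dots> \<le> 1" using \<psi> by (intro prod_le_1) (auto simp: norm_mult)
    finally show ?thesis .
  qed
  have TK: "T y x = 0" if "x \<in> space_R d" "x \<notin> K" for y x
  proof -
    obtain i where "i < d" "x i \<notin> {a i..b i}"
      using \<open>x \<in> space_R d\<close> \<open>x \<notin> K\<close> by (auto simp: K_def space_R_def PiE_iff)
    thus ?thesis unfolding T_def tensor_def using \<psi>(3) by (intro prod_zero) (auto intro!: bexI[of _ i])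
  qed
  have iT: "integrable (lebp d) (\<lambda>x. of_real (u x) * T y x)" if "integrable (lebp d) u" for u y
    using that
  proof (rule integrable_dominated)
    show "(\<lambda>x. of_real (u x) * T y x) \<in> borel_measurable (lebp d)" using that by measurable
    show "AE x in lebp d. norm (of_real (u x) * T y x) \<le> norm (u x)"
      using T1 by (intro AE_I2) (simp add: norm_mult mult_left_le)
  qed
  have conv: "(LINT x:\<Omega>|leb d. u x * L (T y x)) = (LINT x|lebp d. u0 x * L (T y x))"
    if u0: "integrable (lebp d) u0" "AE x in lebp d. indicator K x * u x = u0 x" and L: "bounded_linear L" for u u0 :: "vec \<Rightarrow> real" and L :: "complex \<Rightarrow> real" and y
  proof -
    have [measurable]: "L \<in> borel_measurable borel" using L by (intro borel_measurable_continuous_onI linear_continuous_on)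
    have [measurable]: "u0 \<in> borel_measurable (lebp d)" using u0 by auto
    have "(\<lambda>x. L (T y x)) \<in> borel_measurable (lebp d)"
      by (rule measurable_compose[OF Tm]) measurable
    hence m: "(\<lambda>x. u0 x * L (T y x)) \<in> borel_measurable (lebp d)"
      using u0(1) by (intro borel_measurable_times) auto
    have ae: "AE x in lebp d. indicator \<Omega> x * (u x * L (T y x)) = u0 x * L (T y x)"
      using u0(2) AE_space
    proof eventually_elim
      case (elim x)
      show ?case
      proof (cases "x \<in> K")
        case True
        thus ?thesis using elim K(2) by auto
      next
        case False
        hence "L (T y x) = 0" using TK elim L by (simp add: space_lebp linear_simps)
        thus ?thesis by simp
      qed
    qed
    show ?thesis
      using integral_completion_AE(1)[OF m ae] by (simp add: set_lebesgue_integral_def leb_def)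
  qed
  \<comment> \<open>The hypothesis \<open>eq\<close> concerns real test functions, so the real and
    the imaginary part of the tensor are inserted separately.\<close>
  have LT: "(LINT x|lebp d. v0 x * L (T y x)) = (LINT x|lebp d. v0' x * L (T y x))" if L: "bounded_linear L" for L :: "complex \<Rightarrow> real" and y
  proof -
    have "test_fun d \<Omega> (\<lambda>x. L (T y x))"
      unfolding T_def using \<psi>(3) by (intro test_fun_tensor[where a=a and b=b] L sm box) auto
    from eq[OF this] show ?thesis unfolding conv[OF v0 L] conv[OF v0' L] .
  qed
  have cT: "(LINT x|lebp d. of_real (v0 x) * T y x) = (LINT x|lebp d. of_real (v0' x) * T y x)" for y
  proof (rule complex_eqI)
    show "Re (LINT x|lebp d. of_real (v0 x) * T y x) = Re (LINT x|lebp d. of_real (v0' x) * T y x)"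
      using LT[OF bounded_linear_Re, of y]
      by (simp add: integral_Re[OF iT, symmetric] v0 v0')
    show "Im (LINT x|lebp d. of_real (v0 x) * T y x) = Im (LINT x|lebp d. of_real (v0' x) * T y x)"
      using LT[OF bounded_linear_Im, of y]
      by (simp add: integral_Im[OF iT, symmetric] v0 v0')
  qed
  let ?P = "\<lambda>x. \<Prod>i<d. complex_of_real (\<psi> i (x i))"
  have TP: "T y x = ?P x * (\<Prod>i<d. iexp (y i * x i))" for y x
    by (simp only: T_def tensor_def prod.distrib)
  have P0: "T (\<lambda>_. 0) x = ?P x" for x by (simp add: T_def tensor_def)
  have "AE x in lebp d. (of_real (v0 x) - of_real (v0' x)) * ?P x = 0"
  proof (rule fourier_injective)
    show "integrable (lebp d) (\<lambda>x. (of_real (v0 x) - of_real (v0' x)) * ?P x)"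
      unfolding left_diff_distrib P0[symmetric] by (intro Bochner_Integration.integrable_diff iT v0 v0')
    fix y
    have "(LINT x|lebp d. (of_real (v0 x) - of_real (v0' x)) * ?P x * (\<Prod>i<d. iexp (y i * x i))) =
       (LINT x|lebp d. of_real (v0 x) * T y x - of_real (v0' x) * T y x)"
      by (simp only: TP left_diff_distrib mult.assoc)
    also have "\<dots> = 0" by (subst Bochner_Integration.integral_diff) (auto simp: cT iT v0 v0')
    finally show "(LINT x|lebp d. (of_real (v0 x) - of_real (v0' x)) * ?P x * (\<Prod>i<d. iexp (y i * x i))) = 0" .
  qed
  thus ?thesis using v0(2) v0'(2) AE_space
  proof eventually_elim
    case (elim x)
    show ?case
    proof
      assume x: "\<forall>i<d. a i < x i \<and> x i < b i"
      hence "\<psi> i (x i) \<noteq> 0" if "i < d" for i using \<psi>(2)[of i "x i"] that by force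
      hence "?P x \<noteq> 0" by simp
      hence "v0 x = v0' x" using elim by simp
      moreover have "x \<in> K" using x elim by (auto simp: K_def space_PiM PiE_iff less_imp_le)
      ultimately show "v x = v' x" using elim by simp
    qed
  qed
qed

text \<open>The open boxes with rational corners whose closures lie in \<open>\<Omega>\<close> cover
  it, and there are countably many, so the exceptional sets add up to a null set. Only through this
  can the chosen \<open>weak_deriv\<close> be computed.\<close>

lemma weak_deriv_unique:
  assumes op: "openin (Rtop d) \<Omega>" and v: "is_weak_deriv d \<Omega> \<alpha> g v" and v': "is_weak_deriv d \<Omega> \<alpha> g v'"
  shows "AE x in lebp d. x \<in> \<Omega> \<longrightarrow> v x = v' x"
proof -
  have li: "locally_integrable d \<Omega> v" "locally_integrable d \<Omega> v'" using v v' by (auto simp: is_weak_deriv_def)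
  have eq: "(LINT x:\<Omega>|leb d. v x * \<phi> x) = (LINT x:\<Omega>|leb d. v' x * \<phi> x)" if "test_fun d \<Omega> \<phi>" for \<phi>
  proof -
    have "(- 1) ^ mi_order d \<alpha> * (LINT x:\<Omega>|leb d. v x * \<phi> x) = (- 1) ^ mi_order d \<alpha> * (LINT x:\<Omega>|leb d. v' x * \<phi> x)"
      using that v v' unfolding is_weak_deriv_def by metis
    thus ?thesis by simp
  qed
  \<comment> \<open>Extensional families of corners: functions on all of \<open>nat\<close> would be
    uncountably many.\<close>
  define I where "I = {q \<in> {..<d} \<rightarrow>\<^sub>E (UNIV :: (rat \<times> rat) set).
     Pi\<^sub>E {..<d} (\<lambda>i. {real_of_rat (fst (q i))..real_of_rat (snd (q i))}) \<subseteq> \<Omega>}"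
  have "countable ({..<d} \<rightarrow>\<^sub>E (UNIV :: (rat \<times> rat) set))" by (intro countable_PiE) auto
  hence cI: "countable I" unfolding I_def by (rule countable_subset[rotated]) auto
  have "AE x in lebp d. \<forall>q\<in>I. (\<forall>i<d. real_of_rat (fst (q i)) < x i \<and> x i < real_of_rat (snd (q i))) \<longrightarrow> v x = v' x"
    by (intro AE_ball_countable'[OF _ cI] AE_zero_on_box[OF li eq]) (auto simp: I_def)
  thus ?thesis
  proof eventually_elim
    case (elim x)
    show ?case
    proof
      assume x: "x \<in> \<Omega>"
      have "\<exists>U. finite {i \<in> {..<d}. U i \<noteq> topspace euclideanreal} \<and> (\<forall>i\<in>{..<d}. openin euclideanreal (U i)) \<and>
          x \<in> Pi\<^sub>E {..<d} U \<and> Pi\<^sub>E {..<d} U \<subseteq> \<Omega>"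
        using op x unfolding openin_product_topology_alt by (rule bspec)
      then obtain U where U: "\<And>i. i < d \<Longrightarrow> open (U i)" "x \<in> Pi\<^sub>E {..<d} U" "Pi\<^sub>E {..<d} U \<subseteq> \<Omega>"
        by auto
      have "\<exists>q. real_of_rat (fst q) < x i \<and> x i < real_of_rat (snd q) \<and> {real_of_rat (fst q)..real_of_rat (snd q)} \<subseteq> U i" if i: "i < d" for i
      proof -
        have "x i \<in> U i" using U(2) i by auto
        then obtain e where e: "e > 0" "ball (x i) e \<subseteq> U i" using U(1)[OF i] open_contains_ball by blast
        obtain q1 where q1: "x i - e < real_of_rat q1" "real_of_rat q1 < x i" using of_rat_dense[of "x i - e" "x i"] e by auto
        obtain q2 where q2: "x i < real_of_rat q2" "real_of_rat q2 < x i + e" using of_rat_dense[of "x i" "x i + e"] e by auto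
        have "{real_of_rat q1..real_of_rat q2} \<subseteq> ball (x i) e" using q1 q2 by (auto simp: dist_real_def)
        thus ?thesis using q1 q2 e by (intro exI[of _ "(q1, q2)"]) auto
      qed
      then obtain q where q: "\<And>i. i < d \<Longrightarrow> real_of_rat (fst (q i)) < x i \<and> x i < real_of_rat (snd (q i)) \<and> {real_of_rat (fst (q i))..real_of_rat (snd (q i))} \<subseteq> U i"
        by metis
      have "Pi\<^sub>E {..<d} (\<lambda>i. {real_of_rat (fst (q i))..real_of_rat (snd (q i))}) \<subseteq> Pi\<^sub>E {..<d} U"
        by (intro PiE_mono) (use q in auto)
      moreover have "Pi\<^sub>E {..<d} (\<lambda>i. {real_of_rat (fst (restrict q {..<d} i))..real_of_rat (snd (restrict q {..<d} i))})
          = Pi\<^sub>E {..<d} (\<lambda>i. {real_of_rat (fst (q i))..real_of_rat (snd (q i))})"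
        by (rule PiE_cong) simp
      ultimately have "restrict q {..<d} \<in> I" using U(3) unfolding I_def by simp
      from elim[rule_format, OF this] show "v x = v' x" using q by auto
    qed
  qed
qed

abbreviation pairing :: "nat \<Rightarrow> vec set \<Rightarrow> (vec \<Rightarrow> real) \<Rightarrow> (vec \<Rightarrow> real) \<Rightarrow> real" where
  "pairing d \<Omega> u \<phi> \<equiv> LINT x|lebp d. indicator \<Omega> x * (u x * \<phi> x)"

text \<open>Integration by parts is checked for Borel representatives on the product before
  completion; their bounds on \<open>\<Omega>\<close> supply local integrability.\<close>

lemma is_weak_derivI:
  assumes \<Omega>[measurable]: "\<Omega> \<in> sets (lebp d)" and g: "g \<in> borel_measurable (leb d)"
    and g0[measurable]: "g0 \<in> borel_measurable (lebp d)" and v0[measurable]: "v0 \<in> borel_measurable (lebp d)"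
    and ae: "AE x in lebp d. x \<in> \<Omega> \<longrightarrow> g x = g0 x"
    and bnd: "\<And>x. x \<in> \<Omega> \<Longrightarrow> \<bar>g0 x\<bar> \<le> B" "\<And>x. x \<in> \<Omega> \<Longrightarrow> \<bar>v0 x\<bar> \<le> B"
    and ibp: "\<And>\<phi>. test_fun d \<Omega> \<phi> \<Longrightarrow> pairing d \<Omega> g0 (mderiv d \<alpha> \<phi>) =
       (-1) ^ mi_order d \<alpha> * pairing d \<Omega> v0 \<phi>"
  shows "is_weak_deriv d \<Omega> \<alpha> g v0"
proof -
  have bint: "integrable (lebp d) (\<lambda>x. indicator K x * u x)"
    if K: "compactin (Rtop d) K" "K \<subseteq> \<Omega>" and u[measurable]: "u \<in> borel_measurable (lebp d)" and "\<And>x. x \<in> \<Omega> \<Longrightarrow> \<bar>u x\<bar> \<le> B" for K u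
  proof (rule integrable_dominated)
    note compactin_sets_lebp[OF K(1), measurable]
    show "integrable (lebp d) (\<lambda>x. B * indicator K x)"
      using compactin_bounded_measure(1)[OF K(1)] by auto
    show "AE x in lebp d. norm (indicator K x * u x) \<le> norm (B * indicator K x)"
      using that by (intro AE_I2) (fastforce simp: indicator_def)
    show "(\<lambda>x. indicator K x * u x) \<in> borel_measurable (lebp d)" by measurable
  qed
  have li: "locally_integrable d \<Omega> v"
    if v: "AE x in lebp d. x \<in> \<Omega> \<longrightarrow> v x = u x" and u[measurable]: "u \<in> borel_measurable (lebp d)"
      and ub: "\<And>x. x \<in> \<Omega> \<Longrightarrow> \<bar>u x\<bar> \<le> B" for v u
    unfolding locally_integrable_def set_integrable_def
  proof (intro allI impI)
    fix K assume "compactin (Rtop d) K \<and> K \<subseteq> \<Omega>"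
    hence K: "compactin (Rtop d) K" "K \<subseteq> \<Omega>" by auto
    note [measurable] = compactin_sets_lebp[OF K(1)]
    have m: "(\<lambda>x. indicator K x * u x) \<in> borel_measurable (lebp d)" by measurable
    have "AE x in lebp d. indicator K x *\<^sub>R v x = indicator K x * u x"
      using v by eventually_elim (use K(2) in \<open>auto simp: indicator_def\<close>)
    from integral_completion_AE(2)[OF m this] show "integrable (leb d) (\<lambda>x. indicator K x *\<^sub>R v x)"
      using bint[OF K u ub] by (simp add: leb_def)
  qed
  have "(LINT x:\<Omega>|leb d. g x * mderiv d \<alpha> \<phi> x) = (- 1) ^ mi_order d \<alpha> * (LINT x:\<Omega>|leb d. v0 x * \<phi> x)"
    if \<phi>: "test_fun d \<Omega> \<phi>" for \<phi>
  proof -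
    note [measurable] = test_fun_borel[OF \<phi>] test_fun_borel[OF test_fun_mderiv[OF \<phi>, of \<alpha>]]
    have m: "(\<lambda>x. indicator \<Omega> x * (g0 x * mderiv d \<alpha> \<phi> x)) \<in> borel_measurable (lebp d)" by measurable
    have m2: "(\<lambda>x. indicator \<Omega> x * (v0 x * \<phi> x)) \<in> borel_measurable (lebp d)" by measurable
    have a: "AE x in lebp d. indicator \<Omega> x *\<^sub>R (g x * mderiv d \<alpha> \<phi> x) = indicator \<Omega> x * (g0 x * mderiv d \<alpha> \<phi> x)"
      using ae by eventually_elim (auto simp: indicator_def)
    have "(LINT x:\<Omega>|leb d. g x * mderiv d \<alpha> \<phi> x) = pairing d \<Omega> g0 (mderiv d \<alpha> \<phi>)"
      using integral_completion_AE(1)[OF m a] by (simp add: set_lebesgue_integral_def leb_def)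
    also have "\<dots> = (-1) ^ mi_order d \<alpha> * pairing d \<Omega> v0 \<phi>" by (rule ibp[OF \<phi>])
    also have "pairing d \<Omega> v0 \<phi> = (LINT x:\<Omega>|leb d. v0 x * \<phi> x)"
      unfolding set_lebesgue_integral_def leb_def using integral_completion[OF m2] by simp
    finally show ?thesis .
  qed
  thus ?thesis using li[OF ae g0 bnd(1)] li[OF AE_I2 v0 bnd(2)] by (simp add: is_weak_deriv_def)
qed

text \<open>Uniqueness lets an explicit family \<open>V\<close> stand in for the chosen weak
  derivatives. Only the integral of the whole sum of squares is estimated, which keeps the number of
  multi-indices out of the bound.\<close>

lemma H_norm_le:
  assumes op: "openin (Rtop d) \<Omega>" and fin: "emeasure (lebp d) \<Omega> < \<infinity>"
    and wd: "\<And>\<alpha>. \<alpha> \<in> multi_indices d \<Longrightarrow> mi_order d \<alpha> \<le> m \<Longrightarrow> is_weak_deriv d \<Omega> \<alpha> g (V \<alpha>)"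
    and V: "\<And>\<alpha>. \<alpha> \<in> multi_indices d \<Longrightarrow> mi_order d \<alpha> \<le> m \<Longrightarrow> V \<alpha> \<in> borel_measurable (lebp d)"
    and bnd: "\<And>\<alpha> x. \<alpha> \<in> multi_indices d \<Longrightarrow> mi_order d \<alpha> \<le> m \<Longrightarrow> x \<in> \<Omega> \<Longrightarrow> \<bar>V \<alpha> x\<bar> \<le> B"
    and le: "(LINT x|lebp d. indicator \<Omega> x * (\<Sum>\<alpha> | \<alpha> \<in> multi_indices d \<and> mi_order d \<alpha> \<le> m. (V \<alpha> x)\<^sup>2)) \<le> S"
  shows "H_norm d m \<Omega> g \<le> ennreal (sqrt S)"
proof -
  have \<Omega>[measurable]: "\<Omega> \<in> sets (lebp d)" by (rule openin_sets_lebp[OF op])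
  have main: "(\<exists>v. is_weak_deriv d \<Omega> \<alpha> g v) \<and> set_integrable (leb d) \<Omega> (\<lambda>x. (weak_deriv d \<Omega> \<alpha> g x)\<^sup>2)"
      "(LINT x:\<Omega>|leb d. (weak_deriv d \<Omega> \<alpha> g x)\<^sup>2) = (LINT x|lebp d. indicator \<Omega> x * (V \<alpha> x)\<^sup>2)"
      "integrable (lebp d) (\<lambda>x. indicator \<Omega> x * (V \<alpha> x)\<^sup>2)"
    if \<alpha>: "\<alpha> \<in> multi_indices d" "mi_order d \<alpha> \<le> m" for \<alpha>
  proof -
    note [measurable] = V[OF \<alpha>]
    have w: "is_weak_deriv d \<Omega> \<alpha> g (weak_deriv d \<Omega> \<alpha> g)"
      unfolding weak_deriv_def by (rule someI[of _ "V \<alpha>"]) (rule wd[OF \<alpha>])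
    have m: "(\<lambda>x. indicator \<Omega> x * (V \<alpha> x)\<^sup>2) \<in> borel_measurable (lebp d)" by measurable
    have a: "AE x in lebp d. indicator \<Omega> x *\<^sub>R (weak_deriv d \<Omega> \<alpha> g x)\<^sup>2 = indicator \<Omega> x * (V \<alpha> x)\<^sup>2"
      using weak_deriv_unique[OF op w wd[OF \<alpha>]] by eventually_elim (auto simp: indicator_def)
    show iV: "integrable (lebp d) (\<lambda>x. indicator \<Omega> x * (V \<alpha> x)\<^sup>2)"
    proof (rule integrable_dominated)
      show "integrable (lebp d) (\<lambda>x. B\<^sup>2 * indicator \<Omega> x)" using fin by auto
      show "AE x in lebp d. norm (indicator \<Omega> x * (V \<alpha> x)\<^sup>2) \<le> norm (B\<^sup>2 * indicator \<Omega> x)"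
        using bnd[OF \<alpha>] by (intro AE_I2) (auto simp: indicator_def abs_le_square_iff[symmetric] intro: order_trans[OF _ abs_ge_self])
    qed measurable
    from integral_completion_AE[OF m a] iV
    show "(\<exists>v. is_weak_deriv d \<Omega> \<alpha> g v) \<and> set_integrable (leb d) \<Omega> (\<lambda>x. (weak_deriv d \<Omega> \<alpha> g x)\<^sup>2)"
      and "(LINT x:\<Omega>|leb d. (weak_deriv d \<Omega> \<alpha> g x)\<^sup>2) = (LINT x|lebp d. indicator \<Omega> x * (V \<alpha> x)\<^sup>2)"
      using wd[OF \<alpha>] by (auto simp: set_integrable_def set_lebesgue_integral_def leb_def)
  qed
  have "in_H d m \<Omega> g" using main(1) by (simp add: in_H_def)
  moreover have "(\<Sum>\<alpha> | \<alpha> \<in> multi_indices d \<and> mi_order d \<alpha> \<le> m. LINT x:\<Omega>|leb d. (weak_deriv d \<Omega> \<alpha> g x)\<^sup>2) \<le> S"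
  proof -
    have "(\<Sum>\<alpha> | \<alpha> \<in> multi_indices d \<and> mi_order d \<alpha> \<le> m. LINT x:\<Omega>|leb d. (weak_deriv d \<Omega> \<alpha> g x)\<^sup>2)
      = (\<Sum>\<alpha> | \<alpha> \<in> multi_indices d \<and> mi_order d \<alpha> \<le> m. LINT x|lebp d. indicator \<Omega> x * (V \<alpha> x)\<^sup>2)"
      by (rule sum.cong) (auto simp: main(2))
    also have "\<dots> = (LINT x|lebp d. indicator \<Omega> x * (\<Sum>\<alpha> | \<alpha> \<in> multi_indices d \<and> mi_order d \<alpha> \<le> m. (V \<alpha> x)\<^sup>2))"
      unfolding sum_distrib_left by (rule Bochner_Integration.integral_sum[symmetric]) (auto intro: main(3))
    finally show ?thesis using le by simp
  qed
  ultimately show ?thesis unfolding H_norm_def by (auto intro!: ennreal_leI real_sqrt_le_mono)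
qed

subsection \<open>Sampling in Hilbert norm\<close>

text \<open>Expanding the power over ordered words avoids multinomial coefficients.\<close>

lemma sum_words:
  fixes z :: "nat \<Rightarrow> real"
  assumes "finite A"
  shows "(\<Sum>xs | set xs \<subseteq> A \<and> length xs = k. \<Prod>j\<leftarrow>xs. z j) = (\<Sum>i\<in>A. z i) ^ k"
proof (induction k)
  case 0
  have "{xs. set xs \<subseteq> A \<and> length xs = 0} = {[]}" by auto
  thus ?case by simp
next
  case (Suc k)
  let ?L = "\<lambda>k. {xs. set xs \<subseteq> A \<and> length xs = k}"
  have "(\<Sum>xs\<in>?L (Suc k). \<Prod>j\<leftarrow>xs. z j) = (\<Sum>(xs, i)\<in>?L k \<times> A. \<Prod>j\<leftarrow>i # xs. z j)"
    unfolding lists_length_Suc_eq by (subst sum.reindex) (auto simp: inj_on_def intro!: sum.cong)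
  also have "\<dots> = (\<Sum>xs\<in>?L k. \<Sum>i\<in>A. (\<Prod>j\<leftarrow>xs. z j) * z i)"
    by (subst sum.cartesian_product) (auto intro!: sum.cong simp: mult.commute)
  also have "\<dots> = (\<Sum>i\<in>A. z i) ^ k * (\<Sum>i\<in>A. z i)"
    by (simp add: sum_distrib_left[symmetric] sum_distrib_right[symmetric] Suc)
  finally show ?case by (simp add: mult.commute)
qed

abbreviation indices :: "nat \<Rightarrow> nat \<Rightarrow> (nat \<Rightarrow> nat) set" where
  "indices d m \<equiv> {\<alpha> \<in> multi_indices d. mi_order d \<alpha> \<le> m}"

lemma inj_word: "inj_on (word d) (multi_indices d)"
proof (rule inj_onI)
  fix \<alpha> \<beta> assume ab: "\<alpha> \<in> multi_indices d" "\<beta> \<in> multi_indices d" "word d \<alpha> = word d \<beta>"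
  show "\<alpha> = \<beta>"
  proof (rule extensionalityI[of _ "{..<d}"])
    fix i assume "i \<in> {..<d}"
    thus "\<alpha> i = \<beta> i" using ab(3) count_multi_index[of i d \<alpha>] count_multi_index[of i d \<beta>] by simp
  qed (use ab in \<open>auto simp: multi_indices_def PiE_def\<close>)
qed

lemma word_in: "set (word d \<alpha>) \<subseteq> {..<d}" "length (word d \<alpha>) = mi_order d \<alpha>"
  using length_word[of d \<alpha>] by (auto simp: word_def)

lemma finite_indices: "finite (indices d m)"
proof (rule finite_imageD)
  have "word d ` indices d m \<subseteq> {xs. set xs \<subseteq> {..<d} \<and> length xs \<le> m}" using word_in by auto
  thus "finite (word d ` indices d m)" by (rule finite_subset) (simp add: finite_lists_length_le)
  show "inj_on (word d) (indices d m)" by (rule inj_on_subset[OF inj_word]) auto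
qed

text \<open>Multi-indices embed into words by \<open>word d\<close>, and the squared monomials of
  all words of length \<open>k\<close> sum to \<open>enorm d w ^ (2 * k)\<close>. There are
  \<open>m + 1\<close> lengths, so no dimension appears; this is why the final constant is
  independent of \<open>d\<close>.\<close>

lemma sum_monomials_le:
  "(\<Sum>\<alpha>\<in>indices d m. (\<Prod>i<d. w i ^ \<alpha> i)\<^sup>2) \<le> (real m + 1) * (1 + enorm d w) ^ (2 * m)"
proof -
  let ?z = "\<lambda>i. (w i)\<^sup>2" and ?L = "\<lambda>k. {xs. set xs \<subseteq> {..<d} \<and> length xs = k}"
  have "(\<Sum>\<alpha>\<in>indices d m. (\<Prod>i<d. w i ^ \<alpha> i)\<^sup>2) = (\<Sum>\<alpha>\<in>indices d m. \<Prod>j\<leftarrow>word d \<alpha>. ?z j)"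
    unfolding prod_list_word prod_power_distrib
    by (simp add: power_mult[symmetric] mult.commute)
  also have "\<dots> = (\<Sum>xs\<in>word d ` indices d m. \<Prod>j\<leftarrow>xs. ?z j)"
    by (subst sum.reindex) (auto intro: inj_on_subset[OF inj_word])
  also have "\<dots> \<le> (\<Sum>xs\<in>(\<Union>k\<le>m. ?L k). \<Prod>j\<leftarrow>xs. ?z j)"
  proof (rule sum_mono2)
    show "finite (\<Union>k\<le>m. ?L k)" by (auto intro: finite_lists_length_eq)
    show "word d ` indices d m \<subseteq> (\<Union>k\<le>m. ?L k)" using word_in by auto
    fix xs show "0 \<le> (\<Prod>j\<leftarrow>xs. ?z j)" by (induction xs) auto
  qed
  also have "\<dots> = (\<Sum>k\<le>m. \<Sum>xs\<in>?L k. \<Prod>j\<leftarrow>xs. ?z j)"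
    by (rule sum.UNION_disjoint) (auto intro: finite_lists_length_eq)
  also have "\<dots> = (\<Sum>k\<le>m. (enorm d w)\<^sup>2 ^ k)"
    by (simp add: sum_words enorm_def L2_set_def sum_nonneg)
  also have "\<dots> \<le> (\<Sum>k\<le>m. (1 + enorm d w) ^ (2 * m))"
  proof (rule sum_mono)
    fix k assume "k \<in> {..m}"
    have "(enorm d w)\<^sup>2 ^ k = enorm d w ^ (2 * k)" by (simp add: power_mult)
    also have "\<dots> \<le> (1 + enorm d w) ^ (2 * k)" by (intro power_mono) (auto simp: enorm_nonneg)
    also have "\<dots> \<le> (1 + enorm d w) ^ (2 * m)"
      using \<open>k \<in> {..m}\<close> enorm_nonneg[of d w] by (intro power_increasing) auto
    finally show "(enorm d w)\<^sup>2 ^ k \<le> (1 + enorm d w) ^ (2 * m)" .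
  qed
  also have "\<dots> = (real m + 1) * (1 + enorm d w) ^ (2 * m)" by simp
  finally show ?thesis .
qed

lemma abs_le_of_sum_squares:
  fixes y :: "'i \<Rightarrow> real"
  assumes "finite I" "i \<in> I" "(\<Sum>i\<in>I. (y i)\<^sup>2) \<le> B"
  shows "\<bar>y i\<bar> \<le> sqrt B"
proof (rule real_le_rsqrt)
  have "(y i)\<^sup>2 \<le> (\<Sum>i\<in>I. (y i)\<^sup>2)" using assms by (intro member_le_sum) auto
  thus "\<bar>y i\<bar>\<^sup>2 \<le> B" using assms(3) by simp
qed

text \<open>In the application \<open>Y i \<theta>\<close> is the derivative with multi-index
  \<open>i\<close> of a randomly chosen ridge function. The bound concerns the sum of squares, so
  the cardinality of \<open>I\<close> does not enter the error estimate.\<close>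

locale sampling = prob_space M for M :: "'a measure" +
  fixes N :: "'b measure" and I :: "'i set" and Y :: "'i \<Rightarrow> 'a \<Rightarrow> 'b \<Rightarrow> real" and \<Omega> :: "'b set" and B :: real
  assumes N: "sigma_finite_measure N" and I: "finite I"
    and Y: "\<And>i. i \<in> I \<Longrightarrow> case_prod (Y i) \<in> borel_measurable (M \<Otimes>\<^sub>M N)"
    and \<Omega>: "\<Omega> \<in> sets N" and fin: "emeasure N \<Omega> < \<infinity>"
    and bound: "\<And>\<theta> x. \<theta> \<in> space M \<Longrightarrow> x \<in> \<Omega> \<Longrightarrow> (\<Sum>i\<in>I. (Y i \<theta> x)\<^sup>2) \<le> B"
begin

definition mean :: "'i \<Rightarrow> 'b \<Rightarrow> real" where
  "mean i x = expectation (\<lambda>\<theta>. Y i \<theta> x)"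

abbreviation energy :: "('i \<Rightarrow> 'b \<Rightarrow> real) \<Rightarrow> real" where
  "energy u \<equiv> LINT x|N. indicator \<Omega> x * (\<Sum>i\<in>I. (u i x)\<^sup>2)"

lemma Y1: "i \<in> I \<Longrightarrow> x \<in> space N \<Longrightarrow> (\<lambda>\<theta>. Y i \<theta> x) \<in> borel_measurable M"
  using measurable_compose[OF measurable_Pair2' Y, of x i] by auto

lemma Y2: "i \<in> I \<Longrightarrow> \<theta> \<in> space M \<Longrightarrow> Y i \<theta> \<in> borel_measurable N"
  using measurable_compose[OF measurable_Pair1' Y, of \<theta> i] by auto

lemma Y_abs: "i \<in> I \<Longrightarrow> \<theta> \<in> space M \<Longrightarrow> x \<in> \<Omega> \<Longrightarrow> \<bar>Y i \<theta> x\<bar> \<le> sqrt B"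
  using abs_le_of_sum_squares[OF I _ bound] by blast

lemma \<Omega>_space: "x \<in> \<Omega> \<Longrightarrow> x \<in> space N"
  using sets.sets_into_space[OF \<Omega>] by auto

lemma B_nonneg: "x \<in> \<Omega> \<Longrightarrow> 0 \<le> B"
proof -
  obtain \<theta> where "\<theta> \<in> space M" using not_empty by blast
  thus "x \<in> \<Omega> \<Longrightarrow> 0 \<le> B" using bound[of \<theta> x] sum_nonneg[of I "\<lambda>i. (Y i \<theta> x)\<^sup>2"] by force
qed

lemma integrable_Y: "i \<in> I \<Longrightarrow> x \<in> \<Omega> \<Longrightarrow> integrable M (\<lambda>\<theta>. Y i \<theta> x)"
  using Y_abs Y1 \<Omega>_space by (intro integrable_const_bound[of _ "sqrt B"]) auto

lemma mean_measurable: "i \<in> I \<Longrightarrow> mean i \<in> borel_measurable N"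
proof -
  assume "i \<in> I"
  hence "(\<lambda>(x, \<theta>). Y i \<theta> x) \<in> borel_measurable (N \<Otimes>\<^sub>M M)"
    using measurable_compose[OF measurable_pair_swap' Y[of i]] by (simp add: case_prod_unfold)
  thus ?thesis unfolding mean_def[abs_def] by (rule borel_measurable_lebesgue_integral)
qed

lemma mean_abs: "i \<in> I \<Longrightarrow> x \<in> \<Omega> \<Longrightarrow> \<bar>mean i x\<bar> \<le> sqrt B"
proof -
  assume i: "i \<in> I" "x \<in> \<Omega>"
  have "\<bar>mean i x\<bar> \<le> (\<integral>\<theta>. \<bar>Y i \<theta> x\<bar> \<partial>M)" unfolding mean_def by (rule integral_abs_bound)
  also have "\<dots> \<le> (\<integral>\<theta>. sqrt B \<partial>M)"
    using i by (intro integral_mono integrable_abs integrable_Y) (auto intro: Y_abs)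
  finally show ?thesis by (simp add: prob_space)
qed

lemma integrable_kernel:
  assumes k: "k \<in> borel_measurable (M \<Otimes>\<^sub>M N)" and b: "\<And>\<theta> x. \<theta> \<in> space M \<Longrightarrow> x \<in> \<Omega> \<Longrightarrow> \<bar>k (\<theta>, x)\<bar> \<le> (C :: real)"
  shows "integrable (M \<Otimes>\<^sub>M N) (\<lambda>(\<theta>, x). indicator \<Omega> x * k (\<theta>, x))"
proof -
  interpret N: sigma_finite_measure N by (rule N)
  interpret pair_sigma_finite M N ..
  note k[measurable] \<Omega>[measurable]
  have "integrable (M \<Otimes>\<^sub>M N) (\<lambda>z. C * indicator (space M \<times> \<Omega>) z)"
    using fin by (auto simp: N.emeasure_pair_measure_Times emeasure_space_1)
  thus ?thesis
  proof (rule integrable_dominated)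
    show "AE z in M \<Otimes>\<^sub>M N. norm (case z of (\<theta>, x) \<Rightarrow> indicator \<Omega> x * k (\<theta>, x)) \<le> norm (C * indicator (space M \<times> \<Omega>) z)"
      using b by (intro AE_I2) (fastforce simp: indicator_def space_pair_measure intro: order_trans[OF _ abs_ge_self])
  qed measurable
qed

text \<open>
  On average over \<open>\<theta>\<close> the cross term vanishes, hence some single \<open>\<theta>\<close> does at least as well. Iterating this
  choice replaces the product measure of \<open>n\<close> independent samples.
\<close>

lemma step:
  assumes P: "AE \<theta> in M. P \<theta>"
    and r: "\<And>i. i \<in> I \<Longrightarrow> r i \<in> borel_measurable N" "\<And>i x. i \<in> I \<Longrightarrow> x \<in> \<Omega> \<Longrightarrow> \<bar>r i x\<bar> \<le> c"
  shows "\<exists>\<theta>\<in>space M. P \<theta> \<and> energy (\<lambda>i x. r i x + mean i x - Y i \<theta> x)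
     \<le> energy r + B * measure N \<Omega>"
proof -
  interpret N: sigma_finite_measure N by (rule N)
  interpret pair_sigma_finite M N ..
  let ?k = "\<lambda>(\<theta>, x). \<Sum>i\<in>I. (r i x + mean i x - Y i \<theta> x)\<^sup>2"
  let ?\<Phi> = "\<lambda>\<theta>. energy (\<lambda>i x. r i x + mean i x - Y i \<theta> x)"
  let ?D = "energy r + B * measure N \<Omega>"
  note [measurable] = \<Omega>
  have km: "?k \<in> borel_measurable (M \<Otimes>\<^sub>M N)"
    unfolding case_prod_unfold
  proof (intro borel_measurable_sum borel_measurable_power borel_measurable_diff borel_measurable_add)
    fix i assume i: "i \<in> I"
    show "(\<lambda>z. r i (snd z)) \<in> borel_measurable (M \<Otimes>\<^sub>M N)" "(\<lambda>z. mean i (snd z)) \<in> borel_measurable (M \<Otimes>\<^sub>M N)"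
      using r(1)[OF i] mean_measurable[OF i] by measurable
    show "(\<lambda>z. Y i (fst z) (snd z)) \<in> borel_measurable (M \<Otimes>\<^sub>M N)" using Y[OF i] by (simp add: case_prod_unfold)
  qed
  have kb: "\<bar>?k (\<theta>, x)\<bar> \<le> (\<Sum>i\<in>I. (c + 2 * sqrt B)\<^sup>2)" if "\<theta> \<in> space M" "x \<in> \<Omega>" for \<theta> x
  proof -
    have "(r i x + mean i x - Y i \<theta> x)\<^sup>2 \<le> (c + 2 * sqrt B)\<^sup>2" if "i \<in> I" for i
      using r(2)[OF that \<open>x \<in> \<Omega>\<close>] mean_abs[OF that \<open>x \<in> \<Omega>\<close>] Y_abs[OF that \<open>\<theta> \<in> space M\<close> \<open>x \<in> \<Omega>\<close>]
      by (intro abs_le_square_iff[THEN iffD1]) linarith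
    hence "(\<Sum>i\<in>I. (r i x + mean i x - Y i \<theta> x)\<^sup>2) \<le> (\<Sum>i\<in>I. (c + 2 * sqrt B)\<^sup>2)" by (rule sum_mono)
    thus ?thesis by (simp only: prod.case abs_of_nonneg[OF sum_nonneg] zero_le_power2)
  qed
  have ik: "integrable (M \<Otimes>\<^sub>M N) (\<lambda>(\<theta>, x). indicator \<Omega> x * ?k (\<theta>, x))"
    by (rule integrable_kernel[OF km kb])
  have i\<Phi>: "integrable M ?\<Phi>" using integrable_fst'[OF ik] by simp
  have inner: "(LINT \<theta>|M. indicator \<Omega> x * (\<Sum>i\<in>I. (r i x + mean i x - Y i \<theta> x)\<^sup>2))
      \<le> indicator \<Omega> x * (\<Sum>i\<in>I. (r i x)\<^sup>2) + B * indicator \<Omega> x" for x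
  proof (cases "x \<in> \<Omega>")
    case True
    have iY2: "integrable M (\<lambda>\<theta>. (Y i \<theta> x)\<^sup>2)" if "i \<in> I" for i
    proof (rule integrable_const_bound[of _ B])
      have "(Y i \<theta> x)\<^sup>2 \<le> B" if "\<theta> \<in> space M" for \<theta>
        using bound[OF that True] member_le_sum[of i I "\<lambda>i. (Y i \<theta> x)\<^sup>2"] I \<open>i \<in> I\<close> by force
      thus "AE \<theta> in M. norm ((Y i \<theta> x)\<^sup>2) \<le> B" by (intro AE_I2) simp
    qed (use Y1[OF that \<Omega>_space[OF True]] in measurable)
    \<comment> \<open>The expected square is \<open>r^2\<close> plus the variance of
      \<open>Y\<close>; the term with the squared mean is dropped afterwards.\<close>
    have e: "(LINT \<theta>|M. (r i x + mean i x - Y i \<theta> x)\<^sup>2) = (r i x)\<^sup>2 - (mean i x)\<^sup>2 + (LINT \<theta>|M. (Y i \<theta> x)\<^sup>2)"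
        "integrable M (\<lambda>\<theta>. (r i x + mean i x - Y i \<theta> x)\<^sup>2)" if i: "i \<in> I" for i
    proof -
      have ex: "(r i x + mean i x - Y i \<theta> x)\<^sup>2 = (r i x + mean i x)\<^sup>2 - 2 * (r i x + mean i x) * Y i \<theta> x + (Y i \<theta> x)\<^sup>2" for \<theta>
        by (simp add: power2_eq_square algebra_simps)
      show "integrable M (\<lambda>\<theta>. (r i x + mean i x - Y i \<theta> x)\<^sup>2)"
        unfolding ex using integrable_Y[OF i True] iY2[OF i] by auto
      have "(LINT \<theta>|M. (r i x + mean i x - Y i \<theta> x)\<^sup>2) = (r i x + mean i x)\<^sup>2 - 2 * (r i x + mean i x) * mean i x + (LINT \<theta>|M. (Y i \<theta> x)\<^sup>2)"
        unfolding ex using integrable_Y[OF i True] iY2[OF i] by (simp add: prob_space mean_def)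
      thus "(LINT \<theta>|M. (r i x + mean i x - Y i \<theta> x)\<^sup>2) = (r i x)\<^sup>2 - (mean i x)\<^sup>2 + (LINT \<theta>|M. (Y i \<theta> x)\<^sup>2)"
        by (simp add: power2_eq_square algebra_simps)
    qed
    have "(\<Sum>i\<in>I. LINT \<theta>|M. (Y i \<theta> x)\<^sup>2) = (LINT \<theta>|M. (\<Sum>i\<in>I. (Y i \<theta> x)\<^sup>2))"
      using iY2 by (intro Bochner_Integration.integral_sum[symmetric]) auto
    also have "\<dots> \<le> (LINT \<theta>|M. B)"
      using iY2 bound True by (intro integral_mono) auto
    also have "\<dots> = B" by (simp add: prob_space)
    finally have yb: "(\<Sum>i\<in>I. LINT \<theta>|M. (Y i \<theta> x)\<^sup>2) \<le> B" .
    have "(LINT \<theta>|M. (\<Sum>i\<in>I. (r i x + mean i x - Y i \<theta> x)\<^sup>2)) = (\<Sum>i\<in>I. LINT \<theta>|M. (r i x + mean i x - Y i \<theta> x)\<^sup>2)"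
      using e(2) by (intro Bochner_Integration.integral_sum) auto
    also have "\<dots> = (\<Sum>i\<in>I. (r i x)\<^sup>2 - (mean i x)\<^sup>2 + (LINT \<theta>|M. (Y i \<theta> x)\<^sup>2))"
      by (intro sum.cong refl e)
    also have "\<dots> \<le> (\<Sum>i\<in>I. (r i x)\<^sup>2 + (LINT \<theta>|M. (Y i \<theta> x)\<^sup>2))" by (intro sum_mono) simp
    also have "\<dots> \<le> (\<Sum>i\<in>I. (r i x)\<^sup>2) + B" using yb by (simp add: sum.distrib)
    finally show ?thesis using True by simp
  qed simp
  have ir: "integrable N (\<lambda>x. indicator \<Omega> x * (\<Sum>i\<in>I. (r i x)\<^sup>2))"
  proof (rule integrable_dominated)
    show "integrable N (\<lambda>x. (\<Sum>i\<in>I. c\<^sup>2) * indicator \<Omega> x)" using fin by auto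
    have "(\<Sum>i\<in>I. (r i x)\<^sup>2) \<le> (\<Sum>i\<in>I. c\<^sup>2)" if "x \<in> \<Omega>" for x
      using r(2)[OF _ that] by (intro sum_mono abs_le_square_iff[THEN iffD1]) (auto intro: order_trans[OF _ abs_ge_self])
    thus "AE x in N. norm (indicator \<Omega> x * (\<Sum>i\<in>I. (r i x)\<^sup>2)) \<le> norm ((\<Sum>i\<in>I. c\<^sup>2) * indicator \<Omega> x)"
      by (intro AE_I2) (auto simp: indicator_def sum_nonneg)
    show "(\<lambda>x. indicator \<Omega> x * (\<Sum>i\<in>I. (r i x)\<^sup>2)) \<in> borel_measurable N"
      using r(1) by (intro borel_measurable_times borel_measurable_sum borel_measurable_power borel_measurable_indicator \<Omega>)
  qed
  have "expectation ?\<Phi> = (LINT x|N. LINT \<theta>|M. indicator \<Omega> x * (\<Sum>i\<in>I. (r i x + mean i x - Y i \<theta> x)\<^sup>2))"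
    using Fubini_integral[of "\<lambda>\<theta> x. indicator \<Omega> x * (\<Sum>i\<in>I. (r i x + mean i x - Y i \<theta> x)\<^sup>2)"] ik by simp
  also have "\<dots> \<le> (LINT x|N. indicator \<Omega> x * (\<Sum>i\<in>I. (r i x)\<^sup>2) + B * indicator \<Omega> x)"
    using ir fin integrable_snd[of "\<lambda>\<theta> x. indicator \<Omega> x * (\<Sum>i\<in>I. (r i x + mean i x - Y i \<theta> x)\<^sup>2)"] ik
    by (intro integral_mono inner Bochner_Integration.integrable_add) auto
  also have "\<dots> = ?D" using ir fin \<Omega>_space by (subst Bochner_Integration.integral_add) (auto intro!: arg_cong2[where f="(+)"])
  finally have E: "expectation ?\<Phi> \<le> ?D" .
  show ?thesis
  proof (rule ccontr)
    assume nt: "\<not> ?thesis"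
    \<comment> \<open>If every sample with property \<open>P\<close> exceeded \<open>?D\<close>,
      strict inequality would hold almost surely and hence in expectation. Keeping \<open>P\<close>
      inside the argument allows the samples to avoid a null set.\<close>
    have "AE \<theta> in M. ?D < ?\<Phi> \<theta>" using P AE_space
    proof eventually_elim
      case (elim \<theta>)
      thus ?case using nt by (auto simp: not_le)
    qed
    from expectation_greater[OF i\<Phi> this] E show False by simp
  qed
qed

text \<open>The error is left unnormalised: a new sample then changes it by \<open>mean - Y\<close>
  alone, and each step adds at most \<open>B * measure N \<Omega>\<close>. Division by
  \<open>n\<close> squared turns the linear growth into the factor \<open>1 / n\<close>.\<close>

lemma approximation:
  assumes P: "AE \<theta> in M. P \<theta>"
  shows "\<exists>\<theta>. (\<forall>j<n. \<theta> j \<in> space M \<and> P (\<theta> j)) \<and>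
    energy (\<lambda>i x. real n * mean i x - (\<Sum>j<n. Y i (\<theta> j) x)) \<le> real n * B * measure N \<Omega>"
proof (induction n)
  case (Suc n)
  then obtain \<theta> where \<theta>: "\<And>j. j < n \<Longrightarrow> \<theta> j \<in> space M" "\<And>j. j < n \<Longrightarrow> P (\<theta> j)"
    "energy (\<lambda>i x. real n * mean i x - (\<Sum>j<n. Y i (\<theta> j) x)) \<le> real n * B * measure N \<Omega>"
    by auto
  define r where "r i x = real n * mean i x - (\<Sum>j<n. Y i (\<theta> j) x)" for i x
  have rm: "r i \<in> borel_measurable N" if "i \<in> I" for i
    unfolding r_def using mean_measurable[OF that] Y2[OF that \<theta>(1)]
    by (intro borel_measurable_diff borel_measurable_times borel_measurable_sum) auto
  have rb: "\<bar>r i x\<bar> \<le> real n * sqrt B + real n * sqrt B" if "i \<in> I" "x \<in> \<Omega>" for i x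
  proof -
    have "\<bar>real n * mean i x\<bar> \<le> real n * sqrt B" using mean_abs[OF that] by (simp add: abs_mult mult_left_mono)
    moreover have "\<bar>\<Sum>j<n. Y i (\<theta> j) x\<bar> \<le> (\<Sum>j<n. sqrt B)"
      using Y_abs[OF that(1) \<theta>(1) that(2)] by (intro order_trans[OF sum_abs] sum_mono) auto
    ultimately show ?thesis unfolding r_def by (simp add: abs_le_iff)
  qed
  from step[where r=r, OF P rm rb] obtain t where t: "t \<in> space M" "P t"
    "energy (\<lambda>i x. r i x + mean i x - Y i t x) \<le> energy r + B * measure N \<Omega>"
    by blast
  let ?\<theta> = "\<theta>(n := t)"
  have "real (Suc n) * mean i x - (\<Sum>j<Suc n. Y i (?\<theta> j) x) = r i x + mean i x - Y i t x" for i x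
  proof -
    have "(\<Sum>j<n. Y i (?\<theta> j) x) = (\<Sum>j<n. Y i (\<theta> j) x)" by (intro sum.cong) auto
    thus ?thesis by (simp add: r_def algebra_simps)
  qed
  hence "energy (\<lambda>i x. real (Suc n) * mean i x - (\<Sum>j<Suc n. Y i (?\<theta> j) x))
      \<le> real (Suc n) * B * measure N \<Omega>"
    using t(3) \<theta>(3) unfolding r_def[symmetric] by (simp only:) (simp add: algebra_simps)
  moreover have "\<forall>j<Suc n. ?\<theta> j \<in> space M \<and> P (?\<theta> j)" using t \<theta> by (auto simp: less_Suc_eq)
  ultimately show ?case by blast
qed auto

end

text \<open>By Fubini, an integration by parts valid for every sample passes to the mean; no
  derivative is taken under the integral sign.\<close>

lemma (in sampling) mean_test_integral:
  assumes i: "i \<in> I" and \<psi>: "\<psi> \<in> borel_measurable N" "\<And>x. x \<in> \<Omega> \<Longrightarrow> \<bar>\<psi> x\<bar> \<le> c"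
  shows "(LINT \<theta>|M. LINT x|N. indicator \<Omega> x * (Y i \<theta> x * \<psi> x)) = (LINT x|N. indicator \<Omega> x * (mean i x * \<psi> x))"
proof -
  interpret N: sigma_finite_measure N by (rule N)
  interpret pair_sigma_finite M N ..
  note [measurable] = \<psi>(1)
  have km: "(\<lambda>(\<theta>, x). Y i \<theta> x * \<psi> x) \<in> borel_measurable (M \<Otimes>\<^sub>M N)"
    using Y[OF i] by (simp add: case_prod_unfold)
  have "integrable (M \<Otimes>\<^sub>M N) (\<lambda>(\<theta>, x). indicator \<Omega> x * (\<lambda>(\<theta>, x). Y i \<theta> x * \<psi> x) (\<theta>, x))"
  proof (rule integrable_kernel[OF km])
    fix \<theta> x assume "\<theta> \<in> space M" "x \<in> \<Omega>"
    thus "\<bar>(\<lambda>(\<theta>, x). Y i \<theta> x * \<psi> x) (\<theta>, x)\<bar> \<le> sqrt B * c"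
      using Y_abs[OF i] \<psi>(2)[of x] B_nonneg[of x] by (simp add: abs_mult mult_mono)
  qed
  hence ik: "integrable (M \<Otimes>\<^sub>M N) (\<lambda>(\<theta>, x). indicator \<Omega> x * (Y i \<theta> x * \<psi> x))" by simp
  have "(LINT \<theta>|M. LINT x|N. indicator \<Omega> x * (Y i \<theta> x * \<psi> x)) = (LINT x|N. LINT \<theta>|M. indicator \<Omega> x * (Y i \<theta> x * \<psi> x))"
    by (rule Fubini_integral[OF ik, symmetric])
  also have "\<dots> = (LINT x|N. indicator \<Omega> x * (mean i x * \<psi> x))"
    by (intro lint_cong) (simp add: mean_def)
  finally show ?thesis .
qed

section \<open>Sampling in the Sobolev norm\<close>

definition zero_index :: "nat \<Rightarrow> nat \<Rightarrow> nat" where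
  "zero_index d = (\<lambda>i\<in>{..<d}. 0)"

lemma zero_index: "zero_index d \<in> indices d m"
  by (auto simp: multi_indices_def mi_order_def zero_index_def)

lemma test_fun_indicator_integrable:
  assumes \<phi>: "test_fun d \<Omega> \<phi>" and \<Omega>: "\<Omega> \<in> sets (lebp d)" and u: "u \<in> borel_measurable (lebp d)" "\<And>x. x \<in> \<Omega> \<Longrightarrow> \<bar>u x\<bar> \<le> c"
  shows "integrable (lebp d) (\<lambda>x. indicator \<Omega> x * (u x * \<phi> x))"
proof -
  note [measurable] = \<Omega> u(1)
  have "(\<lambda>x. indicator \<Omega> x * u x) \<in> borel_measurable (lebp d)" by measurable
  from test_fun_integrable_mult[OF \<phi> this, of c] u(2) show ?thesis by (simp add: mult.assoc)
qed

text \<open>The samples are fixed before \<open>g\<close>, and \<open>g\<close> is prescribed only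
  almost everywhere. Hence \<open>g\<close> may be the error of a network built with
  \<open>\<sigma>\<close> itself, although \<open>Y\<close> is formed with Borel
  representatives.\<close>

lemma sobolev_sampling:
  fixes Y :: "(nat \<Rightarrow> nat) \<Rightarrow> 'a \<Rightarrow> vec \<Rightarrow> real"
  assumes op: "openin (Rtop d) \<Omega>" and fin: "emeasure (lebp d) \<Omega> < \<infinity>"
    and samp: "sampling M (lebp d) (indices d m) Y \<Omega> B"
    and ibp: "\<And>\<theta> \<alpha> \<phi>. \<theta> \<in> space M \<Longrightarrow> \<alpha> \<in> indices d m \<Longrightarrow> test_fun d \<Omega> \<phi> \<Longrightarrow>
       pairing d \<Omega> (Y (zero_index d) \<theta>) (mderiv d \<alpha> \<phi>) =
       (-1) ^ mi_order d \<alpha> * pairing d \<Omega> (Y \<alpha> \<theta>) \<phi>"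
    and P: "AE \<theta> in M. P \<theta>" and n: "n \<ge> 1"
  shows "\<exists>\<theta>. (\<forall>j<n. \<theta> j \<in> space M \<and> P (\<theta> j)) \<and>
    (\<forall>g\<in>borel_measurable (leb d). (AE x in lebp d. x \<in> \<Omega> \<longrightarrow> g x = (LINT \<theta>|M. Y (zero_index d) \<theta> x) - (\<Sum>j<n. Y (zero_index d) (\<theta> j) x) / real n) \<longrightarrow>
       H_norm d m \<Omega> g \<le> ennreal (sqrt (B * measure (lebp d) \<Omega> / real n)))"
proof -
  interpret sampling M "lebp d" "indices d m" Y \<Omega> B by (rule samp)
  note zI = zero_index[of d m]
  obtain \<theta> where \<theta>: "\<And>j. j < n \<Longrightarrow> \<theta> j \<in> space M" "\<And>j. j < n \<Longrightarrow> P (\<theta> j)"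
    and le: "(LINT x|lebp d. indicator \<Omega> x * (\<Sum>i\<in>indices d m. (real n * mean i x - (\<Sum>j<n. Y i (\<theta> j) x))\<^sup>2)) \<le> real n * B * measure (lebp d) \<Omega>"
    using approximation[OF P, of n] by blast
  \<comment> \<open>At \<open>zero_index d\<close> this is the error, at the other multi-indices its
    weak derivative.\<close>
  define V where "V \<alpha> x = mean \<alpha> x - (\<Sum>j<n. Y \<alpha> (\<theta> j) x) / real n" for \<alpha> x
  have Vm: "V \<alpha> \<in> borel_measurable (lebp d)" if "\<alpha> \<in> indices d m" for \<alpha>
    unfolding V_def using mean_measurable[OF that] Y2[OF that \<theta>(1)]
    by (intro borel_measurable_diff borel_measurable_divide borel_measurable_sum) auto
  have Vb: "\<bar>V \<alpha> x\<bar> \<le> 2 * sqrt B" if \<alpha>: "\<alpha> \<in> indices d m" and x: "x \<in> \<Omega>" for \<alpha> x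
  proof -
    have "\<bar>\<Sum>j<n. Y \<alpha> (\<theta> j) x\<bar> \<le> (\<Sum>j<n. sqrt B)"
      using Y_abs[OF \<alpha> \<theta>(1) x] by (intro order_trans[OF sum_abs] sum_mono) auto
    hence "\<bar>(\<Sum>j<n. Y \<alpha> (\<theta> j) x) / real n\<bar> \<le> sqrt B" using n by (simp add: field_simps)
    thus ?thesis using mean_abs[OF \<alpha> x] unfolding V_def by linarith
  qed
  have VT: "pairing d \<Omega> (V \<alpha>) \<phi> =
     pairing d \<Omega> (mean \<alpha>) \<phi> - (\<Sum>j<n. pairing d \<Omega> (Y \<alpha> (\<theta> j)) \<phi>) / real n"
    if \<alpha>: "\<alpha> \<in> indices d m" and \<phi>: "test_fun d \<Omega> \<phi>" for \<alpha> \<phi>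
  proof -
    have i1: "integrable (lebp d) (\<lambda>x. indicator \<Omega> x * (mean \<alpha> x * \<phi> x))"
      by (rule test_fun_indicator_integrable[OF \<phi> \<Omega> mean_measurable[OF \<alpha>] mean_abs[OF \<alpha>]])
    have i2: "integrable (lebp d) (\<lambda>x. indicator \<Omega> x * (Y \<alpha> (\<theta> j) x * \<phi> x))" if "j < n" for j
      by (rule test_fun_indicator_integrable[OF \<phi> \<Omega> Y2[OF \<alpha> \<theta>(1)[OF that]] Y_abs[OF \<alpha> \<theta>(1)[OF that]]])
    have e: "indicator \<Omega> x * (V \<alpha> x * \<phi> x) = indicator \<Omega> x * (mean \<alpha> x * \<phi> x) - (\<Sum>j<n. indicator \<Omega> x * (Y \<alpha> (\<theta> j) x * \<phi> x)) / real n" for x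
      by (simp add: V_def algebra_simps sum_distrib_left[symmetric] sum_distrib_right[symmetric])
    have i3: "integrable (lebp d) (\<lambda>x. (\<Sum>j<n. indicator \<Omega> x * (Y \<alpha> (\<theta> j) x * \<phi> x)) / real n)"
      using i2 by (intro integrable_divide Bochner_Integration.integrable_sum) auto
    have "(LINT x|lebp d. (\<Sum>j<n. indicator \<Omega> x * (Y \<alpha> (\<theta> j) x * \<phi> x)) / real n) = (\<Sum>j<n. pairing d \<Omega> (Y \<alpha> (\<theta> j)) \<phi>) / real n"
      using i2 by (subst integral_divide_zero, subst Bochner_Integration.integral_sum) auto
    thus ?thesis unfolding e using i1 i3 by (subst Bochner_Integration.integral_diff) auto
  qed
  have Vibp: "pairing d \<Omega> (V (zero_index d)) (mderiv d \<alpha> \<phi>) = (-1) ^ mi_order d \<alpha> * pairing d \<Omega> (V \<alpha>) \<phi>"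
    if \<alpha>: "\<alpha> \<in> indices d m" and \<phi>: "test_fun d \<Omega> \<phi>" for \<alpha> \<phi>
  proof -
    have b: "\<exists>c. \<forall>x\<in>\<Omega>. \<bar>\<psi> x\<bar> \<le> c" if \<psi>: "test_fun d \<Omega> \<psi>" for \<psi>
    proof -
      obtain K c where "compactin (Rtop d) K" "K \<subseteq> \<Omega>" and K: "\<And>x. x \<in> space_R d \<Longrightarrow> \<bar>\<psi> x\<bar> \<le> c * indicator K x"
        using test_fun_support[OF \<psi>] by blast
      have "\<bar>\<psi> x\<bar> \<le> \<bar>c\<bar>" if "x \<in> \<Omega>" for x
        using K[of x] \<Omega>_space[OF that] by (cases "x \<in> K") (auto simp: space_lebp)
      thus ?thesis by blast
    qed
    obtain c1 where c1: "\<And>x. x \<in> \<Omega> \<Longrightarrow> \<bar>\<phi> x\<bar> \<le> c1" using b[OF \<phi>] by blast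
    obtain c2 where c2: "\<And>x. x \<in> \<Omega> \<Longrightarrow> \<bar>mderiv d \<alpha> \<phi> x\<bar> \<le> c2" using b[OF test_fun_mderiv[OF \<phi>]] by blast
    have "pairing d \<Omega> (mean (zero_index d)) (mderiv d \<alpha> \<phi>) = (LINT \<theta>|M. pairing d \<Omega> (Y (zero_index d) \<theta>) (mderiv d \<alpha> \<phi>))"
      by (rule mean_test_integral[OF zI test_fun_borel[OF test_fun_mderiv[OF \<phi>]] c2, symmetric])
    also have "\<dots> = (LINT \<theta>|M. (-1) ^ mi_order d \<alpha> * pairing d \<Omega> (Y \<alpha> \<theta>) \<phi>)"
      by (intro lint_cong ibp \<alpha> \<phi>)
    also have "\<dots> = (-1) ^ mi_order d \<alpha> * (LINT \<theta>|M. pairing d \<Omega> (Y \<alpha> \<theta>) \<phi>)"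
      by (rule integral_mult_right_zero)
    also have "(LINT \<theta>|M. pairing d \<Omega> (Y \<alpha> \<theta>) \<phi>) = pairing d \<Omega> (mean \<alpha>) \<phi>"
      by (rule mean_test_integral[OF \<alpha> test_fun_borel[OF \<phi>] c1])
    finally have m: "pairing d \<Omega> (mean (zero_index d)) (mderiv d \<alpha> \<phi>) = (-1) ^ mi_order d \<alpha> * pairing d \<Omega> (mean \<alpha>) \<phi>" .
    have s: "(\<Sum>j<n. pairing d \<Omega> (Y (zero_index d) (\<theta> j)) (mderiv d \<alpha> \<phi>)) = (-1) ^ mi_order d \<alpha> * (\<Sum>j<n. pairing d \<Omega> (Y \<alpha> (\<theta> j)) \<phi>)"
      unfolding sum_distrib_left by (intro sum.cong refl ibp \<alpha> \<phi> \<theta>) auto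
    show ?thesis unfolding VT[OF zI test_fun_mderiv[OF \<phi>]] VT[OF \<alpha> \<phi>] m s by (simp add: right_diff_distrib)
  qed
  have VL: "(LINT x|lebp d. indicator \<Omega> x * (\<Sum>\<alpha>\<in>indices d m. (V \<alpha> x)\<^sup>2)) \<le> B * measure (lebp d) \<Omega> / real n"
  proof -
    have "real n * mean i x - (\<Sum>j<n. Y i (\<theta> j) x) = real n * V i x" for i x using n by (simp add: V_def field_simps)
    hence "(real n)\<^sup>2 * (LINT x|lebp d. indicator \<Omega> x * (\<Sum>\<alpha>\<in>indices d m. (V \<alpha> x)\<^sup>2)) \<le> real n * B * measure (lebp d) \<Omega>"
      using le by (simp add: power_mult_distrib sum_distrib_left[symmetric] mult.left_commute[of "indicator _ _"])
    thus ?thesis using n by (simp add: field_simps power2_eq_square)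
  qed
  have "H_norm d m \<Omega> g \<le> ennreal (sqrt (B * measure (lebp d) \<Omega> / real n))"
    if g: "g \<in> borel_measurable (leb d)" "AE x in lebp d. x \<in> \<Omega> \<longrightarrow> g x = (LINT \<theta>|M. Y (zero_index d) \<theta> x) - (\<Sum>j<n. Y (zero_index d) (\<theta> j) x) / real n" for g
  proof (rule H_norm_le[OF op fin])
    fix \<alpha> assume \<alpha>': "\<alpha> \<in> multi_indices d" "mi_order d \<alpha> \<le> m"
    hence \<alpha>: "\<alpha> \<in> indices d m" by simp
    show "is_weak_deriv d \<Omega> \<alpha> g (V \<alpha>)"
    proof (rule is_weak_derivI[OF \<Omega> g(1) Vm[OF zI] Vm[OF \<alpha>] _ Vb[OF zI] Vb[OF \<alpha>] Vibp[OF \<alpha>]])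
      show "AE x in lebp d. x \<in> \<Omega> \<longrightarrow> g x = V (zero_index d) x" using g(2) by (simp add: V_def mean_def)
    qed
    show "V \<alpha> \<in> borel_measurable (lebp d)" by (rule Vm[OF \<alpha>])
    show "\<bar>V \<alpha> x\<bar> \<le> 2 * sqrt B" if "x \<in> \<Omega>" for x by (rule Vb[OF \<alpha> that])
  qed (rule VL)
  thus ?thesis using \<theta> by blast
qed

subsection \<open>The activation function\<close>

text \<open>On the half-line an antiderivative is explicit. The sum with the reflection dominates
  the two-sided function, the origin being counted twice.\<close>

lemma decay_integrable:
  assumes "p > 1" shows "integrable lborel (\<lambda>t::real. (1 + \<bar>t\<bar>) powr (- p))"
proof -
  define f where "f t = (if t \<ge> 0 then (1 + t) powr (- p) else 0)" for t :: real
  have f: "integrable lborel f"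
  proof (rule integrableI_bounded)
    have "(\<integral>\<^sup>+t. ennreal (norm (f t)) \<partial>lborel) = (\<integral>\<^sup>+t. ennreal ((1 + \<bar>t\<bar>) powr (- p)) * indicator {0..} t \<partial>lborel)"
      by (intro nn_integral_cong) (auto simp: f_def indicator_def)
    also have "\<dots> = ennreal (0 - (- ((1 + 0) powr (1 - p) / (p - 1))))"
    proof (rule nn_integral_FTC_atLeast[where F="\<lambda>t. - ((1 + t) powr (1 - p) / (p - 1))"])
      show "((\<lambda>t. - ((1 + t) powr (1 - p) / (p - 1))) has_real_derivative (1 + \<bar>t\<bar>) powr (- p)) (at t)" if "0 \<le> t" for t
      proof -
        have "((\<lambda>t. (1 + t) powr (1 - p)) has_real_derivative (1 - p) * (1 + t) powr (- p)) (at t)"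
          using that by (auto intro!: derivative_eq_intros)
        from DERIV_minus[OF DERIV_cdivide[OF this, of "p - 1"]]
        have "((\<lambda>t. - ((1 + t) powr (1 - p) / (p - 1))) has_real_derivative - ((1 - p) * (1 + t) powr (- p) / (p - 1))) (at t)" .
        moreover have "- ((1 - p) * X / (p - 1)) = X" for X using assms by (simp add: field_simps)
        ultimately show ?thesis using that by simp
      qed
      have "((\<lambda>t::real. (1 + t) powr (1 - p)) \<longlongrightarrow> 0) at_top"
        using assms by (intro tendsto_neg_powr filterlim_tendsto_add_at_top[OF tendsto_const] filterlim_ident) auto
      thus "((\<lambda>t. - ((1 + t) powr (1 - p) / (p - 1))) \<longlongrightarrow> 0) at_top"
        using tendsto_minus[OF tendsto_divide[OF _ tendsto_const, of _ 0 _ "p - 1"]] assms by fastforce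
    qed auto
    also have "\<dots> < \<infinity>" by simp
    finally show "(\<integral>\<^sup>+t. ennreal (norm (f t)) \<partial>lborel) < \<infinity>" .
  qed (simp add: f_def[abs_def])
  have "integrable lborel (\<lambda>t. f (0 + (-1) * t))"
    using f by (subst lborel_integrable_real_affine_iff) auto
  hence "integrable lborel (\<lambda>t. f t + f (- t))" using f by simp
  thus ?thesis
    by (rule integrable_dominated) (auto simp: f_def intro!: AE_I2)
qed

lemma activation_representatives:
  fixes m :: nat and p :: real and \<sigma> :: "real \<Rightarrow> real"
  assumes p: "p > 1" and \<sigma>: "\<sigma> \<in> W_inf m"
    and dec: "\<exists>C\<^sub>p. \<forall>k\<le>m. AE t in lebesgue. \<bar>weak_deriv1 k \<sigma> t\<bar> \<le> C\<^sub>p * (1 + \<bar>t\<bar>) powr (- p)"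
  obtains C s where "weak_chain m C s" "\<And>k t. k \<le> m \<Longrightarrow> \<bar>s k t\<bar> \<le> C * (1 + \<bar>t\<bar>) powr (- p)"
    "AE t in lborel. \<sigma> t = s 0 t" "C \<ge> 0"
proof -
  obtain C where C: "\<And>k. k \<le> m \<Longrightarrow> AE t in lebesgue. \<bar>weak_deriv1 k \<sigma> t\<bar> \<le> C * (1 + \<bar>t\<bar>) powr (- p)" using dec by blast
  have wd: "is_weak_deriv1 k \<sigma> (weak_deriv1 k \<sigma>)" if k: "k \<le> m" for k
  proof -
    obtain v where "is_weak_deriv1 k \<sigma> v" using \<sigma> k by (auto simp: W_inf_def)
    thus ?thesis unfolding weak_deriv1_def by (rule someI[of "is_weak_deriv1 k \<sigma>"])
  qed
  have "\<exists>r. r \<in> borel_measurable borel \<and> (AE t in lborel. weak_deriv1 k \<sigma> t = r t)" if "k \<le> m" for k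
    using wd[OF that] locally_integrable1_borel[of "weak_deriv1 k \<sigma>"] unfolding is_weak_deriv1_def by blast
  then obtain r where r: "\<And>k. k \<le> m \<Longrightarrow> r k \<in> borel_measurable borel" "\<And>k. k \<le> m \<Longrightarrow> AE t in lborel. weak_deriv1 k \<sigma> t = r k t"
    by metis
  \<comment> \<open>Setting the value to zero where the bound fails changes the function on a null
    set only, yet makes the decay valid at every point; \<open>\<bar>C\<bar>\<close> keeps the
    threshold nonnegative.\<close>
  define s where "s k t = (if \<bar>r k t\<bar> \<le> \<bar>C\<bar> * (1 + \<bar>t\<bar>) powr (- p) then r k t else 0)" for k t
  have sm: "s k \<in> borel_measurable borel" if "k \<le> m" for k
  proof -
    note [measurable] = r(1)[OF that]
    show ?thesis unfolding s_def[abs_def] by measurable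
  qed
  have sb: "\<bar>s k t\<bar> \<le> \<bar>C\<bar> * (1 + \<bar>t\<bar>) powr (- p)" for k t by (simp add: s_def)
  have s1: "\<bar>s k t\<bar> \<le> \<bar>C\<bar>" for k t
  proof -
    have "(1 + \<bar>t\<bar>) powr (- p) \<le> 1" using p by (simp add: powr_minus_divide ge_one_powr_ge_zero)
    hence "\<bar>C\<bar> * (1 + \<bar>t\<bar>) powr (- p) \<le> \<bar>C\<bar>" by (simp add: mult_left_le)
    thus ?thesis using sb[of k t] by linarith
  qed
  have se: "AE t in lborel. weak_deriv1 k \<sigma> t = s k t" if "k \<le> m" for k
    using r(2)[OF that] C[OF that, unfolded AE_completion_iff]
  proof eventually_elim
    case (elim t)
    have "C * (1 + \<bar>t\<bar>) powr (- p) \<le> \<bar>C\<bar> * (1 + \<bar>t\<bar>) powr (- p)" by (intro mult_right_mono) auto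
    thus ?case using elim by (simp add: s_def)
  qed
  have int_eq: "(LINT t|lebesgue. weak_deriv1 k \<sigma> t * \<psi> t) = (LINT t|lborel. s k t * \<psi> t)"
    if k: "k \<le> m" and \<psi>: "test_fun1 \<psi>" for k \<psi>
  proof -
    note [measurable] = sm[OF k] test_fun1_borel[OF \<psi>]
    have "AE t in lborel. weak_deriv1 k \<sigma> t * \<psi> t = s k t * \<psi> t" using se[OF k] by eventually_elim simp
    thus ?thesis by (intro lebesgue_integral_AE_borel(1)) measurable
  qed
  have wk: "(LINT t|lborel. s k t * \<psi> t) = (-1) ^ k * (LINT t|lebesgue. \<sigma> t * (deriv ^^ k) \<psi> t)" if k: "k \<le> m" and \<psi>: "test_fun1 \<psi>" for k \<psi>
  proof -
    have "(LINT t|lebesgue. \<sigma> t * (deriv ^^ k) \<psi> t) = (-1) ^ k * (LINT t|lebesgue. weak_deriv1 k \<sigma> t * \<psi> t)"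
      using wd[OF k] \<psi> unfolding is_weak_deriv1_def by blast
    hence "(-1) ^ k * (LINT t|lebesgue. \<sigma> t * (deriv ^^ k) \<psi> t) = ((-1) ^ k * (-1) ^ k) * (LINT t|lborel. s k t * \<psi> t)"
      unfolding int_eq[OF k \<psi>] by (simp only: mult.assoc)
    thus ?thesis by (simp add: power_mult_distrib[symmetric])
  qed
  have "weak_chain m \<bar>C\<bar> s"
    unfolding weak_chain_def
  proof (intro conjI allI impI)
    fix k \<psi> assume k: "k < m" and \<psi>: "test_fun1 \<psi>"
    \<comment> \<open>Each \<open>s k\<close> is tied to \<open>\<sigma>\<close> through the
      derivative of order \<open>k\<close>; testing with \<open>deriv \<psi>\<close> makes the
      orders \<open>k\<close> and \<open>Suc k\<close> comparable.\<close>
    have "(LINT t|lborel. s k t * deriv \<psi> t) = (-1) ^ k * (LINT t|lebesgue. \<sigma> t * (deriv ^^ Suc k) \<psi> t)"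
      using wk[of k, OF _ test_fun1_deriv[OF \<psi>]] k by (simp add: funpow_Suc_right del: funpow.simps)
    also have "\<dots> = - (LINT t|lborel. s (Suc k) t * \<psi> t)" using wk[of "Suc k", OF _ \<psi>] k by simp
    finally show "(LINT t|lborel. s k t * deriv \<psi> t) = - (LINT t|lborel. s (Suc k) t * \<psi> t)" .
  qed (use sm s1 in auto)
  moreover have "AE t in lborel. \<sigma> t = s 0 t"
  proof -
    have "AE t in lborel. \<sigma> t = weak_deriv1 0 \<sigma> t"
      using wd[of 0] by (intro weak_deriv1_zero_unique) (auto simp: is_weak_deriv1_def)
    thus ?thesis using se[OF le0] by eventually_elim simp
  qed
  ultimately show ?thesis using sb by (intro that[of "\<bar>C\<bar>" s]) auto
qed

text \<open>By dominated convergence the Fourier transform is continuous at \<open>0\<close>, so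
  vanishing elsewhere would force it to vanish there too. The frequency \<open>0\<close> is excluded
  because \<open>a\<close> becomes a divisor.\<close>

lemma nonzero_frequency:
  fixes w :: "real \<Rightarrow> real"
  assumes w: "integrable lborel w" and nz: "\<not> (AE t in lborel. w t = 0)"
  shows "\<exists>a. a \<noteq> 0 \<and> (LINT t|lborel. w t *\<^sub>R iexp (a * t)) \<noteq> 0"
proof (rule ccontr)
  assume "\<not> ?thesis"
  hence z: "(LINT t|lborel. w t *\<^sub>R iexp (a * t)) = 0" if "a \<noteq> 0" for a using that by blast
  have [measurable]: "w \<in> borel_measurable borel" using w by auto
  have "(\<lambda>n. LINT t|lborel. w t *\<^sub>R iexp (1 / real (Suc n) * t)) \<longlonglongrightarrow> (LINT t|lborel. w t *\<^sub>R iexp (0 * t))"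
  proof (rule integral_dominated_convergence[where w="\<lambda>t. norm (w t)"])
    show "AE t in lborel. (\<lambda>n. w t *\<^sub>R iexp (1 / real (Suc n) * t)) \<longlonglongrightarrow> w t *\<^sub>R iexp (0 * t)"
    proof (rule AE_I2)
      fix t
      show "(\<lambda>n. w t *\<^sub>R iexp (1 / real (Suc n) * t)) \<longlonglongrightarrow> w t *\<^sub>R iexp (0 * t)"
        by (intro tendsto_intros LIMSEQ_Suc[OF lim_1_over_n])
    qed
  qed (use w in auto)
  hence "(LINT t|lborel. w t *\<^sub>R iexp (0 * t)) = 0"
    by (subst (asm) z) (auto simp: LIMSEQ_const_iff)
  hence "(LINT t|lborel. w t *\<^sub>R iexp (y * t)) = 0" for y using z by (cases "y = 0") auto
  from real_fourier_injective[OF w this] nz show False by simp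
qed

subsection \<open>The density on the parameters\<close>

lemma enorm_measurable: "enorm d \<in> borel_measurable (lebp d)"
proof -
  have "(\<lambda>x. \<Sum>i<d. (x i)\<^sup>2) \<in> borel_measurable (lebp d)"
    using lebp_component by (intro borel_measurable_sum borel_measurable_power) auto
  thus ?thesis unfolding enorm_def[abs_def] L2_set_def by measurable
qed

lemma dotp_le_enorm: "\<bar>dotp d w x\<bar> \<le> enorm d w * enorm d x"
proof -
  have "\<bar>dotp d w x\<bar> \<le> (\<Sum>i<d. \<bar>w i\<bar> * \<bar>x i\<bar>)"
    unfolding dotp_def by (rule order_trans[OF sum_abs]) (simp add: abs_mult)
  also have "\<dots> \<le> enorm d w * enorm d x" unfolding enorm_def by (rule L2_set_mult_ineq)
  finally show ?thesis .
qed

text \<open>\<open>x0\<close> and \<open>R\<close> enclose \<open>\<Omega>\<close> in a ball,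
  \<open>J\<close> is the mass of the decay bound, and \<open>N\<close> is the Barron norm. The
  function \<open>f\<close> is present only through \<open>g\<close> and \<open>N\<close>;
  \<open>nz\<close> ensures that the density can be normalised.\<close>

locale ridge_sampling =
  fixes d m :: nat and \<Omega> :: "vec set" and x0 :: vec and R p C J a N :: real
    and s :: "nat \<Rightarrow> real \<Rightarrow> real" and \<kappa> :: complex and g :: "vec \<Rightarrow> complex"
  assumes p: "p > 1" and op: "openin (Rtop d) \<Omega>" and fin: "emeasure (lebp d) \<Omega> < \<infinity>"
    and R: "R \<ge> 0" "\<And>x. x \<in> \<Omega> \<Longrightarrow> enorm d (\<lambda>i. x i - x0 i) \<le> R" and x0: "x0 \<in> space_R d"
    and C: "C \<ge> 0" and chain: "weak_chain m C s"
    and decay: "\<And>k t. k \<le> m \<Longrightarrow> \<bar>s k t\<bar> \<le> C * (1 + \<bar>t\<bar>) powr (- p)"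
    and J: "J \<ge> 0" "(\<integral>\<^sup>+t. ennreal ((1 + \<bar>t\<bar>) powr (- p)) \<partial>lborel) = ennreal J"
    and a: "a \<noteq> 0" and \<kappa>: "\<kappa> \<noteq> 0" "(LINT t|lborel. s 0 t *\<^sub>R iexp (a * t)) = \<kappa>"
    and g[measurable]: "g \<in> borel_measurable (lebp d)"
    and N: "N \<ge> 0" "(\<integral>\<^sup>+\<omega>. ennreal ((1 + enorm d \<omega>) ^ (m + 1) * norm (g \<omega>)) \<partial>lebp d) = ennreal N"
    and nz: "\<not> (AE \<omega> in lebp d. g \<omega> = 0)"
begin

text \<open>With \<open>t = \<tau> * u + b\<close> the character splits as
  \<open>exp (i a b) = exp (i a t) * exp (- i a \<tau> u)\<close>, and
  \<open>- a * \<tau> = 1\<close> turns the last factor into \<open>exp (i u)\<close>.\<close>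

definition \<tau> :: real where "\<tau> = - 1 / a"

definition W :: "vec \<Rightarrow> vec" where "W \<omega> = (\<lambda>i\<in>{..<d}. \<tau> * \<omega> i)"

text \<open>For \<open>x \<in> \<Omega>\<close> the maximum below is a lower bound of \<open>\<bar>W \<omega> \<cdot> x + b\<bar>\<close> that does not depend on \<open>x\<close>.\<close>

definition h :: "vec \<Rightarrow> real \<Rightarrow> real" where
  "h \<omega> b = (1 + max 0 (\<bar>dotp d (W \<omega>) x0 + b\<bar> - R * enorm d (W \<omega>))) powr (- p)"

text \<open>The coefficient of a ridge function in the plane-wave representation. Its real part
  suffices because the profile and the target are real.\<close>

definition q :: "vec \<times> real \<Rightarrow> real" where
  "q \<theta> = Re (g (fst \<theta>) * iexp (a * snd \<theta>) / \<kappa>)"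

text \<open>Each factor dominates one of \<open>y\<close>: the power bounds the monomial,
  \<open>norm (g (fst \<theta>))\<close> bounds \<open>q\<close> up to \<open>norm \<kappa>\<close>,
  and \<open>h\<close> bounds the profile up to \<open>C\<close>.\<close>

definition \<rho> :: "vec \<times> real \<Rightarrow> real" where
  "\<rho> \<theta> = (1 + enorm d (W (fst \<theta>))) ^ m * norm (g (fst \<theta>)) * h (fst \<theta>) (snd \<theta>)"

definition y :: "(nat \<Rightarrow> nat) \<Rightarrow> vec \<times> real \<Rightarrow> vec \<Rightarrow> real" where
  "y \<alpha> \<theta> x = (\<Prod>i<d. W (fst \<theta>) i ^ \<alpha> i) * ridge d (s (mi_order d \<alpha>)) (W (fst \<theta>)) (snd \<theta>) x * q \<theta>"

abbreviation \<Lambda> :: "(vec \<times> real) measure" where "\<Lambda> \<equiv> lebp d \<Otimes>\<^sub>M lborel"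

definition Z :: real where "Z = (LINT \<theta>|\<Lambda>. \<rho> \<theta>)"

definition K :: real where "K = (2 * R + 2 * J) * (max 1 \<bar>\<tau>\<bar>) ^ (m + 1)"

interpretation P: pair_sigma_finite "lebp d" "lborel :: real measure" ..

lemma W_space: "W \<omega> \<in> space_R d"
  by (simp add: W_def space_R_def)

lemma dotp_W: "dotp d (W \<omega>) x = \<tau> * dotp d \<omega> x"
  by (simp add: dotp_def W_def sum_distrib_left mult.assoc)

lemma enorm_W: "enorm d (W \<omega>) = \<bar>\<tau>\<bar> * enorm d \<omega>"
proof -
  have "(\<Sum>i<d. (W \<omega> i)\<^sup>2) = \<tau>\<^sup>2 * (\<Sum>i<d. (\<omega> i)\<^sup>2)"
    by (simp add: W_def sum_distrib_left power_mult_distrib)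
  thus ?thesis by (simp add: enorm_def L2_set_def real_sqrt_mult)
qed

lemma s_measurable: "k \<le> m \<Longrightarrow> s k \<in> borel_measurable borel"
  using chain by (simp add: weak_chain_def)

lemma h_pos: "0 < h \<omega> b"
  by (simp add: h_def add_pos_nonneg)

text \<open>By Cauchy-Schwarz the argument of the profile differs from its value at
  \<open>x0\<close> by at most \<open>R * enorm d (W \<omega>)\<close>, and the decay bound
  decreases in the modulus.\<close>

lemma s_le_h:
  assumes k: "k \<le> m" and x: "x \<in> \<Omega>"
  shows "\<bar>s k (dotp d (W \<omega>) x + b)\<bar> \<le> C * h \<omega> b"
proof -
  have "dotp d (W \<omega>) x - dotp d (W \<omega>) x0 = dotp d (W \<omega>) (\<lambda>i. x i - x0 i)"
    by (simp add: dotp_def sum_subtractf right_diff_distrib)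
  hence "\<bar>dotp d (W \<omega>) x - dotp d (W \<omega>) x0\<bar> \<le> enorm d (W \<omega>) * R"
    using dotp_le_enorm[of d "W \<omega>" "\<lambda>i. x i - x0 i"] mult_left_mono[OF R(2)[OF x] enorm_nonneg[of d "W \<omega>"]] by simp
  hence "max 0 (\<bar>dotp d (W \<omega>) x0 + b\<bar> - R * enorm d (W \<omega>)) \<le> \<bar>dotp d (W \<omega>) x + b\<bar>"
    by (auto simp: mult.commute)
  hence "(1 + \<bar>dotp d (W \<omega>) x + b\<bar>) powr (- p) \<le> h \<omega> b"
    unfolding h_def using p by (intro powr_mono2') auto
  thus ?thesis using decay[OF k, of "dotp d (W \<omega>) x + b"] C by (meson mult_left_mono order_trans)
qed

lemma enorm_W_measurable: "(\<lambda>\<omega>. enorm d (W \<omega>)) \<in> borel_measurable (lebp d)"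
  unfolding enorm_W using enorm_measurable[of d] by measurable

lemma h_measurable: "(\<lambda>\<theta>. h (fst \<theta>) (snd \<theta>)) \<in> borel_measurable \<Lambda>"
proof -
  have 1: "(\<lambda>\<theta>. enorm d (W (fst \<theta>))) \<in> borel_measurable \<Lambda>"
    by (rule measurable_compose[OF measurable_fst enorm_W_measurable])
  have 2: "(\<lambda>\<theta>. dotp d (fst \<theta>) x0) \<in> borel_measurable \<Lambda>"
    by (rule measurable_compose[OF measurable_fst dotp_measurable_left])
  show ?thesis unfolding h_def dotp_W using 1 2 by measurable
qed

lemma \<rho>_measurable: "\<rho> \<in> borel_measurable \<Lambda>"
proof -
  have [measurable]: "(\<lambda>\<theta>. enorm d (W (fst \<theta>))) \<in> borel_measurable \<Lambda>"
    by (rule measurable_compose[OF measurable_fst enorm_W_measurable])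
  note h_measurable[measurable]
  show ?thesis unfolding \<rho>_def[abs_def] by measurable
qed

lemma q_measurable: "q \<in> borel_measurable \<Lambda>"
  unfolding q_def[abs_def] by measurable

lemma \<rho>_nonneg: "0 \<le> \<rho> \<theta>"
  using h_pos[of "fst \<theta>" "snd \<theta>"] enorm_nonneg[of d "W (fst \<theta>)"] by (simp add: \<rho>_def)

lemma \<rho>_zero_iff: "\<rho> \<theta> = 0 \<longleftrightarrow> g (fst \<theta>) = 0"
  using h_pos[of "fst \<theta>" "snd \<theta>"] enorm_nonneg[of d "W (fst \<theta>)"] by (auto simp: \<rho>_def)

text \<open>In \<open>b\<close>, the function equals one on an interval of length
  \<open>2 * r\<close> and beyond it follows translates of the decay bound, each of mass
  \<open>J\<close> at most; hence \<open>2 * R + 2 * J\<close>.\<close>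

lemma h_integral: "(\<integral>\<^sup>+b. ennreal (h \<omega> b) \<partial>lborel) \<le> ennreal ((2 * R + 2 * J) * (1 + enorm d (W \<omega>)))"
proof -
  define r where "r = R * enorm d (W \<omega>)"
  define c where "c = dotp d (W \<omega>) x0"
  have r: "r \<ge> 0" using R(1) enorm_nonneg by (simp add: r_def)
  define f where "f t = (1 + \<bar>t\<bar>) powr (- p)" for t :: real
  have [measurable]: "f \<in> borel_measurable borel" unfolding f_def[abs_def] by measurable
  have f_shift: "(\<integral>\<^sup>+b. ennreal (f (e + b)) \<partial>lborel) = ennreal J" for e
    using nn_integral_real_affine[of "\<lambda>t. ennreal (f t)" 1 e] J(2) by (simp add: f_def)
  have le: "h \<omega> b \<le> indicator {- c - r..- c + r} b + f (c - r + b) + f (c + r + b)" for b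
  proof (cases "\<bar>c + b\<bar> \<le> r")
    case True
    have "h \<omega> b \<le> 1" using True p by (simp add: h_def r_def c_def)
    moreover have "b \<in> {- c - r..- c + r}" using True by (auto simp: abs_le_iff)
    moreover have "f t \<ge> 0" for t by (simp add: f_def)
    ultimately show ?thesis by (simp add: add_increasing2)
  next
    case False
    have f0: "f t \<ge> 0" for t by (simp add: f_def)
    consider "c + b > r" | "c + b < - r" using False r by linarith
    thus ?thesis
    proof cases
      case 1
      hence "h \<omega> b = f (c - r + b)" using r by (simp add: h_def f_def r_def[symmetric] c_def[symmetric] algebra_simps)
      thus ?thesis using f0[of "c + r + b"] by (simp add: indicator_def)
    next
      case 2
      hence "h \<omega> b = f (c + r + b)" using r by (simp add: h_def f_def r_def[symmetric] c_def[symmetric] algebra_simps)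
      thus ?thesis using f0[of "c - r + b"] by (simp add: indicator_def)
    qed
  qed
  have "(\<integral>\<^sup>+b. ennreal (h \<omega> b) \<partial>lborel) \<le>
     (\<integral>\<^sup>+b. indicator {- c - r..- c + r} b + ennreal (f (c - r + b)) + ennreal (f (c + r + b)) \<partial>lborel)"
  proof (rule nn_integral_mono)
    fix b
    have "ennreal (h \<omega> b) \<le> ennreal (indicator {- c - r..- c + r} b + f (c - r + b) + f (c + r + b))"
      by (rule ennreal_leI[OF le])
    also have "\<dots> = indicator {- c - r..- c + r} b + ennreal (f (c - r + b)) + ennreal (f (c + r + b))"
      by (simp add: f_def ennreal_indicator)
    finally show "ennreal (h \<omega> b) \<le> indicator {- c - r..- c + r} b + ennreal (f (c - r + b)) + ennreal (f (c + r + b))" .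
  qed
  also have "\<dots> = ennreal (2 * r) + ennreal J + ennreal J"
    using r by (simp add: nn_integral_add f_shift)
  also have "\<dots> = ennreal (2 * r + 2 * J)" using r J(1) by (simp flip: ennreal_plus)
  also have "\<dots> \<le> ennreal ((2 * R + 2 * J) * (1 + enorm d (W \<omega>)))"
    using R(1) J(1) enorm_nonneg[of d "W \<omega>"] by (intro ennreal_leI) (simp add: r_def algebra_simps)
  finally show ?thesis .
qed

lemma \<rho>_nn_integral: "(\<integral>\<^sup>+\<theta>. ennreal (\<rho> \<theta>) \<partial>\<Lambda>) \<le> ennreal (K * N)"
proof -
  \<comment> \<open>Compensates for the dilation by \<open>\<tau>\<close>:
    \<open>1 + \<bar>\<tau>\<bar> * e \<le> ?M * (1 + e)\<close> for
    \<open>e \<ge> 0\<close>.\<close>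
  let ?M = "max 1 \<bar>\<tau>\<bar>"
  note [measurable] = enorm_W_measurable enorm_measurable h_measurable \<rho>_measurable
  have hm: "(\<lambda>b. ennreal (h \<omega> b)) \<in> borel_measurable lborel" for \<omega>
    unfolding h_def by measurable
  have "(\<integral>\<^sup>+\<theta>. ennreal (\<rho> \<theta>) \<partial>\<Lambda>) = (\<integral>\<^sup>+\<omega>. \<integral>\<^sup>+b. ennreal (\<rho> (\<omega>, b)) \<partial>lborel \<partial>lebp d)"
    by (rule lborel.nn_integral_fst[symmetric]) measurable
  also have "\<dots> \<le> (\<integral>\<^sup>+\<omega>. ennreal ((2 * R + 2 * J) * ?M ^ (m + 1)) * ennreal ((1 + enorm d \<omega>) ^ (m + 1) * norm (g \<omega>)) \<partial>lebp d)"
  proof (rule nn_integral_mono)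
    fix \<omega>
    let ?e = "enorm d (W \<omega>)"
    have e: "0 \<le> ?e" "0 \<le> enorm d \<omega>" by (simp_all add: enorm_nonneg)
    have "(\<integral>\<^sup>+b. ennreal (\<rho> (\<omega>, b)) \<partial>lborel) = (\<integral>\<^sup>+b. ennreal ((1 + ?e) ^ m * norm (g \<omega>)) * ennreal (h \<omega> b) \<partial>lborel)"
      using e h_pos[of \<omega>] by (intro nn_integral_cong) (simp add: \<rho>_def ennreal_mult less_imp_le)
    also have "\<dots> = ennreal ((1 + ?e) ^ m * norm (g \<omega>)) * (\<integral>\<^sup>+b. ennreal (h \<omega> b) \<partial>lborel)"
      by (rule nn_integral_cmult[OF hm])
    also have "\<dots> \<le> ennreal ((1 + ?e) ^ m * norm (g \<omega>)) * ennreal ((2 * R + 2 * J) * (1 + ?e))"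
      by (intro mult_left_mono h_integral) simp
    also have "\<dots> = ennreal ((2 * R + 2 * J) * (1 + ?e) ^ (m + 1) * norm (g \<omega>))"
      using e R(1) J(1) by (subst ennreal_mult[symmetric]) (auto simp: mult_ac)
    also have "\<dots> \<le> ennreal ((2 * R + 2 * J) * (?M ^ (m + 1) * (1 + enorm d \<omega>) ^ (m + 1)) * norm (g \<omega>))"
    proof (intro ennreal_leI mult_right_mono mult_left_mono)
      have "1 + ?e \<le> ?M * (1 + enorm d \<omega>)"
        unfolding enorm_W distrib_left using mult_right_mono[of "\<bar>\<tau>\<bar>" ?M "enorm d \<omega>"] e by simp
      hence "(1 + ?e) ^ (m + 1) \<le> (?M * (1 + enorm d \<omega>)) ^ (m + 1)" using e by (intro power_mono) auto
      thus "(1 + ?e) ^ (m + 1) \<le> ?M ^ (m + 1) * (1 + enorm d \<omega>) ^ (m + 1)" by (simp only: power_mult_distrib)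
    qed (use R(1) J(1) in auto)
    also have "\<dots> = ennreal ((2 * R + 2 * J) * ?M ^ (m + 1)) * ennreal ((1 + enorm d \<omega>) ^ (m + 1) * norm (g \<omega>))"
      using e R(1) J(1) by (subst ennreal_mult[symmetric]) (auto simp: mult_ac)
    finally show "(\<integral>\<^sup>+b. ennreal (\<rho> (\<omega>, b)) \<partial>lborel) \<le> ennreal ((2 * R + 2 * J) * ?M ^ (m + 1)) * ennreal ((1 + enorm d \<omega>) ^ (m + 1) * norm (g \<omega>))" .
  qed
  also have "\<dots> = ennreal K * ennreal N"
    by (subst nn_integral_cmult, measurable) (simp only: N(2) K_def)
  also have "\<dots> = ennreal (K * N)" using N(1) R(1) J(1) by (subst ennreal_mult) (auto simp: K_def)
  finally show ?thesis .
qed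

lemma K_nonneg: "K \<ge> 0"
  using R(1) J(1) by (simp add: K_def)

lemma \<rho>_integrable: "integrable \<Lambda> \<rho>"
  using \<rho>_measurable \<rho>_nonneg \<rho>_nn_integral
  by (intro integrableI_bounded) (auto intro: le_less_trans)

lemma Z_eq: "(\<integral>\<^sup>+\<theta>. ennreal (\<rho> \<theta>) \<partial>\<Lambda>) = ennreal Z"
  unfolding Z_def using \<rho>_integrable \<rho>_nonneg by (intro nn_integral_eq_integral) auto

lemma Z_le: "Z \<le> K * N"
  using \<rho>_nn_integral K_nonneg N(1) unfolding Z_eq by (simp add: ennreal_le_iff)

lemma Z_pos: "Z > 0"
proof -
  have "Z \<ge> 0" unfolding Z_def using \<rho>_nonneg by simp
  moreover have "Z \<noteq> 0"
  proof
    assume "Z = 0"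
    hence "AE \<theta> in \<Lambda>. \<rho> \<theta> = 0"
      unfolding Z_def using \<rho>_integrable \<rho>_nonneg by (subst (asm) integral_nonneg_eq_0_iff_AE) auto
    hence "AE \<omega> in lebp d. AE b in lborel. \<rho> (\<omega>, b) = 0" by (rule P.AE_pair)
    hence "AE \<omega> in lebp d. g \<omega> = 0"
    proof eventually_elim
      case (elim \<omega>)
      hence "AE b in (lborel :: real measure). g \<omega> = 0" by (simp add: \<rho>_zero_iff)
      \<comment> \<open>\<open>lborel\<close> is not the zero measure, so a proposition free of
        \<open>b\<close> that holds for almost every \<open>b\<close> is true.\<close>
      thus "g \<omega> = 0" by (simp add: eventually_const_iff ae_filter_eq_bot_iff)
    qed
    thus False using nz by simp
  qed
  ultimately show ?thesis by simp
qed

definition \<mu> :: "(vec \<times> real) measure" where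
  "\<mu> = density \<Lambda> (\<lambda>\<theta>. ennreal (\<rho> \<theta> / Z))"

text \<open>Where \<open>\<rho>\<close> vanishes, so does \<open>y\<close>, and the division yields \<open>Y = 0\<close> as needed.\<close>

definition Y :: "(nat \<Rightarrow> nat) \<Rightarrow> vec \<times> real \<Rightarrow> vec \<Rightarrow> real" where
  "Y \<alpha> \<theta> x = Z * y \<alpha> \<theta> x / \<rho> \<theta>"

text \<open>\<open>Z * C / norm \<kappa>\<close> bounds \<open>Y\<close> up to the quotient of the
  monomial by the power in \<open>\<rho>\<close>; \<open>m + 1\<close> comes from summing the
  squared monomials.\<close>

definition B :: real where "B = (Z * C / norm \<kappa>)\<^sup>2 * (real m + 1)"

lemma \<mu>_prob: "prob_space \<mu>"
proof (rule prob_spaceI)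
  have [measurable]: "\<rho> \<in> borel_measurable \<Lambda>" by (rule \<rho>_measurable)
  have m: "(\<lambda>\<theta>. ennreal (\<rho> \<theta> / Z)) \<in> borel_measurable \<Lambda>" by measurable
  have "emeasure \<mu> (space \<mu>) = (\<integral>\<^sup>+\<theta>. ennreal (\<rho> \<theta> / Z) \<partial>\<Lambda>)"
    unfolding \<mu>_def space_density by (subst emeasure_density[OF m sets.top], intro nn_integral_cong) simp
  also have "\<dots> = ennreal (LINT \<theta>|\<Lambda>. \<rho> \<theta> / Z)"
    using \<rho>_integrable \<rho>_nonneg Z_pos by (intro nn_integral_eq_integral) auto
  also have "(LINT \<theta>|\<Lambda>. \<rho> \<theta> / Z) = 1" using Z_pos by (simp add: Z_def[symmetric])
  finally show "emeasure \<mu> (space \<mu>) = 1" by simp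
qed

lemma q_abs: "\<bar>q \<theta>\<bar> \<le> norm (g (fst \<theta>)) / norm \<kappa>"
proof -
  have "\<bar>q \<theta>\<bar> \<le> norm (g (fst \<theta>) * iexp (a * snd \<theta>) / \<kappa>)" unfolding q_def by (rule abs_Re_le_cmod)
  thus ?thesis by (simp add: norm_mult norm_divide)
qed

lemma Y_sum_le:
  assumes x: "x \<in> \<Omega>"
  shows "(\<Sum>\<alpha>\<in>indices d m. (Y \<alpha> \<theta> x)\<^sup>2) \<le> B"
proof (cases "\<rho> \<theta> = 0")
  case True
  thus ?thesis by (simp add: Y_def B_def)
next
  case False
  let ?w = "W (fst \<theta>)" and ?g = "norm (g (fst \<theta>))" and ?h = "h (fst \<theta>) (snd \<theta>)"
  let ?D = "(1 + enorm d ?w) ^ m" and ?c = "Z * C / norm \<kappa>"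
  have g0: "?g > 0" using False \<rho>_zero_iff by simp
  have D0: "?D > 0" using enorm_nonneg[of d ?w] by simp
  have \<rho>p: "\<rho> \<theta> > 0" using False \<rho>_nonneg[of \<theta>] by simp
  have "(Y \<alpha> \<theta> x)\<^sup>2 \<le> (?c / ?D)\<^sup>2 * (\<Prod>i<d. ?w i ^ \<alpha> i)\<^sup>2" if \<alpha>: "\<alpha> \<in> indices d m" for \<alpha>
  proof -
    let ?m = "\<Prod>i<d. ?w i ^ \<alpha> i"
    have "\<bar>y \<alpha> \<theta> x\<bar> \<le> \<bar>?m\<bar> * (C * ?h) * (?g / norm \<kappa>)"
      unfolding y_def ridge_def abs_mult using \<alpha> C h_pos[of "fst \<theta>" "snd \<theta>"]
      by (intro mult_mono s_le_h x q_abs order_refl) (auto simp: less_imp_le)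
    hence "\<bar>Y \<alpha> \<theta> x\<bar> \<le> Z * (\<bar>?m\<bar> * (C * ?h) * (?g / norm \<kappa>)) / \<rho> \<theta>"
    proof -
      assume le: "\<bar>y \<alpha> \<theta> x\<bar> \<le> \<bar>?m\<bar> * (C * ?h) * (?g / norm \<kappa>)"
      have "\<bar>Y \<alpha> \<theta> x\<bar> = Z * \<bar>y \<alpha> \<theta> x\<bar> / \<rho> \<theta>" using Z_pos \<rho>p by (simp add: Y_def abs_mult)
      also have "\<dots> \<le> Z * (\<bar>?m\<bar> * (C * ?h) * (?g / norm \<kappa>)) / \<rho> \<theta>"
        using Z_pos \<rho>p by (intro divide_right_mono mult_left_mono le) auto
      finally show ?thesis .
    qed
    \<comment> \<open>\<open>?g\<close> and \<open>?h\<close> cancel against \<open>\<rho>\<close>;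
      only the power \<open>?D\<close> survives, to be cancelled in turn by the sum of the squared
      monomials.\<close>
    also have "\<dots> = ?c / ?D * \<bar>?m\<bar>"
      using g0 D0 h_pos[of "fst \<theta>" "snd \<theta>"] \<kappa>(1) unfolding \<rho>_def by (simp add: field_simps)
    finally have "\<bar>Y \<alpha> \<theta> x\<bar>\<^sup>2 \<le> (?c / ?D * \<bar>?m\<bar>)\<^sup>2" by (intro power_mono) auto
    thus ?thesis unfolding power_mult_distrib[of "?c / ?D"] by simp
  qed
  hence "(\<Sum>\<alpha>\<in>indices d m. (Y \<alpha> \<theta> x)\<^sup>2) \<le> (\<Sum>\<alpha>\<in>indices d m. (?c / ?D)\<^sup>2 * (\<Prod>i<d. ?w i ^ \<alpha> i)\<^sup>2)"
    by (rule sum_mono)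
  also have "\<dots> \<le> (?c / ?D)\<^sup>2 * ((real m + 1) * (1 + enorm d ?w) ^ (2 * m))"
    unfolding sum_distrib_left[symmetric] by (intro mult_left_mono sum_monomials_le) auto
  also have "(1 + enorm d ?w) ^ (2 * m) = ?D\<^sup>2" by (simp add: power_mult[symmetric] mult.commute)
  also have "(?c / ?D)\<^sup>2 * ((real m + 1) * ?D\<^sup>2) = B"
  proof -
    have "(c / D)\<^sup>2 * (k * D\<^sup>2) = c\<^sup>2 * k" if "D > 0" for c D k :: real using that by (simp add: field_simps)
    from this[OF D0] show ?thesis unfolding B_def .
  qed
  finally show ?thesis .
qed

lemma Y_measurable:
  assumes \<alpha>: "\<alpha> \<in> indices d m"
  shows "case_prod (Y \<alpha>) \<in> borel_measurable (\<mu> \<Otimes>\<^sub>M lebp d)"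
proof -
  let ?L = "\<Lambda> \<Otimes>\<^sub>M lebp d"
  have k: "mi_order d \<alpha> \<le> m" using \<alpha> by simp
  have 1: "(\<lambda>z. \<rho> (fst z)) \<in> borel_measurable ?L" "(\<lambda>z. q (fst z)) \<in> borel_measurable ?L"
    by (rule measurable_compose[OF measurable_fst \<rho>_measurable], rule measurable_compose[OF measurable_fst q_measurable])
  have fs: "(\<lambda>z. fst (fst z)) \<in> measurable ?L (lebp d)" by measurable
  have 2: "(\<lambda>z. dotp d (fst (fst z)) (snd z)) \<in> borel_measurable ?L"
    by (rule dotp_measurable[OF fs measurable_snd])
  have "(\<lambda>z. \<tau> * dotp d (fst (fst z)) (snd z) + snd (fst z)) \<in> borel_measurable ?L"
    using 2 by measurable
  from measurable_compose[OF this s_measurable[OF k]]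
  have 3: "(\<lambda>z. ridge d (s (mi_order d \<alpha>)) (W (fst (fst z))) (snd (fst z)) (snd z)) \<in> borel_measurable ?L"
    unfolding ridge_def dotp_W .
  have 4: "(\<lambda>z. \<Prod>i<d. W (fst (fst z)) i ^ \<alpha> i) \<in> borel_measurable ?L"
  proof (intro borel_measurable_prod borel_measurable_power)
    fix i assume i: "i \<in> {..<d}"
    hence "(\<lambda>z. fst (fst z) i) \<in> borel_measurable ?L" using measurable_compose[OF fs lebp_component[of i d]] by simp
    thus "(\<lambda>z. W (fst (fst z)) i) \<in> borel_measurable ?L" using i by (simp add: W_def)
  qed
  have "(\<lambda>z. Y \<alpha> (fst z) (snd z)) \<in> borel_measurable ?L"
    unfolding Y_def y_def by (intro borel_measurable_divide borel_measurable_times 1 3 4) auto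
  moreover have "sets (\<mu> \<Otimes>\<^sub>M lebp d) = sets ?L" by (intro sets_pair_measure_cong) (auto simp: \<mu>_def)
  ultimately show ?thesis by (simp add: case_prod_unfold cong: measurable_cong_sets)
qed

lemma sampling_Y: "sampling \<mu> (lebp d) (indices d m) Y \<Omega> B"
proof -
  interpret prob_space \<mu> by (rule \<mu>_prob)
  show ?thesis
    by unfold_locales
      (auto intro: finite_indices Y_measurable openin_sets_lebp[OF op] Y_sum_le lebp.sigma_finite_measure_axioms fin simp del: mem_Collect_eq
        simp: less_top[symmetric] fin[unfolded infinity_ennreal_def less_top[symmetric]])
qed

lemma Y_ibp:
  assumes \<alpha>: "\<alpha> \<in> indices d m" and \<phi>: "test_fun d \<Omega> \<phi>"
  shows "pairing d \<Omega> (Y (zero_index d) \<theta>) (mderiv d \<alpha> \<phi>) =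
     (-1) ^ mi_order d \<alpha> * pairing d \<Omega> (Y \<alpha> \<theta>) \<phi>"
proof -
  let ?w = "W (fst \<theta>)" and ?b = "snd \<theta>" and ?c = "Z * q \<theta> / \<rho> \<theta>"
  have k: "mi_order d \<alpha> \<le> m" using \<alpha> by simp
  have z: "mi_order d (zero_index d) = 0" "(\<Prod>i<d. ?w i ^ zero_index d i) = 1"
    by (simp_all add: mi_order_def zero_index_def)
  have drop: "indicator \<Omega> x * (u * \<psi> x) = u * \<psi> x" if "test_fun d \<Omega> \<psi>" "x \<in> space (lebp d)" for \<psi> x u
    using test_fun_zero[OF that(1), of x] that(2) by (cases "x \<in> \<Omega>") (auto simp: space_lebp)
  have "pairing d \<Omega> (Y (zero_index d) \<theta>) (mderiv d \<alpha> \<phi>) =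
     (LINT x|lebp d. ?c * (ridge d (s 0) ?w ?b x * mderiv d \<alpha> \<phi> x))"
    by (intro lint_cong) (simp add: drop[OF test_fun_mderiv[OF \<phi>]] Y_def y_def z)
  also have "\<dots> = ?c * ((-1) ^ mi_order d \<alpha> * (LINT x|lebp d. (\<Prod>i<d. ?w i ^ \<alpha> i) * ridge d (s (mi_order d \<alpha>)) ?w ?b x * \<phi> x))"
    by (subst integral_mult_right_zero) (simp only: ridge_mderiv[OF chain \<phi> k])
  also have "\<dots> = (-1) ^ mi_order d \<alpha> * (LINT x|lebp d. ?c * ((\<Prod>i<d. ?w i ^ \<alpha> i) * ridge d (s (mi_order d \<alpha>)) ?w ?b x * \<phi> x))"
    by (subst integral_mult_right_zero) (simp only: mult_ac)
  also have "(LINT x|lebp d. ?c * ((\<Prod>i<d. ?w i ^ \<alpha> i) * ridge d (s (mi_order d \<alpha>)) ?w ?b x * \<phi> x)) =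
      pairing d \<Omega> (Y \<alpha> \<theta>) \<phi>"
    by (intro lint_cong) (simp add: drop[OF \<phi>] Y_def y_def)
  finally show ?thesis .
qed

text \<open>The density \<open>\<rho> / Z\<close> of \<open>\<mu>\<close> cancels the factor
  \<open>Z / \<rho>\<close> in \<open>Y\<close>, and the integral over \<open>b\<close> at fixed
  \<open>\<omega>\<close> reproduces the plane wave.\<close>

lemma mean_Y:
  assumes x: "x \<in> \<Omega>"
  shows "of_real (LINT \<theta>|\<mu>. Y (zero_index d) \<theta> x) = of_real (Re (LINT \<omega>|lebp d. g \<omega> * iexp (dotp d \<omega> x)))"
proof -
  have [measurable]: "\<rho> \<in> borel_measurable \<Lambda>" "q \<in> borel_measurable \<Lambda>" by (rule \<rho>_measurable, rule q_measurable)
  have xs: "x \<in> space (lebp d)" using x openin_subset[OF op] by (auto simp: space_lebp space_R_def)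
  have dm[measurable]: "(\<lambda>\<theta>. dotp d (fst \<theta>) x) \<in> borel_measurable \<Lambda>"
    by (rule measurable_compose[OF measurable_fst dotp_measurable_left])
  have s0[measurable]: "s 0 \<in> borel_measurable borel" by (rule s_measurable) simp
  define f where "f \<theta> = g (fst \<theta>) / \<kappa> * (of_real (s 0 (\<tau> * dotp d (fst \<theta>) x + snd \<theta>)) * iexp (a * snd \<theta>))" for \<theta>
  have fm[measurable]: "f \<in> borel_measurable \<Lambda>" unfolding f_def[abs_def] by measurable
  have yz: "y (zero_index d) \<theta> x = Re (f \<theta>)" for \<theta>
    by (simp add: y_def f_def q_def ridge_def dotp_W mi_order_def zero_index_def Re_divide_of_real[symmetric])
       (simp add: Re_divide complex_eq_iff algebra_simps)
  have fi: "integrable \<Lambda> f"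
  proof (rule integrable_dominated)
    show "integrable \<Lambda> (\<lambda>\<theta>. C / norm \<kappa> * \<rho> \<theta>)" using \<rho>_integrable by simp
    show "AE \<theta> in \<Lambda>. norm (f \<theta>) \<le> norm (C / norm \<kappa> * \<rho> \<theta>)"
    proof (rule AE_I2)
      fix \<theta>
      let ?h = "h (fst \<theta>) (snd \<theta>)" and ?D = "(1 + enorm d (W (fst \<theta>))) ^ m"
      have D: "?D \<ge> 1" using enorm_nonneg[of d "W (fst \<theta>)"] by simp
      have "norm (f \<theta>) = norm (g (fst \<theta>)) / norm \<kappa> * \<bar>s 0 (dotp d (W (fst \<theta>)) x + snd \<theta>)\<bar>"
        by (simp add: f_def norm_mult norm_divide dotp_W)
      also have "\<dots> \<le> norm (g (fst \<theta>)) / norm \<kappa> * (C * ?h)"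
        by (intro mult_left_mono s_le_h x) auto
      also have "\<dots> \<le> norm (g (fst \<theta>)) / norm \<kappa> * (C * ?h) * ?D"
        using mult_left_mono[OF D, of "norm (g (fst \<theta>)) / norm \<kappa> * (C * ?h)"] C h_pos[of "fst \<theta>" "snd \<theta>"] by simp
      also have "\<dots> = norm (C / norm \<kappa> * \<rho> \<theta>)"
        using C \<rho>_nonneg[of \<theta>] by (simp add: abs_mult) (simp add: \<rho>_def)
      finally show "norm (f \<theta>) \<le> norm (C / norm \<kappa> * \<rho> \<theta>)" .
    qed
  qed measurable
  have ym: "(\<lambda>\<theta>. Y (zero_index d) \<theta> x) \<in> borel_measurable \<Lambda>"
    unfolding Y_def yz by measurable
  have "(LINT \<theta>|\<mu>. Y (zero_index d) \<theta> x) = (LINT \<theta>|\<Lambda>. (\<rho> \<theta> / Z) *\<^sub>R Y (zero_index d) \<theta> x)"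
    unfolding \<mu>_def using ym \<rho>_nonneg Z_pos by (intro integral_density) auto
  also have "\<dots> = (LINT \<theta>|\<Lambda>. Re (f \<theta>))"
  proof (intro lint_cong)
    fix \<theta>
    show "(\<rho> \<theta> / Z) *\<^sub>R Y (zero_index d) \<theta> x = Re (f \<theta>)"
    proof (cases "\<rho> \<theta> = 0")
      case True
      hence "f \<theta> = 0" by (simp add: \<rho>_zero_iff f_def)
      thus ?thesis using True by simp
    next
      case False
      thus ?thesis using Z_pos by (simp add: Y_def yz)
    qed
  qed
  also have "\<dots> = Re (LINT \<theta>|\<Lambda>. f \<theta>)" by (rule integral_Re[OF fi])
  also have "(LINT \<theta>|\<Lambda>. f \<theta>) = (LINT \<omega>|lebp d. LINT b|lborel. f (\<omega>, b))"
    using P.integral_fst'[OF fi] by simp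
  also have "\<dots> = (LINT \<omega>|lebp d. g \<omega> * iexp (dotp d \<omega> x))"
  proof (intro lint_cong)
    fix \<omega>
    define u where "u = \<tau> * dotp d \<omega> x"
    have "(LINT b|lborel. f (\<omega>, b)) = g \<omega> / \<kappa> * (LINT b|lborel. of_real (s 0 (u + b)) * iexp (a * b))"
      unfolding f_def fst_conv snd_conv u_def by (rule integral_mult_right_zero)
    also have "(LINT b|lborel. of_real (s 0 (u + b)) * iexp (a * b)) = (LINT t|lborel. of_real (s 0 (u + (- u + 1 * t))) * iexp (a * (- u + 1 * t)))"
      by (subst lborel_integral_real_affine[of 1 _ "- u"]) auto
    also have "\<dots> = (LINT t|lborel. iexp (- a * u) * (s 0 t *\<^sub>R iexp (a * t)))"
    proof (intro lint_cong)
      fix t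
      have "a * (- u + 1 * t) = - a * u + a * t" by (simp add: algebra_simps)
      hence "iexp (a * (- u + 1 * t)) = iexp (- a * u) * iexp (a * t)"
        by (simp only: of_real_add distrib_left exp_add)
      moreover have "u + (- u + 1 * t) = t" by simp
      ultimately show "of_real (s 0 (u + (- u + 1 * t))) * iexp (a * (- u + 1 * t)) = iexp (- a * u) * (s 0 t *\<^sub>R iexp (a * t))"
        by (simp only: scaleR_conv_of_real mult_ac)
    qed
    also have "\<dots> = iexp (- a * u) * \<kappa>" using \<kappa>(2) by (subst integral_mult_right_zero) simp
    also have "- a * u = dotp d \<omega> x" using a by (simp add: u_def \<tau>_def)
    finally show "(LINT b|lborel. f (\<omega>, b)) = g \<omega> * iexp (dotp d \<omega> x)" using \<kappa>(1) by simp
  qed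
  finally show ?thesis by simp
qed

text \<open>For a single \<open>\<theta>\<close> the equality can fail, for instance if \<omega> = 0
  and \<open>b\<close> is an exceptional value. For fixed \<open>x\<close> and
  \<open>\<omega>\<close>, however, the argument is a translate of \<open>b\<close> and avoids a
  null set for almost every \<open>b\<close>; Fubini then exchanges the roles of \<open>x\<close>
  and \<open>\<theta>\<close>.\<close>

lemma AE_ridge_representative:
  assumes \<sigma>: "AE t in lborel. \<sigma> t = s 0 t"
  shows "AE \<theta> in \<mu>. AE x in lebp d. \<sigma> (dotp d (W (fst \<theta>)) x + snd \<theta>) = s 0 (dotp d (W (fst \<theta>)) x + snd \<theta>)"
proof -
  obtain E where E: "{t \<in> space lborel. \<sigma> t \<noteq> s 0 t} \<subseteq> E" "emeasure lborel E = 0" "E \<in> sets lborel"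
    using AE_E[OF \<sigma>] by blast
  hence Eb[measurable]: "E \<in> sets borel" by simp
  interpret PL: sigma_finite_measure \<Lambda> by unfold_locales
  interpret PP: pair_sigma_finite \<Lambda> "lebp d" ..
  have fs: "(\<lambda>z. fst (fst z)) \<in> measurable (\<Lambda> \<Otimes>\<^sub>M lebp d) (lebp d)" by measurable
  have [measurable]: "(\<lambda>z. dotp d (fst (fst z)) (snd z)) \<in> borel_measurable (\<Lambda> \<Otimes>\<^sub>M lebp d)"
    by (rule dotp_measurable[OF fs measurable_snd])
  have ms: "{z \<in> space (\<Lambda> \<Otimes>\<^sub>M lebp d). \<tau> * dotp d (fst (fst z)) (snd z) + snd (fst z) \<notin> E} \<in> sets (\<Lambda> \<Otimes>\<^sub>M lebp d)"
    by measurable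
  have "AE x in lebp d. AE \<theta> in \<Lambda>. \<tau> * dotp d (fst \<theta>) x + snd \<theta> \<notin> E"
  proof (rule AE_I2)
    fix x assume "x \<in> space (lebp d)"
    have [measurable]: "(\<lambda>\<theta>. dotp d (fst \<theta>) x) \<in> borel_measurable \<Lambda>"
      by (rule measurable_compose[OF measurable_fst dotp_measurable_left])
    have "AE \<omega> in lebp d. AE b in lborel. \<tau> * dotp d \<omega> x + b \<notin> E"
    proof (rule AE_I2)
      fix \<omega>
      let ?u = "\<tau> * dotp d \<omega> x"
      have "(\<integral>\<^sup>+t. indicator E t \<partial>lborel) = (\<integral>\<^sup>+b. indicator E (?u + b) \<partial>lborel)"
        using nn_integral_real_affine[of "indicator E" 1 ?u] by simp
      hence "(\<integral>\<^sup>+b. indicator E (?u + b) \<partial>lborel) = 0" using E(2) by simp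
      hence "AE b in lborel. indicator E (?u + b) = (0::ennreal)" by (subst (asm) nn_integral_0_iff_AE) auto
      thus "AE b in lborel. ?u + b \<notin> E" by eventually_elim (auto simp: indicator_def split: if_splits)
    qed
    hence "AE \<omega> in lebp d. AE b in lborel. (\<lambda>\<theta>. \<tau> * dotp d (fst \<theta>) x + snd \<theta> \<notin> E) (\<omega>, b)" by simp
    from P.AE_pair_measure[OF _ this] show "AE \<theta> in \<Lambda>. \<tau> * dotp d (fst \<theta>) x + snd \<theta> \<notin> E" by measurable
  qed
  hence "AE \<theta> in \<Lambda>. AE x in lebp d. \<tau> * dotp d (fst \<theta>) x + snd \<theta> \<notin> E"
    using PP.AE_commute[OF ms] by simp
  hence "AE \<theta> in \<mu>. AE x in lebp d. \<tau> * dotp d (fst \<theta>) x + snd \<theta> \<notin> E"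
    unfolding \<mu>_def using \<rho>_measurable by (subst AE_density) auto
  thus ?thesis
  proof eventually_elim
    case (elim \<theta>)
    thus ?case
    proof eventually_elim
      case (elim x)
      thus ?case using E(1) by (auto simp: dotp_W)
    qed
  qed
qed

lemma network_exists:
  assumes \<sigma>: "AE t in lborel. \<sigma> t = s 0 t" and f: "f \<in> borel_measurable (leb d)"
    and fg: "AE x in lebp d. of_real (f x) = (LINT \<omega>|lebp d. g \<omega> * iexp (dotp d \<omega> x))" and n: "n \<ge> 1"
  shows "\<exists>fn\<in>shallow_nets d n \<sigma>. H_norm d m \<Omega> (\<lambda>x. f x - fn x)
    \<le> ennreal (sqrt (measure (lebp d) \<Omega>) * (sqrt (real m + 1) * C / norm \<kappa> * K) * real n powr (- (1/2)) * N)"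
proof -
  define P where "P \<theta> \<longleftrightarrow> (AE x in lebp d. \<sigma> (dotp d (W (fst \<theta>)) x + snd \<theta>) = s 0 (dotp d (W (fst \<theta>)) x + snd \<theta>))" for \<theta>
  have "AE \<theta> in \<mu>. P \<theta>" unfolding P_def by (rule AE_ridge_representative[OF \<sigma>])
  from sobolev_sampling[OF op fin sampling_Y Y_ibp this n]
  obtain \<theta> where \<theta>: "\<And>j. j < n \<Longrightarrow> P (\<theta> j)"
    and H: "\<And>g. g \<in> borel_measurable (leb d) \<Longrightarrow>
      (AE x in lebp d. x \<in> \<Omega> \<longrightarrow> g x = (LINT \<theta>|\<mu>. Y (zero_index d) \<theta> x) - (\<Sum>j<n. Y (zero_index d) (\<theta> j) x) / real n) \<Longrightarrow>
      H_norm d m \<Omega> g \<le> ennreal (sqrt (B * measure (lebp d) \<Omega> / real n))"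
    by blast
  \<comment> \<open>The factor of \<open>s 0\<close> in
    \<open>Y (zero_index d) (\<theta> j) x / real n\<close>; for the zero multi-index the monomial
    is one.\<close>
  define \<beta> where "\<beta> j = Z * q (\<theta> j) / \<rho> (\<theta> j) / real n" for j
  define fn where "fn x = (\<Sum>j<n. \<beta> j * \<sigma> (dotp d (W (fst (\<theta> j))) x + snd (\<theta> j)))" for x
  define fn0 where "fn0 x = (\<Sum>j<n. Y (zero_index d) (\<theta> j) x) / real n" for x
  have Y0: "Y (zero_index d) (\<theta> j) x / real n = \<beta> j * s 0 (dotp d (W (fst (\<theta> j))) x + snd (\<theta> j))" for j x
    by (simp add: Y_def y_def \<beta>_def ridge_def mi_order_def zero_index_def)
  have net: "fn \<in> shallow_nets d n \<sigma>"
    unfolding shallow_nets_def mem_Collect_eq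
    by (intro exI[of _ \<beta>] exI[of _ "\<lambda>j. W (fst (\<theta> j))"] exI[of _ "\<lambda>j. snd (\<theta> j)"])
       (auto simp: fn_def W_space)
  have "AE x in lebp d. \<forall>j\<in>{..<n}. \<sigma> (dotp d (W (fst (\<theta> j))) x + snd (\<theta> j)) = s 0 (dotp d (W (fst (\<theta> j))) x + snd (\<theta> j))"
    using \<theta> unfolding P_def by (intro AE_ball_countable') auto
  hence fne: "AE x in lebp d. fn x = fn0 x"
    by eventually_elim (simp add: fn_def fn0_def sum_divide_distrib Y0)
  have "fn0 \<in> borel_measurable (lebp d)"
  proof -
    have "(\<lambda>x. s 0 (dotp d (W (fst (\<theta> j))) x + snd (\<theta> j))) \<in> borel_measurable (lebp d)" for j
      using ridge_measurable[OF s_measurable[of 0], of d "W (fst (\<theta> j))" "snd (\<theta> j)"] by (simp add: ridge_def[abs_def])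
    thus ?thesis unfolding fn0_def[abs_def] sum_divide_distrib Y0
      by (intro borel_measurable_sum borel_measurable_times) auto
  qed
  hence fnm: "fn \<in> borel_measurable (leb d)"
    unfolding leb_def using fne by (rule borel_measurable_completion_AE)
  have "H_norm d m \<Omega> (\<lambda>x. f x - fn x) \<le> ennreal (sqrt (B * measure (lebp d) \<Omega> / real n))"
  proof (rule H)
    show "(\<lambda>x. f x - fn x) \<in> borel_measurable (leb d)" using f fnm by measurable
    show "AE x in lebp d. x \<in> \<Omega> \<longrightarrow> f x - fn x = (LINT \<theta>|\<mu>. Y (zero_index d) \<theta> x) - (\<Sum>j<n. Y (zero_index d) (\<theta> j) x) / real n"
      using fg fne
    proof eventually_elim
      case (elim x)
      show ?case
      proof
        assume "x \<in> \<Omega>"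
        from mean_Y[OF this] have "(LINT \<theta>|\<mu>. Y (zero_index d) \<theta> x) = f x"
          unfolding elim(1)[symmetric] by simp
        thus "f x - fn x = (LINT \<theta>|\<mu>. Y (zero_index d) \<theta> x) - (\<Sum>j<n. Y (zero_index d) (\<theta> j) x) / real n"
          using elim(2) by (simp add: fn0_def)
      qed
    qed
  qed
  also have "\<dots> \<le> ennreal (sqrt (measure (lebp d) \<Omega>) * (sqrt (real m + 1) * C / norm \<kappa> * K) * real n powr (- (1/2)) * N)"
  proof (rule ennreal_leI)
    have "sqrt (B * measure (lebp d) \<Omega> / real n) = (Z * C / norm \<kappa>) * sqrt (real m + 1) * sqrt (measure (lebp d) \<Omega>) / sqrt (real n)"
      using Z_pos C by (simp add: B_def real_sqrt_mult real_sqrt_divide)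
    also have "\<dots> = (sqrt (measure (lebp d) \<Omega>) * (sqrt (real m + 1) * C / norm \<kappa>) / sqrt (real n)) * Z"
      by (simp add: field_simps)
    also have "\<dots> \<le> (sqrt (measure (lebp d) \<Omega>) * (sqrt (real m + 1) * C / norm \<kappa>) / sqrt (real n)) * (K * N)"
      using C by (intro mult_left_mono Z_le) auto
    also have "\<dots> = sqrt (measure (lebp d) \<Omega>) * (sqrt (real m + 1) * C / norm \<kappa> * K) * real n powr (- (1/2)) * N"
      using n by (simp add: powr_minus_divide powr_half_sqrt field_simps)
    finally show "sqrt (B * measure (lebp d) \<Omega> / real n) \<le> sqrt (measure (lebp d) \<Omega>) * (sqrt (real m + 1) * C / norm \<kappa> * K) * real n powr (- (1/2)) * N" .
  qed
  finally show ?thesis using net by blast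
qed

end

section \<open>Bounded domains and the proof of the theorem\<close>

lemma enorm_diff_le_diam:
  assumes \<Omega>: "bounded_domain d \<Omega>" and x: "x \<in> \<Omega>" "x0 \<in> \<Omega>"
  shows "enorm d (\<lambda>i. x i - x0 i) \<le> diam d \<Omega>"
proof -
  obtain r where r: "\<And>x. x \<in> \<Omega> \<Longrightarrow> enorm d x \<le> r" using \<Omega> by (auto simp: bounded_domain_def)
  \<comment> \<open>The supremum in \<open>diam\<close> is taken in the reals and is an upper bound
    only once boundedness is known.\<close>
  have "bdd_above ((\<lambda>(x, y). L2_set (\<lambda>i. x i - y i) {..<d}) ` (\<Omega> \<times> \<Omega>))"
  proof (rule bdd_aboveI2)
    fix z assume "z \<in> \<Omega> \<times> \<Omega>"
    then obtain x y where z: "z = (x, y)" "x \<in> \<Omega>" "y \<in> \<Omega>" by auto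
    have "L2_set (\<lambda>i. x i + - y i) {..<d} \<le> L2_set x {..<d} + L2_set (\<lambda>i. - y i) {..<d}"
      by (rule L2_set_triangle_ineq)
    also have "L2_set (\<lambda>i. - y i) {..<d} = L2_set y {..<d}" by (simp add: L2_set_def)
    also have "L2_set x {..<d} + L2_set y {..<d} \<le> r + r"
      using r[OF z(2)] r[OF z(3)] by (simp add: enorm_def)
    finally show "(case z of (x, y) \<Rightarrow> L2_set (\<lambda>i. x i - y i) {..<d}) \<le> r + r" by (simp add: z)
  qed
  from cSUP_upper[OF _ this, of "(x, x0)"] x show ?thesis by (simp add: diam_def enorm_def)
qed

lemma bounded_domain_finite:
  assumes "bounded_domain d \<Omega>"
  shows "emeasure (lebp d) \<Omega> < \<infinity>"
proof -
  obtain r where r: "\<And>x. x \<in> \<Omega> \<Longrightarrow> enorm d x \<le> r" using assms by (auto simp: bounded_domain_def)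
  have sub: "\<Omega> \<subseteq> Pi\<^sub>E {..<d} (\<lambda>i. {- r..r})"
  proof
    fix x assume x: "x \<in> \<Omega>"
    hence "x \<in> extensional {..<d}"
      using assms openin_subset[of "Rtop d" \<Omega>] by (auto simp: bounded_domain_def PiE_def)
    moreover have "x i \<in> {- r..r}" if "i < d" for i
    proof -
      have "\<bar>x i\<bar> \<le> enorm d x" unfolding enorm_def
        using member_le_L2_set[of "{..<d}" i "\<lambda>i. \<bar>x i\<bar>"] that by (simp add: L2_set_def)
      thus ?thesis using r[OF x] by (simp add: abs_le_iff)
    qed
    ultimately show "x \<in> Pi\<^sub>E {..<d} (\<lambda>i. {- r..r})" by (simp add: PiE_iff)
  qed
  have "emeasure (lebp d) \<Omega> \<le> emeasure (lebp d) (Pi\<^sub>E {..<d} (\<lambda>i. {- r..r}))"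
    by (intro emeasure_mono sub sets_PiM_I_finite) auto
  also have "\<dots> < \<infinity>" by (rule emeasure_box_finite)
  finally show ?thesis .
qed

lemma H_norm_AE_zero:
  assumes op: "openin (Rtop d) \<Omega>" and fin: "emeasure (lebp d) \<Omega> < \<infinity>"
    and f: "f \<in> borel_measurable (leb d)" "AE x in lebp d. f x = 0"
  shows "H_norm d m \<Omega> f = 0"
proof -
  have "is_weak_deriv d \<Omega> \<alpha> f (\<lambda>_. 0)" for \<alpha>
  proof (rule is_weak_derivI[OF openin_sets_lebp[OF op] f(1)])
    show "AE x in lebp d. x \<in> \<Omega> \<longrightarrow> f x = 0" using f(2) by eventually_elim simp
  qed auto
  hence "H_norm d m \<Omega> f \<le> ennreal (sqrt 0)"
    by (intro H_norm_le[OF op fin, where V="\<lambda>_ _. 0" and B=0]) auto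
  thus ?thesis by simp
qed

theorem theorem2:
  fixes m :: nat and p :: real and \<sigma> :: "real \<Rightarrow> real"
  assumes "p > 1"
    and "\<sigma> \<in> W_inf m"
    and "\<not> (AE t in lebesgue. \<sigma> t = 0)"
    and "\<exists>C\<^sub>p. \<forall>k\<le>m. AE t in lebesgue. \<bar>weak_deriv1 k \<sigma> t\<bar> \<le> C\<^sub>p * (1 + \<bar>t\<bar>) powr (- p)"
  shows "\<exists>C :: real \<Rightarrow> real. \<forall>d \<Omega>. d \<ge> 1 \<longrightarrow> bounded_domain d \<Omega> \<longrightarrow>
           (\<forall>f \<in> barron_space d (real (m + 1)). \<forall>n\<ge>1.
              (INF f\<^sub>n \<in> shallow_nets d n \<sigma>. H_norm d m \<Omega> (\<lambda>x. f x - f\<^sub>n x))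
                \<le> ennreal (sqrt (measure (leb d) \<Omega>) * C (diam d \<Omega>) * real n powr (- (1 / 2)))
                    * barron_norm d (real (m + 1)) f)"
proof -
  obtain c s where chain: "weak_chain m c s" and decay: "\<And>k t. k \<le> m \<Longrightarrow> \<bar>s k t\<bar> \<le> c * (1 + \<bar>t\<bar>) powr (- p)"
    and \<sigma>s: "AE t in lborel. \<sigma> t = s 0 t" and c: "c \<ge> 0"
    using activation_representatives[OF assms(1,2,4)] by blast
  have wt: "integrable lborel (\<lambda>t::real. (1 + \<bar>t\<bar>) powr (- p))" by (rule decay_integrable[OF assms(1)])
  define J where "J = (LINT t|lborel. (1 + \<bar>t\<bar>) powr (- p))"
  have J: "J \<ge> 0" "(\<integral>\<^sup>+t. ennreal ((1 + \<bar>t\<bar>) powr (- p)) \<partial>lborel) = ennreal J"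
    unfolding J_def using wt by (auto intro!: nn_integral_eq_integral)
  have s0m: "s 0 \<in> borel_measurable borel" using chain by (simp add: weak_chain_def)
  have "integrable lborel (\<lambda>t. c * (1 + \<bar>t\<bar>) powr (- p))" using wt by simp
  hence s0i: "integrable lborel (s 0)"
  proof (rule integrable_dominated)
    show "AE t in lborel. norm (s 0 t) \<le> norm (c * (1 + \<bar>t\<bar>) powr (- p))"
      using decay[OF le0] c by (intro AE_I2) simp
  qed (use s0m in simp)
  have "\<not> (AE t in lborel. s 0 t = 0)"
  proof
    assume "AE t in lborel. s 0 t = 0"
    with \<sigma>s have "AE t in lborel. \<sigma> t = 0" by eventually_elim simp
    thus False using assms(3) by (simp add: AE_completion_iff)
  qed
  from nonzero_frequency[OF s0i this] obtain a where a: "a \<noteq> 0" "(LINT t|lborel. s 0 t *\<^sub>R iexp (a * t)) \<noteq> 0"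
    by blast
  define \<kappa> where "\<kappa> = (LINT t|lborel. s 0 t *\<^sub>R iexp (a * t))"
  \<comment> \<open>The constant \<open>K\<close> of the sampling argument as a function of the
    radius. Besides \<open>R\<close> it involves only \<open>m\<close>, \<open>J\<close> and
    \<open>a\<close>, which are determined from \<open>p\<close>, \<open>m\<close> and
    \<open>\<sigma>\<close> before \<open>d\<close>, \<open>\<Omega>\<close> and \<open>f\<close>
    are introduced.\<close>
  define D where "D R = (2 * R + 2 * J) * (max 1 \<bar>- 1 / a\<bar>) ^ (m + 1)" for R
  define C where "C R = sqrt (real m + 1) * c / norm \<kappa> * D R" for R
  show ?thesis
  proof (intro exI[of _ C] allI impI ballI)
    fix d n :: nat and \<Omega> f
    assume \<Omega>: "bounded_domain d \<Omega>" and f: "f \<in> barron_space d (real (m + 1))" and n: "n \<ge> 1"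
    have op: "openin (Rtop d) \<Omega>" using \<Omega> by (simp add: bounded_domain_def)
    note fin = bounded_domain_finite[OF \<Omega>]
    obtain x0 where x0: "x0 \<in> \<Omega>" using \<Omega> by (auto simp: bounded_domain_def)
    have x0s: "x0 \<in> space_R d" using x0 openin_subset[OF op] by (auto simp: space_R_def)
    define R where "R = diam d \<Omega>"
    have R: "enorm d (\<lambda>i. x i - x0 i) \<le> R" if "x \<in> \<Omega>" for x
      unfolding R_def by (rule enorm_diff_le_diam[OF \<Omega> that x0])
    have R0: "R \<ge> 0" using R[OF x0] by (simp add: enorm_def L2_set_def)
    define G where "G = fourier_transform d f"
    have ex: "\<exists>g. is_fourier_transform d f g"
      using f by (auto simp: barron_space_def barron_norm_def split: if_splits)
    hence ft: "is_fourier_transform d f G"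
      unfolding G_def fourier_transform_def by (rule someI_ex)
    hence fm: "f \<in> borel_measurable (leb d)" and Gm: "G \<in> borel_measurable (completion (lebp d))"
      by (simp_all add: is_fourier_transform_def leb_def)
    have "(\<lambda>\<omega>. Re (G \<omega>)) \<in> borel_measurable (completion (lebp d))"
      and "(\<lambda>\<omega>. Im (G \<omega>)) \<in> borel_measurable (completion (lebp d))"
      using Gm by (auto intro: measurable_compose[OF Gm])
    note ReIm = this[THEN completion_ex_borel_measurable_real]
    obtain g1 where g1[measurable]: "g1 \<in> borel_measurable (lebp d)" and g1e: "AE \<omega> in lebp d. Re (G \<omega>) = g1 \<omega>"
      using ReIm(1) by blast
    obtain g2 where g2[measurable]: "g2 \<in> borel_measurable (lebp d)" and g2e: "AE \<omega> in lebp d. Im (G \<omega>) = g2 \<omega>"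
      using ReIm(2) by blast
    define g where "g \<omega> = of_real (g1 \<omega>) + \<i> * of_real (g2 \<omega>)" for \<omega>
    have gm[measurable]: "g \<in> borel_measurable (lebp d)" unfolding g_def[abs_def] by measurable
    have ge: "AE \<omega> in lebp d. G \<omega> = g \<omega>"
      using g1e g2e by eventually_elim (simp add: g_def complex_eq_iff)
    have "barron_norm d (real (m + 1)) f = (\<integral>\<^sup>+\<omega>. ennreal ((1 + enorm d \<omega>) powr real (m + 1) * norm (G \<omega>)) \<partial>lebp d)"
      using ex by (simp add: barron_norm_def G_def leb_def nn_integral_completion)
    also have "\<dots> = (\<integral>\<^sup>+\<omega>. ennreal ((1 + enorm d \<omega>) ^ (m + 1) * norm (g \<omega>)) \<partial>lebp d)"
    proof (rule nn_integral_cong_AE)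
      show "AE \<omega> in lebp d. ennreal ((1 + enorm d \<omega>) powr real (m + 1) * norm (G \<omega>)) = ennreal ((1 + enorm d \<omega>) ^ (m + 1) * norm (g \<omega>))"
        using ge
      proof eventually_elim
        case (elim \<omega>)
        have "0 < 1 + enorm d \<omega>" using enorm_nonneg[of d \<omega>] by simp
        thus ?case unfolding elim by (subst powr_realpow) auto
      qed
    qed
    finally have bn: "barron_norm d (real (m + 1)) f = (\<integral>\<^sup>+\<omega>. ennreal ((1 + enorm d \<omega>) ^ (m + 1) * norm (g \<omega>)) \<partial>lebp d)" .
    hence "(\<integral>\<^sup>+\<omega>. ennreal ((1 + enorm d \<omega>) ^ (m + 1) * norm (g \<omega>)) \<partial>lebp d) < \<infinity>"
      using f by (simp add: barron_space_def)
    then obtain N where N: "N \<ge> 0" "(\<integral>\<^sup>+\<omega>. ennreal ((1 + enorm d \<omega>) ^ (m + 1) * norm (g \<omega>)) \<partial>lebp d) = ennreal N"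
      unfolding infinity_ennreal_def less_top_ennreal by blast
    \<comment> \<open>The Barron weight is at least one, so a finite Barron norm makes the transform
      integrable, as inversion requires.\<close>
    have gi: "integrable (lebp d) g"
    proof (rule integrableI_bounded[OF gm])
      have "(\<integral>\<^sup>+\<omega>. ennreal (norm (g \<omega>)) \<partial>lebp d) \<le> (\<integral>\<^sup>+\<omega>. ennreal ((1 + enorm d \<omega>) ^ (m + 1) * norm (g \<omega>)) \<partial>lebp d)"
      proof (intro nn_integral_mono ennreal_leI)
        fix \<omega>
        have "1 \<le> (1 + enorm d \<omega>) ^ (m + 1)" using enorm_nonneg[of d \<omega>] by (intro one_le_power) simp
        from mult_right_mono[OF this, of "norm (g \<omega>)"]
        show "norm (g \<omega>) \<le> (1 + enorm d \<omega>) ^ (m + 1) * norm (g \<omega>)" by simp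
      qed
      thus "(\<integral>\<^sup>+\<omega>. ennreal (norm (g \<omega>)) \<partial>lebp d) < \<infinity>" unfolding N(2) by (rule le_less_trans) simp
    qed
    have inv: "AE x in lebp d. of_real (f x) = (LINT \<omega>|lebp d. g \<omega> * iexp (dotp d \<omega> x))"
      by (rule fourier_inversion[OF ft ge gi])
    have "\<exists>fn\<in>shallow_nets d n \<sigma>. H_norm d m \<Omega> (\<lambda>x. f x - fn x)
       \<le> ennreal (sqrt (measure (lebp d) \<Omega>) * C R * real n powr (- (1 / 2)) * N)"
    proof (cases "AE \<omega> in lebp d. g \<omega> = 0")
      \<comment> \<open>The density would have mass zero and could not be normalised. By inversion
        \<open>f\<close> is zero almost everywhere, and zero outer weights suffice.\<close>
      case True
      have "(LINT \<omega>|lebp d. g \<omega> * iexp (dotp d \<omega> x)) = 0" for x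
      proof (rule integral_eq_zero_AE)
        show "AE \<omega> in lebp d. g \<omega> * iexp (dotp d \<omega> x) = 0" using True by eventually_elim simp
      qed
      hence "AE x in lebp d. f x = 0" using inv by simp
      hence "H_norm d m \<Omega> (\<lambda>x. f x - 0) = 0"
        using H_norm_AE_zero[OF op fin fm] by simp
      moreover have "(\<lambda>x. 0) \<in> shallow_nets d n \<sigma>"
        unfolding shallow_nets_def mem_Collect_eq
        by (intro exI[of _ "\<lambda>_. 0"] exI[of _ "\<lambda>_. x0"]) (simp add: x0s)
      ultimately show ?thesis by (intro bexI[of _ "\<lambda>x. 0"]) auto
    next
      case False
      interpret ridge_sampling d m \<Omega> x0 R p c J a N s \<kappa> g
        using assms(1) op fin R0 R x0s c chain decay J a N False
        by unfold_locales (auto simp: \<kappa>_def)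
      show ?thesis
        using network_exists[OF \<sigma>s fm inv n]
        unfolding C_def D_def K_def \<tau>_def .
    qed
    then obtain fn where fn: "fn \<in> shallow_nets d n \<sigma>"
      and le: "H_norm d m \<Omega> (\<lambda>x. f x - fn x) \<le> ennreal (sqrt (measure (lebp d) \<Omega>) * C R * real n powr (- (1 / 2)) * N)" by blast
    \<comment> \<open>Since \<open>ennreal\<close> truncates negative numbers to zero, splitting it
      over the product calls for nonnegative factors.\<close>
    have "C R \<ge> 0" using R0 J(1) c by (simp add: C_def D_def)
    hence "ennreal (sqrt (measure (lebp d) \<Omega>) * C R * real n powr (- (1 / 2)) * N)
      = ennreal (sqrt (measure (leb d) \<Omega>) * C (diam d \<Omega>) * real n powr (- (1 / 2))) * barron_norm d (real (m + 1)) f"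
      unfolding bn N(2) leb_def R_def[symmetric] using N(1) openin_sets_lebp[OF op]
      by (subst ennreal_mult) auto
    with le show "(INF f\<^sub>n \<in> shallow_nets d n \<sigma>. H_norm d m \<Omega> (\<lambda>x. f x - f\<^sub>n x))
        \<le> ennreal (sqrt (measure (leb d) \<Omega>) * C (diam d \<Omega>) * real n powr (- (1 / 2))) * barron_norm d (real (m + 1)) f"
      by (intro INF_lower2[OF fn]) simp
  qed
qed

end
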